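(* Let $(\mathsf{T},\mathsf{U},Q,D)$ be an Auslander--Gruson--Jensen (AGJ) duality triple. If $\mathcal{D}\subseteq\mathsf{T}$ is definable, then $\mathcal{D}$ is closed under extensions if and only if $\mathcal{D}^{d}$ is, and $\mathcal{D}$ is triangulated if and only if $\mathcal{D}^{d}$ is.
   Context: For a compactly generated triangulated category $\mathsf{T}$ with compact objects $\mathsf{T}^{\mathrm{c}}$, $\mathrm{Mod}(\mathsf{T}^{\mathrm{c}})$ is the category of additive functors $(\mathsf{T}^{\mathrm{c}})^{\mathrm{op}}\to\mathbf{Ab}$ and $\mathbf{y}X=\mathrm{Hom}_{\mathsf{T}}(-,X)|_{\mathsf{T}^{\mathrm{c}}}$. A morphism $X\to Y$ is a pure monomorphism if it sits in a triangle $X\to Y\to Z\to\Sigma X$ with $0\to\mathbf{y}X\to\mathbf{y}Y\to\mathbf{y}Z\to0$ exact; $X$ is pure injective if $\mathbf{y}X$ is injective. A class is closed under extensions if for each triangle $X\to Y\to Z\to\Sigma X$ with $X,Z$ in the class, $Y$ is in the class. A duality triple $(\mathsf{T},\mathsf{U},Q)$ consists of two compactly generated triangulated categories $\mathsf{T},\mathsf{U}$ and exact functors $Q\colon\mathsf{T}^{\mathrm{op}}\to\mathsf{U}$ and $Q\colon\mathsf{U}^{\mathrm{op}}\to\mathsf{T}$ (both denoted $Q$) such that: (1) $Q(X)$ is pure injective for every $X$ in $\mathsf{T}$ or $\mathsf{U}$; (2) for every $X$ in $\mathsf{T}$ or $\mathsf{U}$ there is a natural map $i_X\colon X\to Q^2(X)$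 which is a pure monomorphism; (3) $Q(i_X)\circ i_{Q(X)}$ is the identity for every $X$ in $\mathsf{T}$ or $\mathsf{U}$; (4) $Q(\bigoplus_I X_i)\simeq\prod_I Q(X_i)$ for every set of objects $\{X_i\}_I$ in $\mathsf{T}$ or in $\mathsf{U}$. An AGJ duality triple $(\mathsf{T},\mathsf{U},Q,D)$ is a duality triple together with functors $D\colon(\mathsf{T}^{\mathrm{c}})^{\mathrm{op}}\to\mathsf{U}^{\mathrm{c}}$ and $D\colon(\mathsf{U}^{\mathrm{c}})^{\mathrm{op}}\to\mathsf{T}^{\mathrm{c}}$ such that: (1) they form an adjoint equivalence between $\mathsf{T}^{\mathrm{c}}$ and $(\mathsf{U}^{\mathrm{c}})^{\mathrm{op}}$; (2) for all $C\in\mathsf{T}^{\mathrm{c}}$, $X\in\mathsf{T}$, $C'\in\mathsf{U}^{\mathrm{c}}$, $Y\in\mathsf{U}$ there are isomorphisms $\mathrm{Hom}_{\mathbb{Z}}(\mathrm{Hom}_{\mathsf{T}}(C,X),\mathbb{Q}/\mathbb{Z})\cong\mathrm{Hom}_{\mathsf{U}}(DC,QX)$ and $\mathrm{Hom}_{\mathbb{Z}}(\mathrm{Hom}_{\mathsf{U}}(C',Y),\mathbb{Q}/\mathbb{Z})\cong\mathrm{Hom}_{\mathsf{T}}(DC',QY)$, natural in both variables. A class $\mathcal{D}\subseteq\mathsf{T}$ is definable if there is a set of maps $f_i\colon A_i\to B_i$ in $\mathsf{T}^{\mathrm{c}}$ with $\mathcal{D}=\{X:\mathrm{Hom}_{\mathsf{T}}(f_i,X)\text{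 is surjective for all }i\}$. $(\mathsf{T}^{\mathrm{c}},\mathbf{Ab})^{\mathrm{fp}}$ is the category of finitely presented functors $G=\mathrm{coker}(\mathrm{Hom}_{\mathsf{T}}(f,-)|_{\mathsf{T}^{\mathrm{c}}})$, $f$ a map in $\mathsf{T}^{\mathrm{c}}$; $\widetilde{G}\colon\mathsf{T}\to\mathbf{Ab}$ is the same cokernel computed on $\mathsf{T}$. Put $\mathcal{S}_{\mathcal{D}}=\{G\in(\mathsf{T}^{\mathrm{c}},\mathbf{Ab})^{\mathrm{fp}}:\widetilde{G}(X)=0\ \forall X\in\mathcal{D}\}$ and $(\delta G)(Y)=\mathrm{Hom}_{(\mathsf{T}^{\mathrm{c}},\mathbf{Ab})}(G,\mathrm{Hom}_{\mathsf{T}}(DY,-))$, which defines an exact contravariant equivalence $\delta\colon(\mathsf{T}^{\mathrm{c}},\mathbf{Ab})^{\mathrm{fp}}\to(\mathsf{U}^{\mathrm{c}},\mathbf{Ab})^{\mathrm{fp}}$. The dual definable category is $\mathcal{D}^{d}=\{Y\in\mathsf{U}:\widetilde{H}(Y)=0\ \forall H\in\delta\mathcal{S}_{\mathcal{D}}\}$, a definable subcategory of $\mathsf{U}$. *)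

theory Defs
  imports "HOL-Algebra.Free_Abelian_Groups"
begin

unbundle cardinal_syntax


section \<open>Smallness\<close>

text \<open>
  The distinction between sets and classes is made relative to a universe: a set is small if
  its cardinality is less than that of the type \<open>'u\<close>. Families over small sets are
  indexed by small subsets of \<open>'u\<close> itself. The universe is required to be closed under the
  formation of power sets and of unions of small families, i.e. the cardinality of \<open>'u\<close> is
  strongly inaccessible, or countably infinite (the universe of hereditarily finite sets).
  The objects of a category are not required to form a small set.
\<close>

definition small :: "'u itself \<Rightarrow> 'x set \<Rightarrow> bool" where
  "small \<UU> A \<longleftrightarrow> |A| <o |UNIV :: 'u set|"

definition grothendieck_universe :: "'u itself \<Rightarrow> bool" where
  "grothendieck_universe \<UU> \<longleftrightarrow>
     infinite (UNIV :: 'u set) \<and>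
     (\<forall>A :: 'u set. small \<UU> A \<longrightarrow> small \<UU> (Pow A)) \<and>
     (\<forall>(I :: 'u set) (A :: 'u \<Rightarrow> 'u set).
        small \<UU> I \<and> (\<forall>i\<in>I. small \<UU> (A i)) \<longrightarrow> small \<UU> (\<Union>i\<in>I. A i))"


section \<open>Preadditive categories and functors\<close>

text \<open>The groups of morphisms are written multiplicatively, as everywhere in HOL-Algebra.\<close>

record ('o, 'm) cat =
  Obj :: "'o set"
  Dom :: "'m \<Rightarrow> 'o"
  Cod :: "'m \<Rightarrow> 'o"
  Hom :: "'o \<Rightarrow> 'o \<Rightarrow> 'm monoid"
  Cmp :: "'m \<Rightarrow> 'm \<Rightarrow> 'm"  (infixl \<open>\<cdot>\<index>\<close> 70)
  Idt :: "'o \<Rightarrow> 'm"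

abbreviation maps :: "('o, 'm, 'z) cat_scheme \<Rightarrow> 'o \<Rightarrow> 'o \<Rightarrow> 'm set" where
  "maps C A B \<equiv> carrier (Hom C A B)"

locale preadditive_category =
  fixes C :: "('o, 'm, 'z) cat_scheme" (structure)
  assumes hom_group: "\<lbrakk>X \<in> Obj C; Y \<in> Obj C\<rbrakk> \<Longrightarrow> comm_group (Hom C X Y)"
    and dom_cod: "\<lbrakk>X \<in> Obj C; Y \<in> Obj C; f \<in> maps C X Y\<rbrakk> \<Longrightarrow> Dom C f = X \<and> Cod C f = Y"
    and id_closed: "X \<in> Obj C \<Longrightarrow> Idt C X \<in> maps C X X"
    and comp_closed:
      "\<lbrakk>X \<in> Obj C; Y \<in> Obj C; Z \<in> Obj C; f \<in> maps C X Y; g \<in> maps C Y Z\<rbrakk>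
         \<Longrightarrow> g \<cdot> f \<in> maps C X Z"
    and comp_assoc:
      "\<lbrakk>W \<in> Obj C; X \<in> Obj C; Y \<in> Obj C; Z \<in> Obj C;
        f \<in> maps C W X; g \<in> maps C X Y; h \<in> maps C Y Z\<rbrakk>
         \<Longrightarrow> (h \<cdot> g) \<cdot> f = h \<cdot> (g \<cdot> f)"
    and id_left: "\<lbrakk>X \<in> Obj C; Y \<in> Obj C; f \<in> maps C X Y\<rbrakk> \<Longrightarrow> Idt C Y \<cdot> f = f"
    and id_right: "\<lbrakk>X \<in> Obj C; Y \<in> Obj C; f \<in> maps C X Y\<rbrakk> \<Longrightarrow> f \<cdot> Idt C X = f"
    and comp_add_left:
      "\<lbrakk>X \<in> Obj C; Y \<in> Obj C; Z \<in> Obj C; f \<in> maps C X Y; g \<in> maps C Y Z; g' \<in> maps C Y Z\<rbrakk>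
         \<Longrightarrow> (g \<otimes>\<^bsub>Hom C Y Z\<^esub> g') \<cdot> f = (g \<cdot> f) \<otimes>\<^bsub>Hom C X Z\<^esub> (g' \<cdot> f)"
    and comp_add_right:
      "\<lbrakk>X \<in> Obj C; Y \<in> Obj C; Z \<in> Obj C; f \<in> maps C X Y; f' \<in> maps C X Y; g \<in> maps C Y Z\<rbrakk>
         \<Longrightarrow> g \<cdot> (f \<otimes>\<^bsub>Hom C X Y\<^esub> f') = (g \<cdot> f) \<otimes>\<^bsub>Hom C X Z\<^esub> (g \<cdot> f')"

definition arrows :: "('o, 'm, 'z) cat_scheme \<Rightarrow> 'm set" where
  "arrows C = {f. Dom C f \<in> Obj C \<and> Cod C f \<in> Obj C \<and> f \<in> maps C (Dom C f) (Cod C f)}"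

definition opp :: "('o, 'm, 'z) cat_scheme \<Rightarrow> ('o, 'm) cat" where
  "opp C = \<lparr>Obj = Obj C, Dom = Cod C, Cod = Dom C, Hom = (\<lambda>A B. Hom C B A),
            Cmp = (\<lambda>g f. f \<cdot>\<^bsub>C\<^esub> g), Idt = Idt C\<rparr>"

definition full_subcategory :: "('o, 'm, 'z) cat_scheme \<Rightarrow> 'o set \<Rightarrow> ('o, 'm) cat" where
  "full_subcategory C S = \<lparr>Obj = S, Dom = Dom C, Cod = Cod C, Hom = Hom C, Cmp = Cmp C, Idt = Idt C\<rparr>"

definition is_iso :: "('o, 'm, 'z) cat_scheme \<Rightarrow> 'o \<Rightarrow> 'o \<Rightarrow> 'm \<Rightarrow> bool" where
  "is_iso C A B f \<longleftrightarrow>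
     f \<in> maps C A B \<and> (\<exists>g \<in> maps C B A. g \<cdot>\<^bsub>C\<^esub> f = Idt C A \<and> f \<cdot>\<^bsub>C\<^esub> g = Idt C B)"

definition zero_object :: "('o, 'm, 'z) cat_scheme \<Rightarrow> 'o \<Rightarrow> bool" where
  "zero_object C Z \<longleftrightarrow>
     Z \<in> Obj C \<and> (\<forall>X\<in>Obj C. (\<exists>!f. f \<in> maps C X Z) \<and> (\<exists>!f. f \<in> maps C Z X))"

locale additive_category = preadditive_category +
  assumes ex_zero: "\<exists>Z. zero_object C Z"
    and ex_biproduct:
      "\<lbrakk>X \<in> Obj C; Y \<in> Obj C\<rbrakk> \<Longrightarrow>
         \<exists>P \<in> Obj C. \<exists>i \<in> maps C X P. \<exists>j \<in> maps C Y P. \<exists>p \<in> maps C P X. \<exists>q \<in> maps C P Y.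
           p \<cdot> i = Idt C X \<and> q \<cdot> j = Idt C Y \<and>
           p \<cdot> j = \<one>\<^bsub>Hom C Y X\<^esub> \<and> q \<cdot> i = \<one>\<^bsub>Hom C X Y\<^esub> \<and>
           (i \<cdot> p) \<otimes>\<^bsub>Hom C P P\<^esub> (j \<cdot> q) = Idt C P"

record ('o, 'm, 'p, 'n) ftor =
  fo :: "'o \<Rightarrow> 'p"
  fm :: "'m \<Rightarrow> 'n"

definition id_ftor :: "('o, 'm, 'o, 'm) ftor" where
  "id_ftor = \<lparr>fo = (\<lambda>X. X), fm = (\<lambda>f. f)\<rparr>"

definition comp_ftor ::
    "('p, 'n, 'q, 'k) ftor \<Rightarrow> ('o, 'm, 'p, 'n) ftor \<Rightarrow> ('o, 'm, 'q, 'k) ftor"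
    (infixl \<open>\<circ>\<^sub>F\<close> 55) where
  "G \<circ>\<^sub>F F = \<lparr>fo = fo G \<circ> fo F, fm = fm G \<circ> fm F\<rparr>"

text \<open>
  A contravariant functor from \<open>C\<close> to \<open>E\<close> is a functor \<open>opp C\<close> to \<open>E\<close>; the same record is then
  also a functor from \<open>C\<close> to \<open>opp E\<close>.
\<close>

definition is_functor ::
    "('o, 'm, 'y) cat_scheme \<Rightarrow> ('p, 'n, 'z) cat_scheme \<Rightarrow> ('o, 'm, 'p, 'n) ftor \<Rightarrow> bool" where
  "is_functor C E F \<longleftrightarrow>
     (\<forall>X\<in>Obj C. fo F X \<in> Obj E \<and> fm F (Idt C X) = Idt E (fo F X)) \<and>
     (\<forall>X\<in>Obj C. \<forall>Y\<in>Obj C. \<forall>f\<in>maps C X Y. fm F f \<in> maps E (fo F X) (fo F Y)) \<and>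
     (\<forall>X\<in>Obj C. \<forall>Y\<in>Obj C. \<forall>Z\<in>Obj C. \<forall>f\<in>maps C X Y. \<forall>g\<in>maps C Y Z.
        fm F (g \<cdot>\<^bsub>C\<^esub> f) = fm F g \<cdot>\<^bsub>E\<^esub> fm F f)"

definition additive_functor ::
    "('o, 'm, 'y) cat_scheme \<Rightarrow> ('p, 'n, 'z) cat_scheme \<Rightarrow> ('o, 'm, 'p, 'n) ftor \<Rightarrow> bool" where
  "additive_functor C E F \<longleftrightarrow>
     is_functor C E F \<and>
     (\<forall>X\<in>Obj C. \<forall>Y\<in>Obj C. fm F \<in> hom (Hom C X Y) (Hom E (fo F X) (fo F Y)))"

definition is_nat ::
    "('o, 'm, 'y) cat_scheme \<Rightarrow> ('p, 'n, 'z) cat_scheme \<Rightarrow>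
     ('o, 'm, 'p, 'n) ftor \<Rightarrow> ('o, 'm, 'p, 'n) ftor \<Rightarrow> ('o \<Rightarrow> 'n) \<Rightarrow> bool" where
  "is_nat C E F G \<eta> \<longleftrightarrow>
     (\<forall>X\<in>Obj C. \<eta> X \<in> maps E (fo F X) (fo G X)) \<and>
     (\<forall>X\<in>Obj C. \<forall>Y\<in>Obj C. \<forall>f\<in>maps C X Y. \<eta> Y \<cdot>\<^bsub>E\<^esub> fm F f = fm G f \<cdot>\<^bsub>E\<^esub> \<eta> X)"

definition is_nat_iso ::
    "('o, 'm, 'y) cat_scheme \<Rightarrow> ('p, 'n, 'z) cat_scheme \<Rightarrow>
     ('o, 'm, 'p, 'n) ftor \<Rightarrow> ('o, 'm, 'p, 'n) ftor \<Rightarrow> ('o \<Rightarrow> 'n) \<Rightarrow> bool" where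
  "is_nat_iso C E F G \<eta> \<longleftrightarrow>
     is_nat C E F G \<eta> \<and> (\<forall>X\<in>Obj C. is_iso E (fo F X) (fo G X) (\<eta> X))"

definition is_equivalence ::
    "('o, 'm, 'y) cat_scheme \<Rightarrow> ('p, 'n, 'z) cat_scheme \<Rightarrow> ('o, 'm, 'p, 'n) ftor \<Rightarrow> bool" where
  "is_equivalence C E F \<longleftrightarrow>
     is_functor C E F \<and>
     (\<exists>G. is_functor E C G \<and>
          (\<exists>\<eta>. is_nat_iso C C id_ftor (G \<circ>\<^sub>F F) \<eta>) \<and>
          (\<exists>\<epsilon>. is_nat_iso E E (F \<circ>\<^sub>F G) id_ftor \<epsilon>))"

definition adjoint_equivalence ::
    "('o, 'm, 'y) cat_scheme \<Rightarrow> ('p, 'n, 'z) cat_scheme \<Rightarrow>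
     ('o, 'm, 'p, 'n) ftor \<Rightarrow> ('p, 'n, 'o, 'm) ftor \<Rightarrow> bool" where
  "adjoint_equivalence C E F G \<longleftrightarrow>
     is_functor C E F \<and> is_functor E C G \<and>
     (\<exists>\<eta> \<epsilon>. is_nat_iso C C id_ftor (G \<circ>\<^sub>F F) \<eta> \<and> is_nat_iso E E (F \<circ>\<^sub>F G) id_ftor \<epsilon> \<and>
        (\<forall>X\<in>Obj C. \<epsilon> (fo F X) \<cdot>\<^bsub>E\<^esub> fm F (\<eta> X) = Idt E (fo F X)) \<and>
        (\<forall>Y\<in>Obj E. fm G (\<epsilon> Y) \<cdot>\<^bsub>C\<^esub> \<eta> (fo G Y) = Idt C (fo G Y)))"

definition is_coproduct ::
    "('o, 'm, 'z) cat_scheme \<Rightarrow> 'i set \<Rightarrow> ('i \<Rightarrow> 'o) \<Rightarrow> 'o \<Rightarrow> ('i \<Rightarrow> 'm) \<Rightarrow> bool" where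
  "is_coproduct C I X P \<iota> \<longleftrightarrow>
     P \<in> Obj C \<and> (\<forall>i\<in>I. X i \<in> Obj C \<and> \<iota> i \<in> maps C (X i) P) \<and>
     (\<forall>Y\<in>Obj C. \<forall>f. (\<forall>i\<in>I. f i \<in> maps C (X i) Y) \<longrightarrow>
        (\<exists>!u. u \<in> maps C P Y \<and> (\<forall>i\<in>I. u \<cdot>\<^bsub>C\<^esub> \<iota> i = f i)))"

definition is_product ::
    "('o, 'm, 'z) cat_scheme \<Rightarrow> 'i set \<Rightarrow> ('i \<Rightarrow> 'o) \<Rightarrow> 'o \<Rightarrow> ('i \<Rightarrow> 'm) \<Rightarrow> bool" where
  "is_product C I X P \<pi> \<longleftrightarrow> is_coproduct (opp C) I X P \<pi>"


section \<open>Functors with values in abelian groups\<close>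

record ('o, 'm, 'a) abftor =
  ao :: "'o \<Rightarrow> 'a monoid"
  am :: "'m \<Rightarrow> 'a \<Rightarrow> 'a"

definition is_ab_functor :: "('o, 'm, 'z) cat_scheme \<Rightarrow> ('o, 'm, 'a) abftor \<Rightarrow> bool" where
  "is_ab_functor C F \<longleftrightarrow>
     (\<forall>X\<in>Obj C. comm_group (ao F X)) \<and>
     (\<forall>X\<in>Obj C. \<forall>x\<in>carrier (ao F X). am F (Idt C X) x = x) \<and>
     (\<forall>X\<in>Obj C. \<forall>Y\<in>Obj C. \<forall>f\<in>maps C X Y. am F f \<in> hom (ao F X) (ao F Y)) \<and>
     (\<forall>X\<in>Obj C. \<forall>Y\<in>Obj C. \<forall>Z\<in>Obj C. \<forall>f\<in>maps C X Y. \<forall>g\<in>maps C Y Z. \<forall>x\<in>carrier (ao F X).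
        am F (g \<cdot>\<^bsub>C\<^esub> f) x = am F g (am F f x)) \<and>
     (\<forall>X\<in>Obj C. \<forall>Y\<in>Obj C. \<forall>f\<in>maps C X Y. \<forall>g\<in>maps C X Y. \<forall>x\<in>carrier (ao F X).
        am F (f \<otimes>\<^bsub>Hom C X Y\<^esub> g) x = am F f x \<otimes>\<^bsub>ao F Y\<^esub> am F g x)"

definition is_ab_nat ::
    "('o, 'm, 'z) cat_scheme \<Rightarrow> ('o, 'm, 'a) abftor \<Rightarrow> ('o, 'm, 'b) abftor \<Rightarrow> ('o \<Rightarrow> 'a \<Rightarrow> 'b) \<Rightarrow> bool"
  where
  "is_ab_nat C F G \<eta> \<longleftrightarrow>
     (\<forall>X\<in>Obj C. \<eta> X \<in> hom (ao F X) (ao G X)) \<and>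
     (\<forall>X\<in>Obj C. \<forall>Y\<in>Obj C. \<forall>f\<in>maps C X Y. \<forall>x\<in>carrier (ao F X).
        \<eta> Y (am F f x) = am G f (\<eta> X x))"

definition ab_isomorphic ::
    "('o, 'm, 'z) cat_scheme \<Rightarrow> ('o, 'm, 'a) abftor \<Rightarrow> ('o, 'm, 'b) abftor \<Rightarrow> bool" where
  "ab_isomorphic C F G \<longleftrightarrow>
     (\<exists>\<eta>. is_ab_nat C F G \<eta> \<and> (\<forall>X\<in>Obj C. \<eta> X \<in> iso (ao F X) (ao G X)))"

text \<open>
  Natural transformations are cut down to the elements of the groups \<open>F X\<close>, so that they are
  equal as soon as they agree there.
\<close>

definition nat_group ::
    "('o, 'm, 'z) cat_scheme \<Rightarrow> ('o, 'm, 'a) abftor \<Rightarrow> ('o, 'm, 'b) abftor \<Rightarrow> ('o \<Rightarrow> 'a \<Rightarrow> 'b) monoid"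
  where
  "nat_group C F G =
     \<lparr>carrier = {\<eta> \<in> \<Pi>\<^sub>E X\<in>Obj C. extensional (carrier (ao F X)). is_ab_nat C F G \<eta>},
      mult = (\<lambda>\<eta> \<theta>. \<lambda>X\<in>Obj C. \<lambda>x\<in>carrier (ao F X). \<eta> X x \<otimes>\<^bsub>ao G X\<^esub> \<theta> X x),
      one = (\<lambda>X\<in>Obj C. \<lambda>x\<in>carrier (ao F X). \<one>\<^bsub>ao G X\<^esub>)\<rparr>"

definition short_exact ::
    "('o, 'm, 'z) cat_scheme \<Rightarrow> ('o, 'm, 'a) abftor \<Rightarrow> ('o, 'm, 'b) abftor \<Rightarrow> ('o, 'm, 'c) abftor \<Rightarrow>
     ('o \<Rightarrow> 'a \<Rightarrow> 'b) \<Rightarrow> ('o \<Rightarrow> 'b \<Rightarrow> 'c) \<Rightarrow> bool" where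
  "short_exact C F G H \<alpha> \<beta> \<longleftrightarrow>
     is_ab_nat C F G \<alpha> \<and> is_ab_nat C G H \<beta> \<and>
     (\<forall>X\<in>Obj C.
        inj_on (\<alpha> X) (carrier (ao F X)) \<and>
        \<alpha> X ` carrier (ao F X) = kernel (ao G X) (ao H X) (\<beta> X) \<and>
        \<beta> X ` carrier (ao G X) = carrier (ao H X))"

text \<open>
  Injectivity of \<open>M\<close> in the category of additive functors from \<open>C\<close> to small abelian groups.
  Every small group is isomorphic to one with carrier in \<open>'u\<close>, so it is enough to test against
  functors with values in such groups. Monomorphisms of functors are pointwise injective.
\<close>

definition is_small_ab_functor ::
    "'u itself \<Rightarrow> ('o, 'm, 'z) cat_scheme \<Rightarrow> ('o, 'm, 'a) abftor \<Rightarrow> bool" where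
  "is_small_ab_functor \<UU> C F \<longleftrightarrow> is_ab_functor C F \<and> (\<forall>X\<in>Obj C. small \<UU> (carrier (ao F X)))"

definition injective_ab_functor ::
    "'u itself \<Rightarrow> ('o, 'm, 'z) cat_scheme \<Rightarrow> ('o, 'm, 'a) abftor \<Rightarrow> bool" where
  "injective_ab_functor \<UU> C M \<longleftrightarrow>
     (\<forall>(F :: ('o, 'm, 'u) abftor) (G :: ('o, 'm, 'u) abftor) \<mu> \<alpha>.
        is_small_ab_functor \<UU> C F \<and> is_small_ab_functor \<UU> C G \<and>
        is_ab_nat C F G \<mu> \<and> (\<forall>X\<in>Obj C. inj_on (\<mu> X) (carrier (ao F X))) \<and>
        is_ab_nat C F M \<alpha> \<longrightarrow>
        (\<exists>\<beta>. is_ab_nat C G M \<beta> \<and>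
             (\<forall>X\<in>Obj C. \<forall>x\<in>carrier (ao F X). \<beta> X (\<mu> X x) = \<alpha> X x)))"


section \<open>Triangulated categories\<close>

text \<open>\<open>Tri T X Y Z f g h\<close>: the diagram \<open>X -f-> Y -g-> Z -h-> \<Sigma>X\<close> is a (distinguished) triangle.\<close>

record ('o, 'm) tcat = "('o, 'm) cat" +
  Sus :: "('o, 'm, 'o, 'm) ftor"
  Tri :: "'o \<Rightarrow> 'o \<Rightarrow> 'o \<Rightarrow> 'm \<Rightarrow> 'm \<Rightarrow> 'm \<Rightarrow> bool"

abbreviation sus :: "('o, 'm, 'z) tcat_scheme \<Rightarrow> 'o \<Rightarrow> 'o" where
  "sus T X \<equiv> fo (Sus T) X"

abbreviation susm :: "('o, 'm, 'z) tcat_scheme \<Rightarrow> 'm \<Rightarrow> 'm" where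
  "susm T f \<equiv> fm (Sus T) f"

locale triangulated_category = additive_category T for T :: "('o, 'm, 'z) tcat_scheme" (structure) +
  assumes sus_additive: "additive_functor T T (Sus T)"
    and sus_equivalence: "is_equivalence T T (Sus T)"
    and tri_closed:
      "Tri T X Y Z f g h \<Longrightarrow>
         X \<in> Obj T \<and> Y \<in> Obj T \<and> Z \<in> Obj T \<and>
         f \<in> maps T X Y \<and> g \<in> maps T Y Z \<and> h \<in> maps T Z (sus T X)"
    and tri_iso:
      "\<lbrakk>Tri T X Y Z f g h; X' \<in> Obj T; Y' \<in> Obj T; Z' \<in> Obj T;
        f' \<in> maps T X' Y'; g' \<in> maps T Y' Z'; h' \<in> maps T Z' (sus T X');
        is_iso T X X' a; is_iso T Y Y' b; is_iso T Z Z' c;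
        b \<cdot> f = f' \<cdot> a; c \<cdot> g = g' \<cdot> b; susm T a \<cdot> h = h' \<cdot> c\<rbrakk>
         \<Longrightarrow> Tri T X' Y' Z' f' g' h'"
    and tri_id:
      "\<lbrakk>X \<in> Obj T; zero_object T Z\<rbrakk> \<Longrightarrow>
         Tri T X X Z (Idt T X) \<one>\<^bsub>Hom T X Z\<^esub> \<one>\<^bsub>Hom T Z (sus T X)\<^esub>"
    and tri_cone:
      "\<lbrakk>X \<in> Obj T; Y \<in> Obj T; f \<in> maps T X Y\<rbrakk> \<Longrightarrow> \<exists>Z g h. Tri T X Y Z f g h"
    and tri_rotate:
      "\<lbrakk>X \<in> Obj T; Y \<in> Obj T; Z \<in> Obj T;
        f \<in> maps T X Y; g \<in> maps T Y Z; h \<in> maps T Z (sus T X)\<rbrakk> \<Longrightarrow>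
         Tri T X Y Z f g h \<longleftrightarrow>
         Tri T Y Z (sus T X) g h (inv\<^bsub>Hom T (sus T X) (sus T Y)\<^esub> (susm T f))"
    and tri_morphism:
      "\<lbrakk>Tri T X Y Z f g h; Tri T X' Y' Z' f' g' h';
        a \<in> maps T X X'; b \<in> maps T Y Y'; b \<cdot> f = f' \<cdot> a\<rbrakk> \<Longrightarrow>
         \<exists>c \<in> maps T Z Z'. c \<cdot> g = g' \<cdot> b \<and> susm T a \<cdot> h = h' \<cdot> c"
    and tri_octahedral:
      "\<lbrakk>Tri T X Y Z' f f' f''; Tri T Y Z X' g g' g''; Tri T X Z Y' (g \<cdot> f) h' h''\<rbrakk> \<Longrightarrow>
         \<exists>u v. Tri T Z' Y' X' u v (susm T f' \<cdot> g'') \<and>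
           u \<cdot> f' = h' \<cdot> g \<and> h'' \<cdot> u = f'' \<and> v \<cdot> h' = g' \<and> g'' \<cdot> v = susm T f \<cdot> h''"

text \<open>
  A contravariant exact functor. In the opposite of a triangulated category the suspension is
  \<open>\<Sigma>\<inverse>\<close>, so compatibility with suspensions is an isomorphism between \<open>Q\<close> and \<open>\<Sigma> Q \<Sigma>\<close>.
  The two sign conventions in use for the triangles of an opposite category yield the same exact
  functors, since \<open>\<phi>\<close> can be replaced by \<open>- \<phi>\<close>.
\<close>

definition exact_contravariant ::
    "('o, 'm, 'y) tcat_scheme \<Rightarrow> ('p, 'n, 'z) tcat_scheme \<Rightarrow> ('o, 'm, 'p, 'n) ftor \<Rightarrow> bool" where
  "exact_contravariant T U Q \<longleftrightarrow>
     additive_functor (opp T) U Q \<and>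
     (\<exists>\<phi>. is_nat_iso (opp T) U Q (Sus U \<circ>\<^sub>F Q \<circ>\<^sub>F Sus T) \<phi> \<and>
        (\<forall>X Y Z f g h. Tri T X Y Z f g h \<longrightarrow>
           Tri U (fo Q Z) (fo Q Y) (fo Q X) (fm Q g) (fm Q f) (susm U (fm Q h) \<cdot>\<^bsub>U\<^esub> \<phi> X)))"

definition extension_closed :: "('o, 'm, 'z) tcat_scheme \<Rightarrow> 'o set \<Rightarrow> bool" where
  "extension_closed T \<D> \<longleftrightarrow>
     (\<forall>X Y Z f g h. Tri T X Y Z f g h \<and> X \<in> \<D> \<and> Z \<in> \<D> \<longrightarrow> Y \<in> \<D>)"

definition triangulated_subcategory :: "('o, 'm, 'z) tcat_scheme \<Rightarrow> 'o set \<Rightarrow> bool" where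
  "triangulated_subcategory T \<D> \<longleftrightarrow>
     \<D> \<subseteq> Obj T \<and> (\<exists>Z\<in>\<D>. zero_object T Z) \<and>
     (\<forall>X\<in>Obj T. sus T X \<in> \<D> \<longleftrightarrow> X \<in> \<D>) \<and>
     (\<forall>X Y Z f g h. Tri T X Y Z f g h \<longrightarrow>
        (X \<in> \<D> \<and> Y \<in> \<D> \<longrightarrow> Z \<in> \<D>) \<and> (Y \<in> \<D> \<and> Z \<in> \<D> \<longrightarrow> X \<in> \<D>) \<and> (X \<in> \<D> \<and> Z \<in> \<D> \<longrightarrow> Y \<in> \<D>))"


section \<open>Compact objects and purity\<close>

text \<open>
  \<open>C\<close> is compact if the canonical map from the direct sum of the groups \<open>Hom(C, X i)\<close> to
  \<open>Hom(C, P)\<close> is an isomorphism for each small coproduct \<open>P\<close> of objects \<open>X i\<close>; \<open>gfinprod\<close> adds up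
  the finitely many nonzero terms.
\<close>

definition compact_object :: "'u itself \<Rightarrow> ('o, 'm, 'z) cat_scheme \<Rightarrow> 'o \<Rightarrow> bool" where
  "compact_object \<UU> T C \<longleftrightarrow>
     C \<in> Obj T \<and>
     (\<forall>(I :: 'u set) X P \<iota>. small \<UU> I \<and> is_coproduct T I X P \<iota> \<longrightarrow>
        (\<lambda>x. gfinprod (Hom T C P) (\<lambda>i. \<iota> i \<cdot>\<^bsub>T\<^esub> x i) I)
          \<in> iso (sum_group I (\<lambda>i. Hom T C (X i))) (Hom T C P))"

definition Cpt :: "'u itself \<Rightarrow> ('o, 'm, 'z) cat_scheme \<Rightarrow> ('o, 'm) cat" where
  "Cpt \<UU> T = full_subcategory T {C. compact_object \<UU> T C}"

text \<open>
  The generation condition: \<open>X\<close> is zero if \<open>Hom(\<Sigma>\<^sup>n C, X)\<close> vanishes for all \<open>C\<close> in \<open>\<G>\<close> and all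
  integers \<open>n\<close>; a negative \<open>n\<close> is moved to the second argument of \<open>Hom\<close>.
\<close>

definition compactly_generated :: "'u itself \<Rightarrow> ('o, 'm, 'z) tcat_scheme \<Rightarrow> bool" where
  "compactly_generated \<UU> T \<longleftrightarrow>
     triangulated_category T \<and>
     (\<forall>X\<in>Obj T. \<forall>Y\<in>Obj T. small \<UU> (maps T X Y)) \<and>
     (\<forall>(I :: 'u set) X. small \<UU> I \<and> X \<in> I \<rightarrow> Obj T \<longrightarrow> (\<exists>P \<iota>. is_coproduct T I X P \<iota>)) \<and>
     (\<exists>\<G>. small \<UU> \<G> \<and> \<G> \<subseteq> {C. compact_object \<UU> T C} \<and>
        (\<forall>X\<in>Obj T.
           (\<forall>C\<in>\<G>. \<forall>n. maps T ((sus T ^^ n) C) X = {\<one>\<^bsub>Hom T ((sus T ^^ n) C) X\<^esub>} \<and>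
                       maps T C ((sus T ^^ n) X) = {\<one>\<^bsub>Hom T C ((sus T ^^ n) X)\<^esub>})
           \<longrightarrow> zero_object T X))"

text \<open>The functor \<open>\<^bold>y X = Hom(-, X)\<close>, used as a functor on the opposite of the compact objects.\<close>

definition yon :: "('o, 'm, 'z) cat_scheme \<Rightarrow> 'o \<Rightarrow> ('o, 'm, 'm) abftor" where
  "yon T X = \<lparr>ao = (\<lambda>C. Hom T C X), am = (\<lambda>f u. u \<cdot>\<^bsub>T\<^esub> f)\<rparr>"

definition yon_map :: "('o, 'm, 'z) cat_scheme \<Rightarrow> 'm \<Rightarrow> 'o \<Rightarrow> 'm \<Rightarrow> 'm" where
  "yon_map T g = (\<lambda>C u. g \<cdot>\<^bsub>T\<^esub> u)"

definition pure_mono :: "'u itself \<Rightarrow> ('o, 'm, 'z) tcat_scheme \<Rightarrow> 'o \<Rightarrow> 'o \<Rightarrow> 'm \<Rightarrow> bool" where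
  "pure_mono \<UU> T X Y f \<longleftrightarrow>
     (\<exists>Z g h. Tri T X Y Z f g h \<and>
        short_exact (opp (Cpt \<UU> T)) (yon T X) (yon T Y) (yon T Z) (yon_map T f) (yon_map T g))"

definition pure_injective :: "'u itself \<Rightarrow> ('o, 'm, 'z) tcat_scheme \<Rightarrow> 'o \<Rightarrow> bool" where
  "pure_injective \<UU> T X \<longleftrightarrow> X \<in> Obj T \<and> injective_ab_functor \<UU> (opp (Cpt \<UU> T)) (yon T X)"


section \<open>Duality triples\<close>

text \<open>The two contravariant functors called \<open>Q\<close> are kept apart: \<open>Q\<close> goes from \<open>T\<close> to \<open>U\<close>, and \<open>Q'\<close> from
  \<open>U\<close> to \<open>T\<close>; likewise for \<open>D\<close> and \<open>D'\<close> below.\<close>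

definition coproducts_to_products ::
    "'u itself \<Rightarrow> ('o, 'm, 'y) cat_scheme \<Rightarrow> ('p, 'n, 'z) cat_scheme \<Rightarrow> ('o, 'm, 'p, 'n) ftor \<Rightarrow> bool"
  where
  "coproducts_to_products \<UU> T U Q \<longleftrightarrow>
     (\<forall>(I :: 'u set) X P \<iota>. small \<UU> I \<and> is_coproduct T I X P \<iota> \<longrightarrow>
        (\<exists>\<pi>. is_product U I (\<lambda>i. fo Q (X i)) (fo Q P) \<pi>))"

definition duality_triple ::
    "'u itself \<Rightarrow> ('o, 'm, 'y) tcat_scheme \<Rightarrow> ('p, 'n, 'z) tcat_scheme \<Rightarrow>
     ('o, 'm, 'p, 'n) ftor \<Rightarrow> ('p, 'n, 'o, 'm) ftor \<Rightarrow> bool" where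
  "duality_triple \<UU> T U Q Q' \<longleftrightarrow>
     compactly_generated \<UU> T \<and> compactly_generated \<UU> U \<and>
     exact_contravariant T U Q \<and> exact_contravariant U T Q' \<and>
     (\<forall>X\<in>Obj T. pure_injective \<UU> U (fo Q X)) \<and>
     (\<forall>Y\<in>Obj U. pure_injective \<UU> T (fo Q' Y)) \<and>
     (\<exists>i j.
        is_nat T T id_ftor (Q' \<circ>\<^sub>F Q) i \<and>
        is_nat U U id_ftor (Q \<circ>\<^sub>F Q') j \<and>
        (\<forall>X\<in>Obj T. pure_mono \<UU> T X (fo Q' (fo Q X)) (i X)) \<and>
        (\<forall>Y\<in>Obj U. pure_mono \<UU> U Y (fo Q (fo Q' Y)) (j Y)) \<and>
        (\<forall>X\<in>Obj T. fm Q (i X) \<cdot>\<^bsub>U\<^esub> j (fo Q X) = Idt U (fo Q X)) \<and>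
        (\<forall>Y\<in>Obj U. fm Q' (j Y) \<cdot>\<^bsub>T\<^esub> i (fo Q' Y) = Idt T (fo Q' Y))) \<and>
     coproducts_to_products \<UU> T U Q \<and> coproducts_to_products \<UU> U T Q'"

definition QmodZ :: "rat set monoid" where
  "QmodZ = \<lparr>carrier = UNIV, mult = (+), one = (0 :: rat)\<rparr> Mod \<int>"

definition hom_group :: "('a, 'y) monoid_scheme \<Rightarrow> ('b, 'z) monoid_scheme \<Rightarrow> ('a \<Rightarrow> 'b) monoid" where
  "hom_group G H =
     \<lparr>carrier = hom G H \<inter> extensional (carrier G),
      mult = (\<lambda>\<phi> \<psi>. \<lambda>x\<in>carrier G. \<phi> x \<otimes>\<^bsub>H\<^esub> \<psi> x),
      one = (\<lambda>x\<in>carrier G. \<one>\<^bsub>H\<^esub>)\<rparr>"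

definition AGJ_natural_iso ::
    "'u itself \<Rightarrow> ('o, 'm, 'y) cat_scheme \<Rightarrow> ('p, 'n, 'z) cat_scheme \<Rightarrow>
     ('o, 'm, 'p, 'n) ftor \<Rightarrow> ('o, 'm, 'p, 'n) ftor \<Rightarrow> bool" where
  "AGJ_natural_iso \<UU> T U Q D \<longleftrightarrow>
     (\<exists>\<theta>.
        (\<forall>C\<in>Obj (Cpt \<UU> T). \<forall>X\<in>Obj T.
           \<theta> C X \<in> iso (hom_group (Hom T C X) QmodZ) (Hom U (fo D C) (fo Q X))) \<and>
        (\<forall>C\<in>Obj (Cpt \<UU> T). \<forall>C'\<in>Obj (Cpt \<UU> T). \<forall>X\<in>Obj T. \<forall>X'\<in>Obj T.
           \<forall>c\<in>maps T C C'. \<forall>x\<in>maps T X' X. \<forall>\<phi>\<in>carrier (hom_group (Hom T C X) QmodZ).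
             \<theta> C' X' (\<lambda>u\<in>maps T C' X'. \<phi> (x \<cdot>\<^bsub>T\<^esub> u \<cdot>\<^bsub>T\<^esub> c)) =
             fm Q x \<cdot>\<^bsub>U\<^esub> \<theta> C X \<phi> \<cdot>\<^bsub>U\<^esub> fm D c))"

definition AGJ_duality_triple ::
    "'u itself \<Rightarrow> ('o, 'm, 'y) tcat_scheme \<Rightarrow> ('p, 'n, 'z) tcat_scheme \<Rightarrow>
     ('o, 'm, 'p, 'n) ftor \<Rightarrow> ('p, 'n, 'o, 'm) ftor \<Rightarrow>
     ('o, 'm, 'p, 'n) ftor \<Rightarrow> ('p, 'n, 'o, 'm) ftor \<Rightarrow> bool" where
  "AGJ_duality_triple \<UU> T U Q Q' D D' \<longleftrightarrow>
     duality_triple \<UU> T U Q Q' \<and>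
     adjoint_equivalence (Cpt \<UU> T) (opp (Cpt \<UU> U)) D D' \<and>
     AGJ_natural_iso \<UU> T U Q D \<and> AGJ_natural_iso \<UU> U T Q' D'"


section \<open>Definable subcategories and their duals\<close>

definition definable :: "'u itself \<Rightarrow> ('o, 'm, 'z) cat_scheme \<Rightarrow> 'o set \<Rightarrow> bool" where
  "definable \<UU> T \<D> \<longleftrightarrow>
     (\<exists>\<Phi>. small \<UU> \<Phi> \<and> \<Phi> \<subseteq> arrows (Cpt \<UU> T) \<and>
        \<D> = {X \<in> Obj T. \<forall>f\<in>\<Phi>. (\<lambda>u. u \<cdot>\<^bsub>T\<^esub> f) ` maps T (Cod T f) X = maps T (Dom T f) X})"

text \<open>The functor \<open>Hom(A, -)\<close>.\<close>

definition corep :: "('o, 'm, 'z) cat_scheme \<Rightarrow> 'o \<Rightarrow> ('o, 'm, 'm) abftor" where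
  "corep T A = \<lparr>ao = (\<lambda>X. Hom T A X), am = (\<lambda>g u. g \<cdot>\<^bsub>T\<^esub> u)\<rparr>"

text \<open>
  The cokernel of \<open>Hom(f, -): Hom(B, -) -> Hom(A, -)\<close> for \<open>f: A -> B\<close>. An arrow \<open>g: X -> X'\<close> maps the coset of \<open>k: A -> X\<close> to
  the coset of \<open>g \<cdot> k\<close>; the union below is over equal cosets. The same record is used as a
  functor on the compact objects and as a functor on all of \<open>T\<close>.
\<close>

definition coker :: "('o, 'm, 'z) cat_scheme \<Rightarrow> 'm \<Rightarrow> ('o, 'm, 'm set) abftor" where
  "coker T f =
     \<lparr>ao = (\<lambda>X. Hom T (Dom T f) X Mod ((\<lambda>u. u \<cdot>\<^bsub>T\<^esub> f) ` maps T (Cod T f) X)),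
      am = (\<lambda>g K. \<Union>k\<in>K.
              ((\<lambda>u. u \<cdot>\<^bsub>T\<^esub> f) ` maps T (Cod T f) (Cod T g)) #>\<^bsub>Hom T (Dom T f) (Cod T g)\<^esub> (g \<cdot>\<^bsub>T\<^esub> k))\<rparr>"

definition presents ::
    "'u itself \<Rightarrow> ('o, 'm, 'z) cat_scheme \<Rightarrow> 'm \<Rightarrow> ('o, 'm, 'a) abftor \<Rightarrow> bool" where
  "presents \<UU> T f G \<longleftrightarrow> f \<in> arrows (Cpt \<UU> T) \<and> ab_isomorphic (Cpt \<UU> T) G (coker T f)"

definition finitely_presented ::
    "'u itself \<Rightarrow> ('o, 'm, 'z) cat_scheme \<Rightarrow> ('o, 'm, 'a) abftor \<Rightarrow> bool" where
  "finitely_presented \<UU> T G \<longleftrightarrow> is_ab_functor (Cpt \<UU> T) G \<and> (\<exists>f. presents \<UU> T f G)"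

text \<open>
  The extension of a finitely presented functor \<open>G\<close> to \<open>T\<close>, formed by means of some
  presentation. Up to isomorphism it does not depend on which one is chosen.
\<close>

definition fp_ext ::
    "'u itself \<Rightarrow> ('o, 'm, 'z) cat_scheme \<Rightarrow> ('o, 'm, 'a) abftor \<Rightarrow> ('o, 'm, 'm set) abftor" where
  "fp_ext \<UU> T G = coker T (SOME f. presents \<UU> T f G)"

text \<open>
  The values of the functors in \<open>annihilated\<close> are groups of elements of type \<open>'m set\<close>. These
  include the cokernels themselves, hence represent all finitely presented functors.
\<close>

definition annihilated ::
    "'u itself \<Rightarrow> ('o, 'm, 'z) cat_scheme \<Rightarrow> 'o set \<Rightarrow> ('o, 'm, 'm set) abftor set" where
  "annihilated \<UU> T \<D> =
     {G. finitely_presented \<UU> T G \<and> (\<forall>X\<in>\<D>. trivial_group (ao (fp_ext \<UU> T G) X))}"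

definition delta ::
    "'u itself \<Rightarrow> ('o, 'm, 'z) cat_scheme \<Rightarrow> ('p, 'n, 'o, 'm) ftor \<Rightarrow>
     ('o, 'm, 'a) abftor \<Rightarrow> ('p, 'n, 'o \<Rightarrow> 'a \<Rightarrow> 'm) abftor" where
  "delta \<UU> T D' G =
     \<lparr>ao = (\<lambda>Y. nat_group (Cpt \<UU> T) G (corep T (fo D' Y))),
      am = (\<lambda>g \<eta>. \<lambda>C\<in>Obj (Cpt \<UU> T). \<lambda>x\<in>carrier (ao G C). \<eta> C x \<cdot>\<^bsub>T\<^esub> fm D' g)\<rparr>"

definition dual_definable ::
    "'u itself \<Rightarrow> ('o, 'm, 'y) cat_scheme \<Rightarrow> ('p, 'n, 'z) cat_scheme \<Rightarrow>
     ('p, 'n, 'o, 'm) ftor \<Rightarrow> 'o set \<Rightarrow> 'p set" where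
  "dual_definable \<UU> T U D' \<D> =
     {Y \<in> Obj U. \<forall>H \<in> delta \<UU> T D' ` annihilated \<UU> T \<D>. trivial_group (ao (fp_ext \<UU> U H) Y)}"

end

theory Submission
  imports Defs "HOL-Algebra.Multiplicative_Group"
begin

text \<open>
  The isomorphisms \<open>\<theta>\<close> and the injectivity of \<open>\<rat>/\<int>\<close> turn surjectivity of \<open>Hom(f, X)\<close> into
  injectivity of \<open>Hom(D f, Q X)\<close>, and injectivity of \<open>Hom(D f, Y)\<close> into surjectivity of
  \<open>Hom(f, Q' Y)\<close>. If \<open>G\<close> is presented by \<open>f: A \<rightarrow> B\<close>, then \<open>\<delta> G\<close> is the kernel of \<open>Hom(D f, -)\<close> and
  is presented by the last arrow of the triangle over \<open>D f\<close>. So the dual of \<open>\<D>\<close> consists of the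
  \<open>Y\<close> with \<open>Hom(D f, Y)\<close> injective whenever \<open>Hom(f, X)\<close> is surjective for all \<open>X\<close> in \<open>\<D>\<close>. Hence \<open>X\<close>
  is in \<open>\<D>\<close> iff \<open>Q X\<close> is in the dual, and \<open>Y\<close> is in the dual iff \<open>Q' Y\<close> is in \<open>\<D>\<close>; closure
  properties are carried back and forth by the exact functors \<open>Q\<close> and \<open>Q'\<close>.
\<close>

section \<open>Homomorphisms into divisible groups\<close>

text \<open>The criteria for \<open>Q\<close> and for \<open>Q'\<close> test membership in opposite
  directions, so each implication pulls a closure property back along one exact functor, and one
  transfer lemma serves both. The work lies in reaching a form to which \<theta> applies.
  \<open>fp_ext\<close> picks a presentation by choice, so vanishing must first be shown independent
  of it, and a presentation of \<delta> G must be an arrow between compact objects. Hence cones and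
  suspensions have to be shown compact; for this, compactness is rephrased as finite support of
  arrows into coproducts. Identifying \<delta> G with a kernel must also respect addition, while
  \<open>D\<close> is only given as a functor; its additivity is extracted from \<theta>. On the
  side of groups, injectivity of \<rat>/\<int> extends characters, but the converse implications
  need that characters separate elements. Both facts come from one extension theorem for graphs of
  partial homomorphisms.\<close>

lemma (in comm_group) adjoin_power_subgroup:
  assumes M: "subgroup M G" and p: "p \<in> carrier G"
  shows "subgroup {m \<otimes> p [^] n | m n. m \<in> M \<and> n \<in> (UNIV :: int set)} G" (is "subgroup ?N G")
proof (rule subgroupI)
  have mc: "m \<in> carrier G" if "m \<in> M" for m using subgroup.mem_carrier[OF M that] .
  show "?N \<subseteq> carrier G" using mc p by auto
  show "?N \<noteq> {}" using subgroup.one_closed[OF M] by blast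
  fix a assume "a \<in> ?N"
  then obtain m n where a: "a = m \<otimes> p [^] n" "m \<in> M" "n \<in> (UNIV :: int set)" by auto
  have "inv a = inv m \<otimes> p [^] (-n)"
    using a mc p by (simp add: inv_mult int_pow_neg)
  then show "inv a \<in> ?N" using subgroup.m_inv_closed[OF M] a by blast
  fix b assume "b \<in> ?N"
  then obtain m' n' where b: "b = m' \<otimes> p [^] n'" "m' \<in> M" "n' \<in> (UNIV :: int set)" by auto
  have "a \<otimes> b = (m \<otimes> m') \<otimes> p [^] (n + n')"
    using a b mc p by (simp add: int_pow_mult m_ac)
  then show "a \<otimes> b \<in> ?N" using subgroup.m_closed[OF M] a b by blast
qed

lemma DirProd_int_pow:
  assumes "group G" "group A" "x \<in> carrier G" "b \<in> carrier A"
  shows "(x, b) [^]\<^bsub>G \<times>\<times> A\<^esub> (n::int) = (x [^]\<^bsub>G\<^esub> n, b [^]\<^bsub>A\<^esub> n)"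
proof -
  interpret P: group "G \<times>\<times> A" using assms by (simp add: DirProd_group)
  have "fst \<in> hom (G \<times>\<times> A) G" "snd \<in> hom (G \<times>\<times> A) A"
    by (auto simp: hom_def)
  then have "fst ((x, b) [^]\<^bsub>G \<times>\<times> A\<^esub> n) = x [^]\<^bsub>G\<^esub> n" "snd ((x, b) [^]\<^bsub>G \<times>\<times> A\<^esub> n) = b [^]\<^bsub>A\<^esub> n"
    using assms by (auto simp: hom_int_pow P.is_group)
  then show ?thesis by (metis prod.collapse)
qed

text \<open>A homomorphism from a subgroup of \<open>G\<close> to \<open>A\<close> is encoded by its
  graph. Extension is then inclusion and the union of a chain is again such a graph, so Zorn's lemma
  applies to plain sets.\<close>

definition univalent :: "('a, 'y) monoid_scheme \<Rightarrow> ('b, 'z) monoid_scheme \<Rightarrow> ('a \<times> 'b) set \<Rightarrow> bool" where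
  "univalent G A R \<longleftrightarrow> subgroup R (G \<times>\<times> A) \<and> (\<forall>a. (\<one>\<^bsub>G\<^esub>, a) \<in> R \<longrightarrow> a = \<one>\<^bsub>A\<^esub>)"

definition divisible :: "('a, 'y) monoid_scheme \<Rightarrow> bool" where
  "divisible A \<longleftrightarrow> (\<forall>a\<in>carrier A. \<forall>n::nat. n > 0 \<longrightarrow> (\<exists>b\<in>carrier A. b [^]\<^bsub>A\<^esub> n = a))"

lemma comm_group_DirProd:
  assumes "comm_group G" "comm_group A"
  shows "comm_group (G \<times>\<times> A)"
proof -
  interpret G: comm_group G by fact
  interpret A: comm_group A by fact
  show ?thesis
    by (intro group.group_comm_groupI DirProd_group G.is_group A.is_group)
      (auto simp: G.m_comm A.m_comm)
qed

context
  fixes G :: "('a, 'y) monoid_scheme" and A :: "('b, 'z) monoid_scheme"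
  assumes G: "comm_group G" and A: "comm_group A" and div: "divisible A"
begin

interpretation G: comm_group G by (fact G)
interpretation A: comm_group A by (fact A)

interpretation P: comm_group "G \<times>\<times> A" by (rule comm_group_DirProd[OF G A])

lemma univalent_mem:
  assumes "univalent G A M"
  shows "(x, a) \<in> M \<Longrightarrow> x \<in> carrier G" "(x, a) \<in> M \<Longrightarrow> a \<in> carrier A"
    "(\<one>\<^bsub>G\<^esub>, \<one>\<^bsub>A\<^esub>) \<in> M" "(\<one>\<^bsub>G\<^esub>, a) \<in> M \<Longrightarrow> a = \<one>\<^bsub>A\<^esub>"
    "\<lbrakk>(x, a) \<in> M; (y, b) \<in> M\<rbrakk> \<Longrightarrow> (x \<otimes>\<^bsub>G\<^esub> y, a \<otimes>\<^bsub>A\<^esub> b) \<in> M"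
    "(x, a) \<in> M \<Longrightarrow> (inv\<^bsub>G\<^esub> x, inv\<^bsub>A\<^esub> a) \<in> M"
    "(x, a) \<in> M \<Longrightarrow> (x [^]\<^bsub>G\<^esub> (n::int), a [^]\<^bsub>A\<^esub> n) \<in> M"
proof -
  have M: "subgroup M (G \<times>\<times> A)" using assms by (simp add: univalent_def)
  show c: "(x, a) \<in> M \<Longrightarrow> x \<in> carrier G" "(x, a) \<in> M \<Longrightarrow> a \<in> carrier A"
    using subgroup.subset[OF M] by auto
  show "(\<one>\<^bsub>G\<^esub>, \<one>\<^bsub>A\<^esub>) \<in> M" using subgroup.one_closed[OF M] by simp
  show "(\<one>\<^bsub>G\<^esub>, a) \<in> M \<Longrightarrow> a = \<one>\<^bsub>A\<^esub>" using assms by (simp add: univalent_def)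
  show "\<lbrakk>(x, a) \<in> M; (y, b) \<in> M\<rbrakk> \<Longrightarrow> (x \<otimes>\<^bsub>G\<^esub> y, a \<otimes>\<^bsub>A\<^esub> b) \<in> M"
    using subgroup.m_closed[OF M, of "(x,a)" "(y,b)"] by simp
  show "(x, a) \<in> M \<Longrightarrow> (inv\<^bsub>G\<^esub> x, inv\<^bsub>A\<^esub> a) \<in> M"
    using subgroup.m_inv_closed[OF M, of "(x,a)"] c by (simp add: G.is_group A.is_group)
  show "(x, a) \<in> M \<Longrightarrow> (x [^]\<^bsub>G\<^esub> n, a [^]\<^bsub>A\<^esub> n) \<in> M"
    using P.subgroup_int_pow_closed[OF M, of "(x,a)" n] c
    by (simp add: DirProd_int_pow G.is_group A.is_group)
qed

lemma univalent_functional: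
  assumes "univalent G A M" "(x, a) \<in> M" "(x, b) \<in> M"
  shows "a = b"
proof -
  note m = univalent_mem[OF assms(1)]
  have "(x \<otimes>\<^bsub>G\<^esub> inv\<^bsub>G\<^esub> x, a \<otimes>\<^bsub>A\<^esub> inv\<^bsub>A\<^esub> b) \<in> M" by (intro m assms)
  then have "a \<otimes>\<^bsub>A\<^esub> inv\<^bsub>A\<^esub> b = \<one>\<^bsub>A\<^esub>" using m(1)[OF assms(2)] m(4) by simp
  then show ?thesis using m(2)[OF assms(2)] m(2)[OF assms(3)]
    by (metis A.inv_closed A.inv_equality A.inv_inv)
qed

text \<open>A value at \<open>x\<close> that is compatible with \<open>M\<close>. If some positive
  power of \<open>x\<close> lies in the domain of \<open>M\<close>, take the least exponent
  \<open>d\<close> and a \<open>d\<close>-th root of the value there: divisibility provides it, and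
  all exponents in the domain are multiples of \<open>d\<close>. Otherwise only the exponent 0
  occurs and the unit serves.\<close>

lemma univalent_power_value:
  assumes M: "univalent G A M" and x: "x \<in> carrier G"
  obtains b where "b \<in> carrier A" "\<And>n a. (x [^]\<^bsub>G\<^esub> (n::int), a) \<in> M \<Longrightarrow> a = b [^]\<^bsub>A\<^esub> n"
proof (cases "\<exists>d::nat. d > 0 \<and> (\<exists>a. (x [^]\<^bsub>G\<^esub> (int d), a) \<in> M)")
  case True
  define d where "d = (LEAST d::nat. d > 0 \<and> (\<exists>a. (x [^]\<^bsub>G\<^esub> (int d), a) \<in> M))"
  have d: "d > 0" "\<exists>a. (x [^]\<^bsub>G\<^esub> (int d), a) \<in> M"
    using LeastI_ex[OF True] by (auto simp: d_def)
  have min: "\<not> (\<exists>a. (x [^]\<^bsub>G\<^esub> (int e), a) \<in> M)" if "e > 0" "e < d" for e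
    using not_less_Least that unfolding d_def by blast
  obtain a where a: "(x [^]\<^bsub>G\<^esub> (int d), a) \<in> M" using d by blast
  obtain b where b: "b \<in> carrier A" "b [^]\<^bsub>A\<^esub> d = a"
    using div univalent_mem(2)[OF M a] d(1) unfolding divisible_def by blast
  show ?thesis
  proof (rule that[OF b(1)])
    fix n :: int and a' assume n: "(x [^]\<^bsub>G\<^esub> n, a') \<in> M"
    define q r where "q = n div int d" and "r = n mod int d"
    have nqr: "n = int d * q + r" by (simp add: q_def r_def)
    have r: "0 \<le> r" "r < int d" using d(1) by (auto simp: r_def)
    have xd: "x [^]\<^bsub>G\<^esub> n = (x [^]\<^bsub>G\<^esub> int d) [^]\<^bsub>G\<^esub> q \<otimes>\<^bsub>G\<^esub> x [^]\<^bsub>G\<^esub> r"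
      by (simp add: nqr G.int_pow_mult G.int_pow_pow x)
    have "(x [^]\<^bsub>G\<^esub> n \<otimes>\<^bsub>G\<^esub> inv\<^bsub>G\<^esub> ((x [^]\<^bsub>G\<^esub> int d) [^]\<^bsub>G\<^esub> q), a' \<otimes>\<^bsub>A\<^esub> inv\<^bsub>A\<^esub> (a [^]\<^bsub>A\<^esub> q)) \<in> M"
      by (intro univalent_mem(5-7)[OF M] n a)
    moreover have "x [^]\<^bsub>G\<^esub> n \<otimes>\<^bsub>G\<^esub> inv\<^bsub>G\<^esub> ((x [^]\<^bsub>G\<^esub> int d) [^]\<^bsub>G\<^esub> q) = x [^]\<^bsub>G\<^esub> r"
      unfolding xd by (metis G.int_pow_closed G.inv_solve_right' G.m_closed G.m_comm x)
    ultimately have mr: "(x [^]\<^bsub>G\<^esub> r, a' \<otimes>\<^bsub>A\<^esub> inv\<^bsub>A\<^esub> (a [^]\<^bsub>A\<^esub> q)) \<in> M" by simp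
    \<comment> \<open>A nonzero remainder would be a positive exponent below \<open>d\<close> in the
      domain of \<open>M\<close>.\<close>
    have "r = 0" using min[of "nat r"] r mr by (cases "r = 0") auto
    then have "a' \<otimes>\<^bsub>A\<^esub> inv\<^bsub>A\<^esub> (a [^]\<^bsub>A\<^esub> q) = \<one>\<^bsub>A\<^esub>" using mr univalent_mem(4)[OF M] by simp
    then have "a' = a [^]\<^bsub>A\<^esub> q" using univalent_mem(2)[OF M] n a
      by (metis A.inv_closed A.inv_equality A.inv_inv A.int_pow_closed)
    also have "\<dots> = b [^]\<^bsub>A\<^esub> n" using b \<open>r = 0\<close> nqr
      by (metis int_pow_int A.int_pow_pow add.right_neutral)
    finally show "a' = b [^]\<^bsub>A\<^esub> n" .
  qed
next
  case False
  show ?thesis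
  proof (rule that[OF A.one_closed])
    fix n :: int and a assume n: "(x [^]\<^bsub>G\<^esub> n, a) \<in> M"
    have "(x [^]\<^bsub>G\<^esub> (-n), inv\<^bsub>A\<^esub> a) \<in> M"
      using univalent_mem(6)[OF M n] by (simp add: x G.int_pow_neg)
    then have "\<not> n > 0" "\<not> - n > 0"
      using False n by (metis zero_less_nat_eq nat_0_le less_imp_le)+
    then have "n = 0" by simp
    then show "a = \<one>\<^bsub>A\<^esub> [^]\<^bsub>A\<^esub> n" using n univalent_mem(4)[OF M] by simp
  qed
qed

text \<open>The subgroup generated by \<open>M\<close> and \<open>(x, b)\<close> stays univalent: if
  (1, a) is the product of (y, c) and the n-th power of (x, b), then y is the power of x with
  exponent -n, so c is the power of b with exponent -n by the choice of b, and a is trivial.\<close>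

lemma univalent_adjoin:
  assumes M: "univalent G A M" and x: "x \<in> carrier G"
  shows "\<exists>N b. univalent G A N \<and> M \<subseteq> N \<and> (x, b) \<in> N"
proof -
  obtain b where b: "b \<in> carrier A" "\<And>n a. (x [^]\<^bsub>G\<^esub> (n::int), a) \<in> M \<Longrightarrow> a = b [^]\<^bsub>A\<^esub> n"
    using univalent_power_value[OF M x] by blast
  have p: "(x, b) \<in> carrier (G \<times>\<times> A)" using x b by simp
  let ?N = "{m \<otimes>\<^bsub>G \<times>\<times> A\<^esub> (x, b) [^]\<^bsub>G \<times>\<times> A\<^esub> n | m n. m \<in> M \<and> n \<in> (UNIV :: int set)}"
  have sM: "subgroup M (G \<times>\<times> A)" using M by (simp add: univalent_def)
  have "M \<subseteq> ?N"
  proof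
    fix m assume "m \<in> M"
    moreover have "m = m \<otimes>\<^bsub>G \<times>\<times> A\<^esub> (x, b) [^]\<^bsub>G \<times>\<times> A\<^esub> (0::int)"
      using subgroup.mem_carrier[OF sM \<open>m \<in> M\<close>] by (simp add: mult_DirProd' mem_Times_iff)
    ultimately show "m \<in> ?N" by blast
  qed
  moreover have "(x, b) \<in> ?N"
  proof -
    have "(x, b) = \<one>\<^bsub>G \<times>\<times> A\<^esub> \<otimes>\<^bsub>G \<times>\<times> A\<^esub> (x, b) [^]\<^bsub>G \<times>\<times> A\<^esub> (1::int)"
      using p by (simp add: P.int_pow_1 del: one_DirProd)
    then show ?thesis using subgroup.one_closed[OF sM] by blast
  qed
  moreover have "univalent G A ?N"
    unfolding univalent_def
  proof (intro conjI allI impI)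
    show "subgroup ?N (G \<times>\<times> A)" by (rule P.adjoin_power_subgroup[OF sM p])
    fix a assume "(\<one>\<^bsub>G\<^esub>, a) \<in> ?N"
    then obtain m n where mn: "(\<one>\<^bsub>G\<^esub>, a) = m \<otimes>\<^bsub>G \<times>\<times> A\<^esub> (x, b) [^]\<^bsub>G \<times>\<times> A\<^esub> (n::int)" "m \<in> M"
      by blast
    obtain y c where m: "m = (y, c)" by (cases m)
    have yc: "y \<in> carrier G" "c \<in> carrier A" "(y, c) \<in> M" using mn m univalent_mem[OF M] by auto
    have e: "\<one>\<^bsub>G\<^esub> = y \<otimes>\<^bsub>G\<^esub> x [^]\<^bsub>G\<^esub> n" "a = c \<otimes>\<^bsub>A\<^esub> b [^]\<^bsub>A\<^esub> n"
      using mn m x b by (auto simp: DirProd_int_pow G.is_group A.is_group)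
    have "y = x [^]\<^bsub>G\<^esub> (-n)"
      using e(1) x yc by (metis G.int_pow_closed G.int_pow_neg G.inv_equality)
    then have "c = b [^]\<^bsub>A\<^esub> (-n)" using b(2) yc by blast
    then show "a = \<one>\<^bsub>A\<^esub>" using e(2) b by (simp add: A.int_pow_neg)
  qed
  ultimately show ?thesis by blast
qed

text \<open>A maximal graph containing \<open>R\<close> is total, because
  \<open>univalent_adjoin\<close> could enlarge it at any point that it misses. Starting from a
  relation rather than a map covers both the extension along a monomorphism and the construction of
  a character with a prescribed value.\<close>

theorem univalent_extends_to_hom:
  assumes R: "univalent G A R"
  shows "\<exists>\<psi>\<in>hom G A. \<forall>(x, a)\<in>R. \<psi> x = a"
proof -
  let ?S = "{M. univalent G A M \<and> R \<subseteq> M}"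
  have "\<exists>M\<in>?S. \<forall>X\<in>?S. M \<subseteq> X \<longrightarrow> X = M"
  proof (rule subset_Zorn_nonempty)
    show "?S \<noteq> {}" using R by blast
    fix \<C> assume C: "\<C> \<noteq> {}" "subset.chain ?S \<C>"
    have u: "univalent G A M" "R \<subseteq> M" if "M \<in> \<C>" for M using C(2) that by (auto simp: subset_chain_def)
    have tot: "M \<subseteq> N \<or> N \<subseteq> M" if "M \<in> \<C>" "N \<in> \<C>" for M N using C(2) that by (auto simp: subset_chain_def)
    have sub: "subgroup M (G \<times>\<times> A)" if "M \<in> \<C>" for M using u(1)[OF that] by (simp add: univalent_def)
    obtain M0 where M0: "M0 \<in> \<C>" using C(1) by blast
    have "univalent G A (\<Union>\<C>)" unfolding univalent_def
    proof (intro conjI allI impI P.subgroupI)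
      show "\<Union>\<C> \<subseteq> carrier (G \<times>\<times> A)" using subgroup.subset[OF sub] by blast
      show "\<Union>\<C> \<noteq> {}" using univalent_mem(3)[OF u(1)[OF M0]] M0 by blast
      show "inv\<^bsub>G \<times>\<times> A\<^esub> p \<in> \<Union>\<C>" if p: "p \<in> \<Union>\<C>" for p
      proof -
        obtain M where M: "M \<in> \<C>" "p \<in> M" using p by blast
        then show ?thesis using subgroup.m_inv_closed[OF sub[OF M(1)] M(2)] by blast
      qed
      show "p \<otimes>\<^bsub>G \<times>\<times> A\<^esub> q \<in> \<Union>\<C>" if pq: "p \<in> \<Union>\<C>" "q \<in> \<Union>\<C>" for p q
      proof -
        obtain M where M: "M \<in> \<C>" "p \<in> M" "q \<in> M" using pq tot by blast
        then show ?thesis using subgroup.m_closed[OF sub[OF M(1)] M(2,3)] by blast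
      qed
      show "a = \<one>\<^bsub>A\<^esub>" if "(\<one>\<^bsub>G\<^esub>, a) \<in> \<Union>\<C>" for a using that u(1) univalent_mem(4) by blast
    qed
    then show "\<Union>\<C> \<in> ?S" using u(2) M0 by blast
  qed
  then obtain M where M: "univalent G A M" "R \<subseteq> M"
      "\<forall>X\<in>?S. M \<subseteq> X \<longrightarrow> X = M"
    by blast
  have dom: "\<exists>a. (x, a) \<in> M" if x: "x \<in> carrier G" for x
    proof -
    obtain N b where N: "univalent G A N" "M \<subseteq> N" "(x, b) \<in> N"
      using univalent_adjoin[OF M(1) x] by blast
    then have "N = M" using M(2,3) by blast
    then show ?thesis using N by blast
  qed
  define \<psi> where "\<psi> x = (THE a. (x, a) \<in> M)" for x
  have psi: "\<psi> x = a" if "(x, a) \<in> M" for x a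
    unfolding \<psi>_def using univalent_functional[OF M(1)] that by blast
  have "\<psi> \<in> hom G A"
  proof (rule homI)
    fix x y assume "x \<in> carrier G" "y \<in> carrier G"
    then obtain a b where ab: "(x, a) \<in> M" "(y, b) \<in> M" using dom by blast
    show "\<psi> x \<in> carrier A" using psi ab univalent_mem(2)[OF M(1)] by simp
    show "\<psi> (x \<otimes>\<^bsub>G\<^esub> y) = \<psi> x \<otimes>\<^bsub>A\<^esub> \<psi> y"
      using psi ab univalent_mem(5)[OF M(1)] by simp
  qed
  then show ?thesis using psi M(2) by blast
qed

end

text \<open>Injectivity of \<open>i\<close> makes the set of pairs \<open>(i x, \<phi> x)\<close>
  univalent in \<open>H\<close> and \<open>A\<close>.\<close>

lemma hom_extends_along_mono:
  assumes "comm_group G" "comm_group H" "comm_group A" "divisible A"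
    and i: "i \<in> hom G H" "inj_on i (carrier G)" and \<phi>: "\<phi> \<in> hom G A"
  shows "\<exists>\<psi>\<in>hom H A. \<forall>x\<in>carrier G. \<psi> (i x) = \<phi> x"
proof -
  interpret G: comm_group G by fact
  interpret H: comm_group H by fact
  interpret A: comm_group A by fact
  interpret P: group "H \<times>\<times> A" by (intro DirProd_group H.is_group A.is_group)
  let ?j = "\<lambda>x. (i x, \<phi> x)"
  have j: "?j \<in> hom G (H \<times>\<times> A)" using i(1) \<phi> by (auto simp: hom_def)
  interpret j: group_hom G "H \<times>\<times> A" ?j using j by unfold_locales
  have one: "i \<one>\<^bsub>G\<^esub> = \<one>\<^bsub>H\<^esub>" "\<phi> \<one>\<^bsub>G\<^esub> = \<one>\<^bsub>A\<^esub>"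
    using i(1) \<phi> by (simp_all add: hom_one)
  have "univalent H A (?j ` carrier G)"
    unfolding univalent_def
    using j.img_is_subgroup inj_onD[OF i(2) _ _ G.one_closed] one by (fastforce simp: image_iff)
  from univalent_extends_to_hom[OF assms(2-4) this] show ?thesis by fastforce
qed

section \<open>Characters with values in the rationals modulo the integers\<close>

lemma QmodZ_facts:
  shows comm_group_QmodZ: "comm_group QmodZ" and divisible_QmodZ: "divisible QmodZ"
    and QmodZ_torsion: "n \<ge> 2 \<Longrightarrow> \<exists>q\<in>carrier QmodZ. \<forall>k::int. q [^]\<^bsub>QmodZ\<^esub> k = \<one>\<^bsub>QmodZ\<^esub> \<longleftrightarrow> int n dvd k"
proof -
  let ?R = "\<lparr>carrier = UNIV, mult = (+), one = (0 :: rat)\<rparr>"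
  interpret R: comm_group ?R
    by (rule comm_groupI) (auto intro: exI[of _ "- x" for x :: rat] simp: add.assoc add.commute)
  have inv: "inv\<^bsub>?R\<^esub> x = - x" for x by (rule R.inv_equality) auto
  have Z: "subgroup \<int> ?R" by (rule R.subgroupI) (auto simp: inv)
  interpret N: normal \<int> ?R using Z by (rule R.normal_iff_subgroup[THEN iffD2])
  show cg: "comm_group QmodZ" unfolding QmodZ_def by (rule R.abelian_FactGroup[OF Z])
  interpret Q: comm_group QmodZ by (fact cg)
  define \<pi> where "\<pi> r = \<int> #>\<^bsub>?R\<^esub> r" for r :: rat
  have pi: "\<pi> \<in> hom ?R QmodZ" unfolding \<pi>_def QmodZ_def using N.r_coset_hom_Mod by (simp add: eta_contract_eq)
  have surj: "carrier QmodZ = range \<pi>" by (simp add: QmodZ_def carrier_FactGroup \<pi>_def)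
  have one: "\<pi> r = \<one>\<^bsub>QmodZ\<^esub> \<longleftrightarrow> r \<in> \<int>" for r
    unfolding \<pi>_def QmodZ_def one_FactGroup
    using R.coset_join1[OF _ _ Z, of r] R.coset_join2[OF _ Z, of r] by auto
  have npow: "r [^]\<^bsub>?R\<^esub> (n::nat) = of_nat n * r" for n r
    by (induction n) (auto simp: algebra_simps)
  have zpow: "r [^]\<^bsub>?R\<^esub> (n::int) = of_int n * r" for n r
    by (cases n rule: int_cases3) (auto simp: R.int_pow_neg int_pow_int npow inv)
  have pin: "\<pi> r [^]\<^bsub>QmodZ\<^esub> (n::int) = \<pi> (of_int n * r)" for r n
    using hom_int_pow[OF pi _ R.is_group Q.is_group, of r n] by (simp add: zpow)
  show "divisible QmodZ" unfolding divisible_def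
  proof (intro ballI allI impI)
    fix a and n :: nat assume "a \<in> carrier QmodZ" "n > 0"
    then obtain r where r: "a = \<pi> r" using surj by blast
    have "\<pi> (r / of_nat n) [^]\<^bsub>QmodZ\<^esub> n = a"
      using pin[of "r / of_nat n" "int n"] \<open>n > 0\<close> by (simp add: int_pow_int r)
    then show "\<exists>b\<in>carrier QmodZ. b [^]\<^bsub>QmodZ\<^esub> n = a" using surj by blast
  qed
  show "\<exists>q\<in>carrier QmodZ. \<forall>k::int. q [^]\<^bsub>QmodZ\<^esub> k = \<one>\<^bsub>QmodZ\<^esub> \<longleftrightarrow> int n dvd k" if n: "n \<ge> 2"
  proof (intro bexI allI)
    \<comment> \<open>The class of 1/n has order exactly \<open>n\<close>.\<close>
    show "\<pi> (1 / of_nat n) \<in> carrier QmodZ" using surj by blast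
    fix k :: int
    have "of_int k * (1 / of_nat n) \<in> (\<int> :: rat set) \<longleftrightarrow> int n dvd k"
    proof
      assume "of_int k * (1 / of_nat n) \<in> (\<int> :: rat set)"
      then obtain m where "of_int k * (1 / of_nat n) = (of_int m :: rat)" by (auto elim: Ints_cases)
      then have "(of_int k :: rat) = of_int (m * int n)" using n by (simp add: field_simps)
      then have "k = m * int n" by (simp only: of_int_eq_iff)
      then show "int n dvd k" by simp
    next
      assume "int n dvd k"
      then obtain m where "k = int n * m" ..
      then show "of_int k * (1 / of_nat n) \<in> (\<int> :: rat set)" using n by simp
    qed
    then show "\<pi> (1 / of_nat n) [^]\<^bsub>QmodZ\<^esub> k = \<one>\<^bsub>QmodZ\<^esub> \<longleftrightarrow> int n dvd k" by (simp add: pin one)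
  qed
qed

text \<open>\<open>QmodZ\<close> is a cogenerator: on the cyclic subgroup generated by
  \<open>x\<close>, send \<open>x\<close> to an element of order \<open>n\<close>, then extend to
  \<open>G\<close>.\<close>

lemma QmodZ_separates:
  assumes "comm_group G" "x \<in> carrier G" "x \<noteq> \<one>\<^bsub>G\<^esub>"
  shows "\<exists>\<psi>\<in>hom G QmodZ. \<psi> x \<noteq> \<one>\<^bsub>QmodZ\<^esub>"
proof -
  interpret G: comm_group G by fact
  interpret Q: comm_group QmodZ by (rule comm_group_QmodZ)
  interpret P: comm_group "G \<times>\<times> QmodZ" by (rule comm_group_DirProd[OF assms(1) comm_group_QmodZ])
  \<comment> \<open>\<open>G.ord x = 0\<close> stands for infinite order. Then only the zeroth power
    of \<open>x\<close> is trivial, any order above 1 would do for the target, and 2 is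
    taken.\<close>
  define n where "n = (if G.ord x = 0 then 2 else G.ord x)"
  have n: "n \<ge> 2" using G.ord_eq_1[OF assms(2)] assms(3) by (auto simp: n_def)
  have dv: "int n dvd k" if "x [^]\<^bsub>G\<^esub> (k::int) = \<one>\<^bsub>G\<^esub>" for k
    using that G.int_pow_eq_id[OF assms(2), of k] by (auto simp: n_def)
  obtain q where q: "q \<in> carrier QmodZ" "\<And>k::int. q [^]\<^bsub>QmodZ\<^esub> k = \<one>\<^bsub>QmodZ\<^esub> \<longleftrightarrow> int n dvd k"
    using QmodZ_torsion[OF n] by blast
  \<comment> \<open>The cyclic subgroup generated by \<open>(x, q)\<close>, written as powers
    adjoined to the trivial subgroup so that \<open>adjoin_power_subgroup\<close> applies. It is
    univalent because an exponent that kills \<open>x\<close> is a multiple of \<open>n\<close> and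
    so kills \<open>q\<close>.\<close>
  let ?R = "{\<one>\<^bsub>G \<times>\<times> QmodZ\<^esub> \<otimes>\<^bsub>G \<times>\<times> QmodZ\<^esub> (x, q) [^]\<^bsub>G \<times>\<times> QmodZ\<^esub> k | k. k \<in> (UNIV :: int set)}"
  have pow: "\<one>\<^bsub>G \<times>\<times> QmodZ\<^esub> \<otimes>\<^bsub>G \<times>\<times> QmodZ\<^esub> (x, q) [^]\<^bsub>G \<times>\<times> QmodZ\<^esub> k = (x [^]\<^bsub>G\<^esub> k, q [^]\<^bsub>QmodZ\<^esub> k)" for k :: int
    using assms q by (simp add: DirProd_int_pow G.is_group Q.is_group)
  have "subgroup {\<one>\<^bsub>G \<times>\<times> QmodZ\<^esub>} (G \<times>\<times> QmodZ)" by (rule P.triv_subgroup)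
  from P.adjoin_power_subgroup[OF this, of "(x, q)"] have "subgroup ?R (G \<times>\<times> QmodZ)"
    using assms q by simp
  then have "univalent G QmodZ ?R"
    unfolding univalent_def pow using dv q(2) by (simp add: eq_commute[of "\<one>\<^bsub>G\<^esub>"]) blast
  from univalent_extends_to_hom[OF assms(1) comm_group_QmodZ divisible_QmodZ this]
  obtain \<psi> where psi: "\<psi> \<in> hom G QmodZ" "\<And>k::int. \<psi> (x [^]\<^bsub>G\<^esub> k) = q [^]\<^bsub>QmodZ\<^esub> k"
    unfolding pow by blast
  have "\<psi> x = q [^]\<^bsub>QmodZ\<^esub> (1::int)" using psi(2)[of 1] assms by (simp add: G.int_pow_1)
  moreover have "q [^]\<^bsub>QmodZ\<^esub> (1::int) \<noteq> \<one>\<^bsub>QmodZ\<^esub>"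
    using q(2)[of 1] n by simp
  ultimately show ?thesis using psi(1) by metis
qed

text \<open>A proper image leaves a nonzero element in the cokernel. A character that is nontrivial
  there, composed with the quotient map, kills the image without being trivial.\<close>

lemma QmodZ_detects_surjective:
  assumes "comm_group G" "comm_group H" and h: "h \<in> hom G H"
    and ker: "\<And>\<psi>. \<psi> \<in> hom H QmodZ \<Longrightarrow> (\<And>x. x \<in> carrier G \<Longrightarrow> \<psi> (h x) = \<one>\<^bsub>QmodZ\<^esub>) \<Longrightarrow>
               (\<And>y. y \<in> carrier H \<Longrightarrow> \<psi> y = \<one>\<^bsub>QmodZ\<^esub>)"
  shows "h ` carrier G = carrier H"
proof (rule ccontr)
  interpret G: comm_group G by fact
  interpret H: comm_group H by fact
  interpret h: group_hom G H h using h by unfold_locales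
  let ?N = "h ` carrier G"
  have N: "subgroup ?N H" by (rule h.img_is_subgroup)
  interpret N: normal ?N H using N by (rule H.normal_iff_subgroup[THEN iffD2])
  assume "\<not> ?thesis"
  then obtain y where y: "y \<in> carrier H" "y \<notin> ?N" using h.hom_closed by blast
  have "?N #>\<^bsub>H\<^esub> y \<noteq> \<one>\<^bsub>H Mod ?N\<^esub>"
    using H.coset_join1[OF _ y(1) N] y(2) subgroup.subset[OF N] by auto
  moreover have "?N #>\<^bsub>H\<^esub> y \<in> carrier (H Mod ?N)" using y by (auto simp: carrier_FactGroup)
  ultimately obtain \<psi> where psi: "\<psi> \<in> hom (H Mod ?N) QmodZ" "\<psi> (?N #>\<^bsub>H\<^esub> y) \<noteq> \<one>\<^bsub>QmodZ\<^esub>"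
    using QmodZ_separates[OF H.abelian_FactGroup[OF N]] by blast
  have "\<psi> (?N #>\<^bsub>H\<^esub> h x) = \<one>\<^bsub>QmodZ\<^esub>" if "x \<in> carrier G" for x
  proof -
    have "?N #>\<^bsub>H\<^esub> h x = \<one>\<^bsub>H Mod ?N\<^esub>" using H.coset_join2[OF _ N] that by simp
    then show ?thesis
      using hom_one[OF psi(1) N.factorgroup_is_group comm_group.axioms(2)[OF comm_group_QmodZ]] by simp
  qed
  with ker[OF hom_compose[OF N.r_coset_hom_Mod psi(1)]] y(1) psi(2) show False by simp
qed

section \<open>Preadditive categories and cokernels\<close>

context preadditive_category
begin

lemma mapsD:
  assumes "f \<in> maps C X Y" "X \<in> Obj C" "Y \<in> Obj C"
  shows "f \<in> arrows C" "Dom C f = X" "Cod C f = Y"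
  using dom_cod[OF assms(2,3,1)] assms by (auto simp: arrows_def)

text \<open>Turns membership in a Hom set into conditions on \<open>arrows\<close>,
  \<open>Dom\<close> and \<open>Cod\<close>, so that simplification can check composability without
  instantiating objects. It is deleted where carriers have to stay intact.\<close>

lemma maps_iff [simp]:
  "\<lbrakk>X \<in> Obj C; Y \<in> Obj C\<rbrakk> \<Longrightarrow> f \<in> maps C X Y \<longleftrightarrow> f \<in> arrows C \<and> Dom C f = X \<and> Cod C f = Y"
  using dom_cod by (auto simp: arrows_def)

lemma arrow_obj [simp]: "f \<in> arrows C \<Longrightarrow> Dom C f \<in> Obj C" "f \<in> arrows C \<Longrightarrow> Cod C f \<in> Obj C"
  by (auto simp: arrows_def)

lemma comp_simps [simp]:
  assumes "f \<in> arrows C" "g \<in> arrows C" "Cod C f = Dom C g"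
  shows "g \<cdot> f \<in> arrows C" "Dom C (g \<cdot> f) = Dom C f" "Cod C (g \<cdot> f) = Cod C g"
  using comp_closed[of "Dom C f" "Dom C g" "Cod C g" f g] assms by auto

lemma id_simps [simp]:
  assumes "X \<in> Obj C"
  shows "Idt C X \<in> arrows C" "Dom C (Idt C X) = X" "Cod C (Idt C X) = X"
  using id_closed[OF assms] assms by auto

lemma comp_id [simp]:
  assumes "f \<in> arrows C"
  shows "Cod C f = X \<Longrightarrow> Idt C X \<cdot> f = f" "Dom C f = X \<Longrightarrow> f \<cdot> Idt C X = f"
  using id_left[of "Dom C f" "Cod C f" f] id_right[of "Dom C f" "Cod C f" f] assms by auto

lemma assoc:
  assumes "f \<in> arrows C" "g \<in> arrows C" "h \<in> arrows C" "Cod C f = Dom C g" "Cod C g = Dom C h"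
  shows "(h \<cdot> g) \<cdot> f = h \<cdot> (g \<cdot> f)"
  using comp_assoc[of "Dom C f" "Dom C g" "Dom C h" "Cod C h" f g h] assms by simp

lemma group_Hom [simp]: "\<lbrakk>X \<in> Obj C; Y \<in> Obj C\<rbrakk> \<Longrightarrow> group (Hom C X Y)"
  using hom_group comm_group.axioms(2) by blast

lemma add_simps [simp]:
  assumes "f \<in> arrows C" "g \<in> arrows C" "Dom C f = X" "Dom C g = X" "Cod C f = Y" "Cod C g = Y"
  shows "f \<otimes>\<^bsub>Hom C X Y\<^esub> g \<in> arrows C" "Dom C (f \<otimes>\<^bsub>Hom C X Y\<^esub> g) = X" "Cod C (f \<otimes>\<^bsub>Hom C X Y\<^esub> g) = Y"
proof -
  have o: "X \<in> Obj C" "Y \<in> Obj C" using assms by auto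
  interpret H: comm_group "Hom C X Y" using hom_group o by blast
  have "f \<otimes>\<^bsub>Hom C X Y\<^esub> g \<in> maps C X Y" by (rule H.m_closed) (use assms o in auto)
  then show "f \<otimes>\<^bsub>Hom C X Y\<^esub> g \<in> arrows C" "Dom C (f \<otimes>\<^bsub>Hom C X Y\<^esub> g) = X" "Cod C (f \<otimes>\<^bsub>Hom C X Y\<^esub> g) = Y"
    using o by auto
qed

lemma zero_simps [simp]:
  assumes "X \<in> Obj C" "Y \<in> Obj C"
  shows "\<one>\<^bsub>Hom C X Y\<^esub> \<in> arrows C" "Dom C \<one>\<^bsub>Hom C X Y\<^esub> = X" "Cod C \<one>\<^bsub>Hom C X Y\<^esub> = Y"
proof -
  interpret H: comm_group "Hom C X Y" using hom_group assms by blast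
  show "\<one>\<^bsub>Hom C X Y\<^esub> \<in> arrows C" "Dom C \<one>\<^bsub>Hom C X Y\<^esub> = X" "Cod C \<one>\<^bsub>Hom C X Y\<^esub> = Y"
    using mapsD[OF H.one_closed assms] by auto
qed

lemma neg_simps [simp]:
  assumes "f \<in> arrows C" "Dom C f = X" "Cod C f = Y"
  shows "inv\<^bsub>Hom C X Y\<^esub> f \<in> arrows C" "Dom C (inv\<^bsub>Hom C X Y\<^esub> f) = X" "Cod C (inv\<^bsub>Hom C X Y\<^esub> f) = Y"
proof -
  have o: "X \<in> Obj C" "Y \<in> Obj C" using assms by auto
  interpret H: comm_group "Hom C X Y" using hom_group o by blast
  have "inv\<^bsub>Hom C X Y\<^esub> f \<in> maps C X Y" by (rule H.inv_closed) (use assms o in auto)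
  then show "inv\<^bsub>Hom C X Y\<^esub> f \<in> arrows C" "Dom C (inv\<^bsub>Hom C X Y\<^esub> f) = X" "Cod C (inv\<^bsub>Hom C X Y\<^esub> f) = Y"
    using o by auto
qed

lemma add_zero [simp]:
  assumes "f \<in> arrows C" "Dom C f = X" "Cod C f = Y"
  shows "f \<otimes>\<^bsub>Hom C X Y\<^esub> \<one>\<^bsub>Hom C X Y\<^esub> = f" "\<one>\<^bsub>Hom C X Y\<^esub> \<otimes>\<^bsub>Hom C X Y\<^esub> f = f"
    "f \<otimes>\<^bsub>Hom C X Y\<^esub> inv\<^bsub>Hom C X Y\<^esub> f = \<one>\<^bsub>Hom C X Y\<^esub>" "inv\<^bsub>Hom C X Y\<^esub> f \<otimes>\<^bsub>Hom C X Y\<^esub> f = \<one>\<^bsub>Hom C X Y\<^esub>"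
proof -
  have o: "X \<in> Obj C" "Y \<in> Obj C" using assms by auto
  interpret H: comm_group "Hom C X Y" using hom_group o by blast
  have f: "f \<in> maps C X Y" using assms o by auto
  show "f \<otimes>\<^bsub>Hom C X Y\<^esub> \<one>\<^bsub>Hom C X Y\<^esub> = f" "\<one>\<^bsub>Hom C X Y\<^esub> \<otimes>\<^bsub>Hom C X Y\<^esub> f = f"
    "f \<otimes>\<^bsub>Hom C X Y\<^esub> inv\<^bsub>Hom C X Y\<^esub> f = \<one>\<^bsub>Hom C X Y\<^esub>" "inv\<^bsub>Hom C X Y\<^esub> f \<otimes>\<^bsub>Hom C X Y\<^esub> f = \<one>\<^bsub>Hom C X Y\<^esub>"
    using f by auto
qed

lemma Hom_diff_cancel:
  assumes "f \<in> arrows C" "Dom C f = X" "Cod C f = Y" "g \<in> arrows C" "Dom C g = X" "Cod C g = Y"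
  shows "(f \<otimes>\<^bsub>Hom C X Y\<^esub> inv\<^bsub>Hom C X Y\<^esub> g) \<otimes>\<^bsub>Hom C X Y\<^esub> g = f"
    and Hom_commute: "f \<otimes>\<^bsub>Hom C X Y\<^esub> g = g \<otimes>\<^bsub>Hom C X Y\<^esub> f"
proof -
  have o: "X \<in> Obj C" "Y \<in> Obj C" using assms by auto
  interpret H: comm_group "Hom C X Y" using hom_group o by blast
  have f: "f \<in> maps C X Y" "g \<in> maps C X Y" using assms o by auto
  show "(f \<otimes>\<^bsub>Hom C X Y\<^esub> inv\<^bsub>Hom C X Y\<^esub> g) \<otimes>\<^bsub>Hom C X Y\<^esub> g = f"
    using f by (simp only: H.m_assoc H.inv_closed H.l_inv H.r_one)
  show "f \<otimes>\<^bsub>Hom C X Y\<^esub> g = g \<otimes>\<^bsub>Hom C X Y\<^esub> f" using f H.m_comm by blast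
qed

lemma comp_distrib:
  assumes "f \<in> arrows C" "g \<in> arrows C" "h \<in> arrows C" "Dom C g = Y" "Dom C h = Y" "Cod C f = Y"
    "Cod C g = Z" "Cod C h = Z" "Dom C f = X"
  shows "(g \<otimes>\<^bsub>Hom C Y Z\<^esub> h) \<cdot> f = (g \<cdot> f) \<otimes>\<^bsub>Hom C X Z\<^esub> (h \<cdot> f)"
  by (rule comp_add_left) (use assms in auto)

lemma comp_distrib2:
  assumes "f \<in> arrows C" "g \<in> arrows C" "h \<in> arrows C" "Dom C g = X" "Dom C h = X" "Cod C g = Y"
    "Cod C h = Y" "Dom C f = Y" "Cod C f = Z"
  shows "f \<cdot> (g \<otimes>\<^bsub>Hom C X Y\<^esub> h) = (f \<cdot> g) \<otimes>\<^bsub>Hom C X Z\<^esub> (f \<cdot> h)"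
  by (rule comp_add_right) (use assms in auto)

lemma precomp_hom:
  assumes "f \<in> arrows C" "Dom C f = A" "Cod C f = B" "X \<in> Obj C"
  shows "(\<lambda>u. u \<cdot> f) \<in> hom (Hom C B X) (Hom C A X)"
  using assms by (intro homI) (auto simp: comp_distrib)

lemma postcomp_hom:
  assumes "f \<in> arrows C" "Dom C f = A" "Cod C f = B" "X \<in> Obj C"
  shows "(\<lambda>u. f \<cdot> u) \<in> hom (Hom C X A) (Hom C X B)"
  using assms by (intro homI) (auto simp: comp_distrib2)

lemma zero_comp [simp]:
  assumes "f \<in> arrows C" "Y \<in> Obj C"
  shows "Cod C f = B \<Longrightarrow> \<one>\<^bsub>Hom C B Y\<^esub> \<cdot> f = \<one>\<^bsub>Hom C (Dom C f) Y\<^esub>"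
    "Dom C f = B \<Longrightarrow> f \<cdot> \<one>\<^bsub>Hom C Y B\<^esub> = \<one>\<^bsub>Hom C Y (Cod C f)\<^esub>"
  using hom_one[OF precomp_hom[of f]] hom_one[OF postcomp_hom[of f]] assms by auto

lemma precomp_group_hom:
  assumes "f \<in> arrows C" "Dom C f = A" "Cod C f = B" "X \<in> Obj C"
  shows "group_hom (Hom C B X) (Hom C A X) (\<lambda>u. u \<cdot> f)"
  using precomp_hom[OF assms] assms by (intro group_hom.intro group_hom_axioms.intro) auto

lemma neg_comp:
  assumes "f \<in> arrows C" "g \<in> arrows C" "Cod C f = Y" "Dom C g = Y" "Cod C g = Z" "Dom C f = X"
  shows "(inv\<^bsub>Hom C Y Z\<^esub> g) \<cdot> f = inv\<^bsub>Hom C X Z\<^esub> (g \<cdot> f)"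
  using group_hom.hom_inv[OF precomp_group_hom[of f X Y Z]] assms by auto

section \<open>Surjectivity and injectivity of Hom(f, X), and elements of the cokernel\<close>

definition hom_surj :: "'m \<Rightarrow> 'o \<Rightarrow> bool" where
  "hom_surj f X \<longleftrightarrow> (\<forall>u\<in>maps C (Dom C f) X. \<exists>v\<in>maps C (Cod C f) X. u = v \<cdot> f)"

text \<open>Both conditions are vanishing conditions at \<open>X\<close>: \<open>hom_surj\<close>
  says that the cokernel of Hom(f, -) is trivial, \<open>hom_inj\<close> that its kernel is.
  \<delta> turns the cokernel for an arrow into the kernel for the dual arrow, which is why the pair
  occurs together.\<close>

definition hom_inj :: "'m \<Rightarrow> 'o \<Rightarrow> bool" where
  "hom_inj f X \<longleftrightarrow> (\<forall>v\<in>maps C (Cod C f) X. v \<cdot> f = \<one>\<^bsub>Hom C (Dom C f) X\<^esub> \<longrightarrow> v = \<one>\<^bsub>Hom C (Cod C f) X\<^esub>)"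

definition precomp_image :: "'m \<Rightarrow> 'o \<Rightarrow> 'm set" where
  "precomp_image f X = (\<lambda>u. u \<cdot> f) ` maps C (Cod C f) X"

lemma hom_surj_iff:
  assumes "f \<in> arrows C" "X \<in> Obj C"
  shows "hom_surj f X \<longleftrightarrow> (\<lambda>u. u \<cdot> f) ` maps C (Cod C f) X = maps C (Dom C f) X"
proof -
  have "v \<in> maps C (Cod C f) X \<Longrightarrow> v \<cdot> f \<in> maps C (Dom C f) X" for v
    using assms by auto
  then show ?thesis unfolding hom_surj_def by blast
qed

lemma hom_inj_iff:
  assumes "f \<in> arrows C" "X \<in> Obj C"
  shows "hom_inj f X \<longleftrightarrow> inj_on (\<lambda>u. u \<cdot> f) (maps C (Cod C f) X)"
  using inj_on_one_iff'[OF precomp_hom[OF assms(1) refl refl assms(2)]] assms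
  unfolding hom_inj_def by auto

lemma precomp_subgroup:
  assumes "f \<in> arrows C" "X \<in> Obj C"
  shows "subgroup (precomp_image f X) (Hom C (Dom C f) X)"
  unfolding precomp_image_def
  using group_hom.img_is_subgroup[OF precomp_group_hom] assms by auto

text \<open>The element of the cokernel represented by \<open>k\<close>, named so that equality,
  products and the action of arrows can be computed on representatives.\<close>

definition cls :: "'m \<Rightarrow> 'o \<Rightarrow> 'm \<Rightarrow> 'm set" where
  "cls f X k = precomp_image f X #>\<^bsub>Hom C (Dom C f) X\<^esub> k"

lemma cls_mem:
  assumes "f \<in> arrows C" "k \<in> maps C (Dom C f) X" "X \<in> Obj C"
  shows "k' \<in> cls f X k \<longleftrightarrow> (\<exists>w\<in>maps C (Cod C f) X. k' = (w \<cdot> f) \<otimes>\<^bsub>Hom C (Dom C f) X\<^esub> k)"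
  unfolding cls_def r_coset_def precomp_image_def by auto

lemma cls_self:
  assumes "f \<in> arrows C" "k \<in> maps C (Dom C f) X" "X \<in> Obj C"
  shows "k \<in> cls f X k"
  unfolding cls_def by (intro group.rcos_self precomp_subgroup) (use assms in auto)

lemma cls_eq:
  assumes "f \<in> arrows C" "X \<in> Obj C" "k \<in> maps C (Dom C f) X" "k' \<in> maps C (Dom C f) X"
  shows "cls f X k' = cls f X k \<longleftrightarrow> (\<exists>w\<in>maps C (Cod C f) X. k' = (w \<cdot> f) \<otimes>\<^bsub>Hom C (Dom C f) X\<^esub> k)"
  using group.repr_independence[OF _ _ _ precomp_subgroup[of f X], of k' k] cls_mem[OF assms(1,3,2), of k']
    cls_self[OF assms(1,4,2)] assms unfolding cls_def by auto

lemma cls_one: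
  assumes "f \<in> arrows C" "X \<in> Obj C" "k \<in> maps C (Dom C f) X"
  shows "cls f X k = precomp_image f X \<longleftrightarrow> (\<exists>w\<in>maps C (Cod C f) X. k = w \<cdot> f)"
proof -
  have "cls f X k = precomp_image f X \<longleftrightarrow> k \<in> precomp_image f X"
    unfolding cls_def
    using group.coset_join1[OF _ _ _ precomp_subgroup[of f X], of k] group.coset_join2[OF _ _ precomp_subgroup[of f X], of k] assms by auto
  then show ?thesis unfolding precomp_image_def by auto
qed

lemma ao_coker: "ao (coker C f) X = Hom C (Dom C f) X Mod precomp_image f X"
  by (simp add: coker_def precomp_image_def)

lemma carrier_coker:
  "carrier (ao (coker C f) X) = cls f X ` maps C (Dom C f) X"
  unfolding ao_coker carrier_FactGroup cls_def by auto

lemma one_coker: "\<one>\<^bsub>ao (coker C f) X\<^esub> = precomp_image f X"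
  unfolding ao_coker by simp

lemma normal_precomp:
  assumes "f \<in> arrows C" "X \<in> Obj C"
  shows "precomp_image f X \<lhd> Hom C (Dom C f) X"
  using comm_group.normal_iff_subgroup[OF hom_group] precomp_subgroup assms by simp

lemma mult_coker:
  assumes "f \<in> arrows C" "X \<in> Obj C" "k \<in> maps C (Dom C f) X" "k' \<in> maps C (Dom C f) X"
  shows "cls f X k \<otimes>\<^bsub>ao (coker C f) X\<^esub> cls f X k' = cls f X (k \<otimes>\<^bsub>Hom C (Dom C f) X\<^esub> k')"
  using normal.rcos_sum[OF normal_precomp[OF assms(1,2)] assms(3,4)]
  by (simp add: cls_def ao_coker)

text \<open>If \<open>k'\<close> differs from \<open>k\<close> by \<open>w \<cdot> f\<close>, then
  \<open>g \<cdot> k'\<close> differs from \<open>g \<cdot> k\<close> by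
  \<open>(g \<cdot> w) \<cdot> f\<close>. So the union in \<open>coker\<close> runs over copies of a
  single coset.\<close>

lemma am_coker:
  assumes "f \<in> arrows C" "X \<in> Obj C" "X' \<in> Obj C" "k \<in> maps C (Dom C f) X" "g \<in> maps C X X'"
  shows "am (coker C f) g (cls f X k) = cls f X' (g \<cdot> k)"
proof -
  have g: "Cod C g = X'" "Dom C g = X" "g \<in> arrows C" using assms by auto
  have e: "cls f X' (g \<cdot> k') = cls f X' (g \<cdot> k)" if k': "k' \<in> cls f X k" for k'
  proof -
    obtain w where w: "w \<in> maps C (Cod C f) X" "k' = (w \<cdot> f) \<otimes>\<^bsub>Hom C (Dom C f) X\<^esub> k"
      using k' unfolding cls_mem[OF assms(1,4,2)] by blast
    have "g \<cdot> k' = ((g \<cdot> w) \<cdot> f) \<otimes>\<^bsub>Hom C (Dom C f) X'\<^esub> (g \<cdot> k)"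
      using w assms by (auto simp: comp_distrib2 assoc)
    moreover have "g \<cdot> w \<in> maps C (Cod C f) X'" using w assms by auto
    ultimately show ?thesis using w assms by (subst cls_eq) auto
  qed
  have "am (coker C f) g (cls f X k) = (\<Union>k'\<in>cls f X k. cls f X' (g \<cdot> k'))"
    by (simp add: coker_def cls_def precomp_image_def g(1))
  also have "\<dots> = cls f X' (g \<cdot> k)"
    by (rule SUP_eq_const) (use e cls_self[OF assms(1,4,2)] in blast)+
  finally show ?thesis .
qed

lemma coker_functor:
  assumes f: "f \<in> arrows C"
  shows "is_ab_functor C (coker C f)"
proof -
  have hom: "am (coker C f) g \<in> hom (ao (coker C f) X) (ao (coker C f) Y)"
    if o: "X \<in> Obj C" "Y \<in> Obj C" and g: "g \<in> maps C X Y" for X Y g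
  proof (rule homI)
    fix x y assume "x \<in> carrier (ao (coker C f) X)" "y \<in> carrier (ao (coker C f) X)"
    then obtain k l where kl: "k \<in> maps C (Dom C f) X" "x = cls f X k" "l \<in> maps C (Dom C f) X" "y = cls f X l"
      unfolding carrier_coker by blast
    have m: "g \<cdot> k \<in> maps C (Dom C f) Y" "g \<cdot> l \<in> maps C (Dom C f) Y" "k \<otimes>\<^bsub>Hom C (Dom C f) X\<^esub> l \<in> maps C (Dom C f) X"
      using kl f o g by auto
    show "am (coker C f) g x \<in> carrier (ao (coker C f) Y)"
      using m kl by (simp only: am_coker[OF f o _ g] carrier_coker) blast
    have "g \<cdot> (k \<otimes>\<^bsub>Hom C (Dom C f) X\<^esub> l) = (g \<cdot> k) \<otimes>\<^bsub>Hom C (Dom C f) Y\<^esub> (g \<cdot> l)"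
      using kl f o g by (auto simp: comp_distrib2)
    then show "am (coker C f) g (x \<otimes>\<^bsub>ao (coker C f) X\<^esub> y) = am (coker C f) g x \<otimes>\<^bsub>ao (coker C f) Y\<^esub> am (coker C f) g y"
      using kl m by (simp only: mult_coker[OF f o(1)] mult_coker[OF f o(2)] am_coker[OF f o _ g])
  qed
  show ?thesis unfolding is_ab_functor_def
  proof (intro conjI ballI)
    fix X assume X: "X \<in> Obj C"
    show "comm_group (ao (coker C f) X)"
      unfolding ao_coker by (rule comm_group.abelian_FactGroup[OF hom_group precomp_subgroup]) (use X f in auto)
    fix x assume "x \<in> carrier (ao (coker C f) X)"
    then obtain k where "k \<in> maps C (Dom C f) X" "x = cls f X k" unfolding carrier_coker by blast
    then show "am (coker C f) (Idt C X) x = x" using am_coker[OF f X X, of k "Idt C X"] f X by auto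
  next
    fix X Y g assume "X \<in> Obj C" "Y \<in> Obj C" "g \<in> maps C X Y"
    then show "am (coker C f) g \<in> hom (ao (coker C f) X) (ao (coker C f) Y)" by (rule hom)
  next
    fix X Y Z g h x assume o: "X \<in> Obj C" "Y \<in> Obj C" "Z \<in> Obj C" and gh: "g \<in> maps C X Y" "h \<in> maps C Y Z"
      and "x \<in> carrier (ao (coker C f) X)"
    then obtain k where k: "k \<in> maps C (Dom C f) X" "x = cls f X k" unfolding carrier_coker by blast
    have "am (coker C f) (h \<cdot> g) x = cls f Z ((h \<cdot> g) \<cdot> k)"
      unfolding k(2) by (rule am_coker[OF f o(1,3) k(1)]) (use o gh in auto)
    also have "(h \<cdot> g) \<cdot> k = h \<cdot> (g \<cdot> k)" using o gh k f by (auto simp: assoc)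
    also have "cls f Z \<dots> = am (coker C f) h (cls f Y (g \<cdot> k))"
      by (rule am_coker[OF f o(2,3), symmetric]) (use o gh k f in auto)
    also have "cls f Y (g \<cdot> k) = am (coker C f) g x"
      unfolding k(2) by (rule am_coker[OF f o(1,2), symmetric]) (use o gh k f in auto)
    finally show "am (coker C f) (h \<cdot> g) x = am (coker C f) h (am (coker C f) g x)" .
  next
    fix X Y g h x assume o: "X \<in> Obj C" "Y \<in> Obj C" and gh: "g \<in> maps C X Y" "h \<in> maps C X Y"
      and "x \<in> carrier (ao (coker C f) X)"
    then obtain k where k: "k \<in> maps C (Dom C f) X" "x = cls f X k" unfolding carrier_coker by blast
    have m: "g \<cdot> k \<in> maps C (Dom C f) Y" "h \<cdot> k \<in> maps C (Dom C f) Y" "g \<otimes>\<^bsub>Hom C X Y\<^esub> h \<in> maps C X Y"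
      using o gh k f by auto
    have "(g \<otimes>\<^bsub>Hom C X Y\<^esub> h) \<cdot> k = (g \<cdot> k) \<otimes>\<^bsub>Hom C (Dom C f) Y\<^esub> (h \<cdot> k)"
      using o gh k f by (auto simp: comp_distrib)
    then show "am (coker C f) (g \<otimes>\<^bsub>Hom C X Y\<^esub> h) x = am (coker C f) g x \<otimes>\<^bsub>ao (coker C f) Y\<^esub> am (coker C f) h x"
      unfolding k(2) using m
      by (simp only: am_coker[OF f o k(1) gh(1)] am_coker[OF f o k(1) gh(2)] am_coker[OF f o k(1) m(3)] mult_coker[OF f o(2)])
  qed
qed

lemma trivial_coker_iff:
  assumes "f \<in> arrows C" "X \<in> Obj C"
  shows "trivial_group (ao (coker C f) X) \<longleftrightarrow> hom_surj f X"
proof -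
  have g: "group (ao (coker C f) X)"
    using coker_functor[OF assms(1)] assms(2) unfolding is_ab_functor_def by (intro comm_group.axioms(2)) blast
  have "hom_surj f X \<longleftrightarrow> (\<forall>k\<in>maps C (Dom C f) X. cls f X k = precomp_image f X)"
    unfolding hom_surj_def by (intro ball_cong refl cls_one[OF assms, symmetric])
  then show ?thesis
    by (simp only: group.trivial_group_subset[OF g] carrier_coker one_coker image_subset_iff singleton_iff)
qed

end

section \<open>Isomorphisms of functors\<close>

lemma ab_functorD:
  assumes "is_ab_functor C F"
  shows "X \<in> Obj C \<Longrightarrow> comm_group (ao F X)"
    "\<lbrakk>X \<in> Obj C; Y \<in> Obj C; f \<in> maps C X Y\<rbrakk> \<Longrightarrow> am F f \<in> hom (ao F X) (ao F Y)"
    "\<lbrakk>X \<in> Obj C; Y \<in> Obj C; f \<in> maps C X Y; x \<in> carrier (ao F X)\<rbrakk> \<Longrightarrow> am F f x \<in> carrier (ao F Y)"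
proof -
  show "X \<in> Obj C \<Longrightarrow> comm_group (ao F X)" using assms unfolding is_ab_functor_def by blast
  show h: "\<lbrakk>X \<in> Obj C; Y \<in> Obj C; f \<in> maps C X Y\<rbrakk> \<Longrightarrow> am F f \<in> hom (ao F X) (ao F Y)"
    using assms unfolding is_ab_functor_def by blast
  show "\<lbrakk>X \<in> Obj C; Y \<in> Obj C; f \<in> maps C X Y; x \<in> carrier (ao F X)\<rbrakk> \<Longrightarrow> am F f x \<in> carrier (ao F Y)"
    by (rule hom_in_carrier[OF h])
qed

lemma ab_isomorphic_refl:
  assumes "is_ab_functor C F"
  shows "ab_isomorphic C F F"
  unfolding ab_isomorphic_def is_ab_nat_def
  by (rule exI[of _ "\<lambda>X x. x"]) (auto simp: hom_def iso_def bij_betw_def)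

text \<open>The part of functoriality that inverting a natural isomorphism uses. It is isolated
  because \<open>delta\<close> enters the argument through this closure and an isomorphism with a
  kernel functor.\<close>

definition ab_closed :: "('o, 'm, 'z) cat_scheme \<Rightarrow> ('o, 'm, 'a) abftor \<Rightarrow> bool" where
  "ab_closed C F \<longleftrightarrow>
     (\<forall>X\<in>Obj C. \<forall>x\<in>carrier (ao F X). \<forall>y\<in>carrier (ao F X). x \<otimes>\<^bsub>ao F X\<^esub> y \<in> carrier (ao F X)) \<and>
     (\<forall>X\<in>Obj C. \<forall>Y\<in>Obj C. \<forall>f\<in>maps C X Y. \<forall>x\<in>carrier (ao F X). am F f x \<in> carrier (ao F Y))"

lemma ab_functor_closed: "is_ab_functor C F \<Longrightarrow> ab_closed C F"
  unfolding ab_closed_def using ab_functorD(1,3)[of C F]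
  by (simp add: monoid.m_closed group.is_monoid comm_group.axioms(2))

text \<open>Every product in \<open>G\<close>, and every action of an arrow on \<open>G\<close>, is
  the image of one in \<open>F\<close>. Closure of the source \<open>F\<close> is therefore what
  makes the inverse a natural homomorphism.\<close>

lemma ab_isomorphic_sym:
  assumes F: "ab_closed C F" and FG: "ab_isomorphic C F G"
  shows "ab_isomorphic C G F"
proof -
  obtain \<eta> where n: "is_ab_nat C F G \<eta>" and i: "\<And>X. X \<in> Obj C \<Longrightarrow> \<eta> X \<in> iso (ao F X) (ao G X)"
    using FG unfolding ab_isomorphic_def by blast
  define \<theta> where "\<theta> X = inv_into (carrier (ao F X)) (\<eta> X)" for X
  have bij: "bij_betw (\<eta> X) (carrier (ao F X)) (carrier (ao G X))" if "X \<in> Obj C" for X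
    using i[OF that] by (simp add: iso_def)
  have th: "\<theta> X (\<eta> X y) = y" if "X \<in> Obj C" "y \<in> carrier (ao F X)" for X y
    using that bij[OF that(1)] by (simp add: \<theta>_def bij_betw_def)
  have ex: "\<exists>y\<in>carrier (ao F X). x = \<eta> X y" if "X \<in> Obj C" "x \<in> carrier (ao G X)" for X x
    using that bij[OF that(1)] by (auto simp: bij_betw_def)
  have hom: "\<theta> X \<in> hom (ao G X) (ao F X)" if X: "X \<in> Obj C" for X
  proof (rule homI)
    fix x y assume "x \<in> carrier (ao G X)" "y \<in> carrier (ao G X)"
    then obtain x' y' where xy: "x' \<in> carrier (ao F X)" "x = \<eta> X x'" "y' \<in> carrier (ao F X)" "y = \<eta> X y'"
      using ex[OF X] by blast
    show "\<theta> X x \<in> carrier (ao F X)" using xy th[OF X] by simp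
    have "x \<otimes>\<^bsub>ao G X\<^esub> y = \<eta> X (x' \<otimes>\<^bsub>ao F X\<^esub> y')"
      using i[OF X] hom_mult[of "\<eta> X" "ao F X" "ao G X" x' y'] xy by (simp add: iso_def)
    moreover have "x' \<otimes>\<^bsub>ao F X\<^esub> y' \<in> carrier (ao F X)" using F X xy unfolding ab_closed_def by blast
    ultimately show "\<theta> X (x \<otimes>\<^bsub>ao G X\<^esub> y) = \<theta> X x \<otimes>\<^bsub>ao F X\<^esub> \<theta> X y" using xy th[OF X] by simp
  qed
  have nat: "\<theta> Y (am G f x) = am F f (\<theta> X x)"
    if o: "X \<in> Obj C" "Y \<in> Obj C" "f \<in> maps C X Y" and x: "x \<in> carrier (ao G X)" for X Y f x
  proof -
    obtain y where y: "y \<in> carrier (ao F X)" "x = \<eta> X y" using ex[OF o(1) x] by blast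
    have "am G f x = \<eta> Y (am F f y)" using n o y unfolding is_ab_nat_def by simp
    moreover have "am F f y \<in> carrier (ao F Y)" using F o y unfolding ab_closed_def by blast
    ultimately show ?thesis using th o y by simp
  qed
  have "bij_betw (\<theta> X) (carrier (ao G X)) (carrier (ao F X))" if "X \<in> Obj C" for X
    unfolding \<theta>_def by (rule bij_betw_inv_into[OF bij[OF that]])
  then show ?thesis unfolding ab_isomorphic_def is_ab_nat_def
    by (intro exI[of _ \<theta>]) (use hom nat in \<open>auto simp: iso_def\<close>)
qed

lemma ab_isomorphic_trans:
  assumes "ab_isomorphic C F G" "ab_isomorphic C G H"
  shows "ab_isomorphic C F H"
proof -
  obtain \<eta> \<theta> where n: "is_ab_nat C F G \<eta>" "is_ab_nat C G H \<theta>"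
    and i: "\<And>X. X \<in> Obj C \<Longrightarrow> \<eta> X \<in> iso (ao F X) (ao G X)" "\<And>X. X \<in> Obj C \<Longrightarrow> \<theta> X \<in> iso (ao G X) (ao H X)"
    using assms unfolding ab_isomorphic_def by blast
  show ?thesis unfolding ab_isomorphic_def is_ab_nat_def
  proof (intro exI[of _ "\<lambda>X x. \<theta> X (\<eta> X x)"] conjI ballI)
    fix X assume X: "X \<in> Obj C"
    show "(\<lambda>x. \<theta> X (\<eta> X x)) \<in> hom (ao F X) (ao H X)"
      using i[OF X] by (auto simp: iso_def hom_def Pi_iff)
    show "(\<lambda>x. \<theta> X (\<eta> X x)) \<in> iso (ao F X) (ao H X)"
      using i[OF X] bij_betw_trans[of "\<eta> X" _ _ "\<theta> X"] by (auto simp: iso_def hom_def Pi_iff o_def)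
  next
    fix X Y f x assume "X \<in> Obj C" "Y \<in> Obj C" "f \<in> maps C X Y" "x \<in> carrier (ao F X)"
    moreover from this have "\<eta> X x \<in> carrier (ao G X)" using i by (auto simp: iso_def hom_def Pi_iff)
    ultimately show "\<theta> Y (\<eta> Y (am F f x)) = am H f (\<theta> X (\<eta> X x))"
      using n unfolding is_ab_nat_def by simp
  qed
qed

lemma full_subcategory_sel [simp]:
  "Obj (full_subcategory C S) = S" "Dom (full_subcategory C S) = Dom C" "Cod (full_subcategory C S) = Cod C"
  "Hom (full_subcategory C S) = Hom C" "Cmp (full_subcategory C S) = Cmp C" "Idt (full_subcategory C S) = Idt C"
  by (simp_all add: full_subcategory_def)

lemma opp_sel [simp]:
  "Obj (opp C) = Obj C" "Dom (opp C) = Cod C" "Cod (opp C) = Dom C"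
  "Hom (opp C) X Y = Hom C Y X" "Cmp (opp C) g f = Cmp C f g" "Idt (opp C) = Idt C"
  by (simp_all add: opp_def)

lemma (in preadditive_category) preadditive_full_subcategory:
  assumes "S \<subseteq> Obj C"
  shows "preadditive_category (full_subcategory C S)"
proof -
  have S: "X \<in> S \<Longrightarrow> X \<in> Obj C" for X using assms by blast
  show ?thesis
    by (rule preadditive_category.intro) (simp_all add: S hom_group assoc comp_distrib comp_distrib2)
qed

context preadditive_category
begin

text \<open>By Yoneda, an isomorphism of the cokernels and its inverse come from arrows
  \<open>a\<close> and \<open>a'\<close> between the domains, with
  \<open>f' \<cdot> a' = b' \<cdot> f\<close> and with the identity of \<open>A\<close> equal to the
  sum of \<open>c \<cdot> f\<close> and \<open>a \<cdot> a'\<close>. These are equations between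
  arrows, so they can be used at every \<open>X\<close> of \<open>C\<close>, even outside
  \<open>S\<close>, where the isomorphism itself says nothing. If
  \<open>u \<cdot> a = w \<cdot> f'\<close>, then \<open>u\<close> is the sum of
  \<open>u \<cdot> c\<close> and \<open>w \<cdot> b'\<close>, composed with
  \<open>f\<close>.\<close>

lemma coker_iso_hom_surj:
  assumes f: "f \<in> arrows C" "Dom C f \<in> S" "Cod C f \<in> S" and f': "f' \<in> arrows C" "Dom C f' \<in> S" "Cod C f' \<in> S"
    and S: "S \<subseteq> Obj C"
    and iso: "ab_isomorphic (full_subcategory C S) (coker C f) (coker C f')"
    and X: "X \<in> Obj C" and surj: "hom_surj f' X"
  shows "hom_surj f X"
proof -
  define A B A' B' where d: "A = Dom C f" "B = Cod C f" "A' = Dom C f'" "B' = Cod C f'"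
  have dsimp [simp]: "Dom C f = A" "Cod C f = B" "Dom C f' = A'" "Cod C f' = B'" by (simp_all add: d)
  have o [simp]: "A \<in> Obj C" "B \<in> Obj C" "A' \<in> Obj C" "B' \<in> Obj C" using f f' S by auto
  have s: "A \<in> S" "B \<in> S" "A' \<in> S" "B' \<in> S" using f f' by (simp_all only: d)
  note [simp] = f(1) f'(1)
  obtain \<eta> where nat: "\<And>X Y g x. \<lbrakk>X \<in> S; Y \<in> S; g \<in> maps C X Y; x \<in> carrier (ao (coker C f) X)\<rbrakk>
        \<Longrightarrow> \<eta> Y (am (coker C f) g x) = am (coker C f') g (\<eta> X x)"
    and bij: "\<And>X. X \<in> S \<Longrightarrow> bij_betw (\<eta> X) (carrier (ao (coker C f) X)) (carrier (ao (coker C f') X))"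
    using iso unfolding ab_isomorphic_def is_ab_nat_def iso_def full_subcategory_sel by blast
  have c: "cls f W k \<in> carrier (ao (coker C f) W)" if "k \<in> arrows C" "Dom C k = A" "Cod C k = W" for k W
    unfolding carrier_coker using that by (intro imageI) auto
  have c': "cls f' W k \<in> carrier (ao (coker C f') W)" if "k \<in> arrows C" "Dom C k = A'" "Cod C k = W" for k W
    unfolding carrier_coker using that by (intro imageI) auto
  have "\<eta> A (cls f A (Idt C A)) \<in> carrier (ao (coker C f') A)"
    using bij[OF s(1)] c[of "Idt C A" A] by (auto simp: bij_betw_def)
  then obtain a where a: "\<eta> A (cls f A (Idt C A)) = cls f' A a" "a \<in> maps C A' A"
    unfolding carrier_coker by auto
  have "cls f' A' (Idt C A') \<in> \<eta> A' ` carrier (ao (coker C f) A')"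
    using bij[OF s(3)] c'[of "Idt C A'" A'] by (auto simp: bij_betw_def)
  then obtain a' where a': "\<eta> A' (cls f A' a') = cls f' A' (Idt C A')" "a' \<in> maps C A A'"
    unfolding carrier_coker by auto
  have inj: "cls f W k = cls f W l" if "\<eta> W (cls f W k) = \<eta> W (cls f W l)" "W \<in> S"
    "k \<in> maps C A W" "l \<in> maps C A W" for W k l
    using bij[OF that(2)] that c S by (auto simp: bij_betw_def inj_on_def subset_iff)
  have na': "\<eta> W (cls f W (g \<cdot> a')) = cls f' W g" if "W \<in> S" "g \<in> maps C A' W" for W g
  proof -
    have W [simp]: "W \<in> Obj C" using that S by auto
    have "\<eta> W (cls f W (g \<cdot> a')) = \<eta> W (am (coker C f) g (cls f A' a'))"
      using that a' by (subst am_coker) auto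
    also have "\<dots> = am (coker C f') g (cls f' A' (Idt C A'))"
      using nat[OF s(3) that, of "cls f A' a'"] a' c by auto
    also have "\<dots> = cls f' W g" using that by (subst am_coker) auto
    finally show ?thesis .
  qed
  \<comment> \<open>\<open>f'\<close> represents zero in its own cokernel. Carried back along
    \<eta>, this says that \<open>f' \<cdot> a'\<close> is zero in the cokernel of \<open>f\<close>,
    which yields \<open>b'\<close>.\<close>
  have "cls f' B' f' = cls f' B' \<one>\<^bsub>Hom C A' B'\<^esub>"
    by (subst cls_eq) (auto intro!: bexI[of _ "Idt C B'"])
  then have "\<eta> B' (cls f B' (f' \<cdot> a')) = \<eta> B' (cls f B' (\<one>\<^bsub>Hom C A' B'\<^esub> \<cdot> a'))"
    using na'[OF s(4), of f'] na'[OF s(4), of "\<one>\<^bsub>Hom C A' B'\<^esub>"] by (simp del: zero_comp)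
  then have "cls f B' (f' \<cdot> a') = cls f B' (\<one>\<^bsub>Hom C A' B'\<^esub> \<cdot> a')"
    by (rule inj) (use a' s in auto)
  then have "cls f B' (f' \<cdot> a') = cls f B' \<one>\<^bsub>Hom C A B'\<^esub>" using a' by simp
  then obtain b' where b': "b' \<in> maps C B B'" "f' \<cdot> a' = b' \<cdot> f"
    by (subst (asm) cls_eq) (use a' in auto)
  \<comment> \<open>Passing to the other cokernel and back is the identity; on representatives this
    holds up to an arrow that factors through \<open>f\<close>.\<close>
  have "\<eta> A (cls f A (a \<cdot> a')) = \<eta> A (cls f A (Idt C A))" using a s by (simp add: na')
  then have "cls f A (Idt C A) = cls f A (a \<cdot> a')"
    by (intro inj) (use a a' s in auto)
  then obtain c where cc: "c \<in> maps C B A" "Idt C A = (c \<cdot> f) \<otimes>\<^bsub>Hom C A A\<^esub> (a \<cdot> a')"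
    by (subst (asm) cls_eq) (use a a' in auto)
  show ?thesis unfolding hom_surj_def
  proof
    fix u assume "u \<in> maps C (Dom C f) X"
    then have u: "u \<in> arrows C" "Dom C u = A" "Cod C u = X" using X by auto
    have "u \<cdot> a \<in> maps C A' X" using u a X by auto
    then obtain w where w: "w \<in> maps C B' X" "u \<cdot> a = w \<cdot> f'" using surj unfolding hom_surj_def by auto
    have "u = u \<cdot> ((c \<cdot> f) \<otimes>\<^bsub>Hom C A A\<^esub> (a \<cdot> a'))" using cc(2) u by (metis comp_id(2))
    also have "\<dots> = (u \<cdot> (c \<cdot> f)) \<otimes>\<^bsub>Hom C A X\<^esub> (u \<cdot> (a \<cdot> a'))"
      using u cc(1) a a' by (simp add: comp_distrib2)
    also have "u \<cdot> (a \<cdot> a') = w \<cdot> (f' \<cdot> a')" using u a a' w X by (simp add: assoc[symmetric])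
    also have "\<dots> = (w \<cdot> b') \<cdot> f" using w b' X by (simp add: assoc)
    also have "u \<cdot> (c \<cdot> f) = (u \<cdot> c) \<cdot> f" using u cc by (simp add: assoc)
    also have "((u \<cdot> c) \<cdot> f) \<otimes>\<^bsub>Hom C A X\<^esub> ((w \<cdot> b') \<cdot> f) = ((u \<cdot> c) \<otimes>\<^bsub>Hom C B X\<^esub> (w \<cdot> b')) \<cdot> f"
      using u cc(1) w b'(1) X by (simp add: comp_distrib)
    finally have "u = ((u \<cdot> c) \<otimes>\<^bsub>Hom C B X\<^esub> (w \<cdot> b')) \<cdot> f" .
    moreover have "(u \<cdot> c) \<otimes>\<^bsub>Hom C B X\<^esub> (w \<cdot> b') \<in> maps C (Cod C f) X"
      using u cc(1) w b'(1) X by simp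
    ultimately show "\<exists>v\<in>maps C (Cod C f) X. u = v \<cdot> f" by blast
  qed
qed

section \<open>Kernels of Hom(f, -) and natural maps out of a cokernel\<close>

definition hom_kernel :: "'m \<Rightarrow> ('o, 'm, 'm) abftor" where
  "hom_kernel f = \<lparr>ao = (\<lambda>X. (Hom C (Cod C f) X)\<lparr>carrier := {v \<in> maps C (Cod C f) X. v \<cdot> f = \<one>\<^bsub>Hom C (Dom C f) X\<^esub>}\<rparr>),
                  am = (\<lambda>g u. g \<cdot> u)\<rparr>"

lemma hom_kernel_functor:
  assumes f: "f \<in> arrows C"
  shows "is_ab_functor C (hom_kernel f)"
proof -
  have "comm_group (ao (hom_kernel f) X)" if X: "X \<in> Obj C" for X
  proof -
    have "{v \<in> maps C (Cod C f) X. v \<cdot> f = \<one>\<^bsub>Hom C (Dom C f) X\<^esub>} = kernel (Hom C (Cod C f) X) (Hom C (Dom C f) X) (\<lambda>u. u \<cdot> f)"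
      by (simp add: kernel_def)
    moreover have "subgroup \<dots> (Hom C (Cod C f) X)"
      by (rule group_hom.subgroup_kernel[OF precomp_group_hom]) (use f X in auto)
    ultimately have "group (ao (hom_kernel f) X)"
      using subgroup.subgroup_is_group[OF _ group_Hom] f X by (simp add: hom_kernel_def)
    then show ?thesis
      by (rule group.group_comm_groupI) (use f X in \<open>simp add: hom_kernel_def Hom_commute\<close>)
  qed
  then show ?thesis unfolding is_ab_functor_def
    using f by (auto simp: hom_kernel_def hom_def comp_distrib comp_distrib2 assoc)
qed

text \<open>Precomposition with \<open>g\<close> lands in the kernel of Hom(f, X). By
  \<open>ex1\<close> it fills this kernel, and by \<open>ex2\<close> its own kernel is the image of
  Hom(h, X). The hypotheses are what three consecutive arrows of a triangle satisfy.\<close>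

lemma coker_iso_hom_kernel:
  assumes fgh: "f \<in> arrows C" "g \<in> arrows C" "h \<in> arrows C" "Cod C f = Dom C g" "Cod C g = Dom C h"
    and S: "S \<subseteq> Obj C"
    and zero: "g \<cdot> f = \<one>\<^bsub>Hom C (Dom C f) (Cod C g)\<^esub>" "h \<cdot> g = \<one>\<^bsub>Hom C (Dom C g) (Cod C h)\<^esub>"
    and ex1: "\<And>X v. \<lbrakk>X \<in> S; v \<in> maps C (Dom C g) X; v \<cdot> f = \<one>\<^bsub>Hom C (Dom C f) X\<^esub>\<rbrakk> \<Longrightarrow> \<exists>w\<in>maps C (Cod C g) X. v = w \<cdot> g"
    and ex2: "\<And>X v. \<lbrakk>X \<in> S; v \<in> maps C (Dom C h) X; v \<cdot> g = \<one>\<^bsub>Hom C (Dom C g) X\<^esub>\<rbrakk> \<Longrightarrow> \<exists>w\<in>maps C (Cod C h) X. v = w \<cdot> h"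
  shows "ab_isomorphic (full_subcategory C S) (coker C h) (hom_kernel f)"
proof -
  \<comment> \<open>All elements of a coset have the same composite with \<open>g\<close>, because
    \<open>h \<cdot> g\<close> is zero; \<open>the_elem\<close> extracts this composite.\<close>
  define \<eta> where "\<eta> X K = the_elem ((\<lambda>w. w \<cdot> g) ` K)" for X :: 'o and K
  have S': "X \<in> S \<Longrightarrow> X \<in> Obj C" for X using S by blast
  have iso: "\<eta> X \<in> iso (ao (coker C h) X) (ao (hom_kernel f) X)" if X: "X \<in> S" for X
  proof -
    let ?p = "\<lambda>w. w \<cdot> g" and ?H = "Hom C (Dom C h) X"
    have Xo: "X \<in> Obj C" using X S' by blast
    have p: "?p \<in> hom ?H (ao (hom_kernel f) X)"
      using fgh Xo zero by (auto simp: hom_kernel_def hom_def comp_distrib assoc)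
    interpret p: group_hom ?H "ao (hom_kernel f) X" ?p
      using p fgh Xo comm_group.axioms(2)[OF ab_functorD(1)[OF hom_kernel_functor[OF fgh(1)] Xo]]
      by (intro group_hom.intro group_hom_axioms.intro) auto
    have "?p ` carrier ?H = carrier (ao (hom_kernel f) X)"
    proof
      show "?p ` carrier ?H \<subseteq> carrier (ao (hom_kernel f) X)" using p.hom_closed by blast
      show "carrier (ao (hom_kernel f) X) \<subseteq> ?p ` carrier ?H"
        using ex1[OF X] fgh by (auto simp: hom_kernel_def simp del: maps_iff)
    qed
    \<comment> \<open>The first isomorphism theorem; what remains is to recognise the kernel as the
      subgroup by which \<open>coker\<close> divides.\<close>
    from p.FactGroup_iso_set[OF this]
    have "\<eta> X \<in> iso (?H Mod kernel ?H (ao (hom_kernel f) X) ?p) (ao (hom_kernel f) X)"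
      unfolding \<eta>_def by simp
    moreover have "kernel ?H (ao (hom_kernel f) X) ?p = precomp_image h X"
    proof
      show "kernel ?H (ao (hom_kernel f) X) ?p \<subseteq> precomp_image h X"
        using ex2[OF X] fgh by (auto simp: kernel_def precomp_image_def hom_kernel_def simp del: maps_iff)
      show "precomp_image h X \<subseteq> kernel ?H (ao (hom_kernel f) X) ?p"
        using fgh Xo zero by (auto simp: kernel_def precomp_image_def hom_kernel_def assoc)
    qed
    ultimately show ?thesis by (simp add: ao_coker)
  qed
  have val: "\<eta> X (cls h X w) = w \<cdot> g" if w: "w \<in> maps C (Dom C h) X" "X \<in> Obj C" for X w
  proof -
    have "w' \<cdot> g = w \<cdot> g" if w': "w' \<in> cls h X w" for w'
    proof -
      obtain t where t: "t \<in> maps C (Cod C h) X" "w' = (t \<cdot> h) \<otimes>\<^bsub>Hom C (Dom C h) X\<^esub> w"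
        using w' unfolding cls_mem[OF fgh(3) w] by blast
      have t': "t \<in> arrows C" "Dom C t = Cod C h" "Cod C t = X" "w \<in> arrows C" "Dom C w = Dom C h" "Cod C w = X"
        using t(1) w fgh by auto
      have "w' \<cdot> g = ((t \<cdot> h) \<cdot> g) \<otimes>\<^bsub>Hom C (Dom C g) X\<^esub> (w \<cdot> g)"
        unfolding t(2) by (rule comp_distrib) (use fgh t' in auto)
      also have "(t \<cdot> h) \<cdot> g = t \<cdot> (h \<cdot> g)" by (rule assoc) (use fgh t' in auto)
      also have "\<dots> = \<one>\<^bsub>Hom C (Dom C g) X\<^esub>" unfolding zero(2) using fgh t' by simp
      finally show ?thesis using fgh t' by simp
    qed
    then have "(\<lambda>w. w \<cdot> g) ` cls h X w \<subseteq> {w \<cdot> g}" by blast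
    moreover have "w \<cdot> g \<in> (\<lambda>w. w \<cdot> g) ` cls h X w" using cls_self[OF fgh(3) w] by blast
    ultimately have "(\<lambda>w. w \<cdot> g) ` cls h X w = {w \<cdot> g}" by blast
    then show ?thesis by (simp add: \<eta>_def)
  qed
  have nat: "\<eta> Y (am (coker C h) k x) = am (hom_kernel f) k (\<eta> X x)"
    if o: "X \<in> S" "Y \<in> S" and k: "k \<in> maps C X Y" and x: "x \<in> carrier (ao (coker C h) X)" for X Y k x
  proof -
    obtain w where w: "w \<in> maps C (Dom C h) X" "x = cls h X w" using x unfolding carrier_coker by blast
    have "am (coker C h) k x = cls h Y (k \<cdot> w)"
      unfolding w(2) by (rule am_coker[OF fgh(3) S'[OF o(1)] S'[OF o(2)] w(1) k])
    moreover have "\<eta> Y (cls h Y (k \<cdot> w)) = (k \<cdot> w) \<cdot> g" by (rule val) (use S' o w k fgh in auto)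
    moreover have "\<eta> X x = w \<cdot> g" unfolding w(2) by (rule val[OF w(1) S'[OF o(1)]])
    moreover have "(k \<cdot> w) \<cdot> g = k \<cdot> (w \<cdot> g)" using S' o w k fgh by (auto simp: assoc)
    ultimately show ?thesis by (simp add: hom_kernel_def)
  qed
  show ?thesis unfolding ab_isomorphic_def is_ab_nat_def full_subcategory_sel
    by (rule exI[of _ \<eta>]) (use iso nat in \<open>auto simp: iso_def\<close>)
qed

text \<open>Yoneda: a map from a quotient of \<open>Hom(A, -)\<close> is determined by its value at the image \<open>\<gamma>\<close> of the identity.\<close>

lemma nat_group_corep_bij:
  assumes f: "f \<in> arrows C" and G: "is_ab_functor C G" and iso: "ab_isomorphic C G (coker C f)"
  obtains \<gamma> where "\<gamma> \<in> carrier (ao G (Dom C f))"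
    and "\<And>W. W \<in> Obj C \<Longrightarrow> bij_betw (\<lambda>\<eta>. \<eta> (Dom C f) \<gamma>) (carrier (nat_group C G (corep C W)))
           {u \<in> maps C W (Dom C f). f \<cdot> u = \<one>\<^bsub>Hom C W (Cod C f)\<^esub>}"
proof -
  define A B where AB: "A = Dom C f" "B = Cod C f"
  have [simp]: "A \<in> Obj C" "B \<in> Obj C" using f by (auto simp: AB)
  have fAB: "f \<in> arrows C" "Dom C f = A" "Cod C f = B" using f by (simp_all only: AB)
  obtain \<alpha> where nat: "\<And>X Y g x. \<lbrakk>X \<in> Obj C; Y \<in> Obj C; g \<in> maps C X Y; x \<in> carrier (ao G X)\<rbrakk>
        \<Longrightarrow> \<alpha> Y (am G g x) = am (coker C f) g (\<alpha> X x)"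
    and ai: "\<And>X. X \<in> Obj C \<Longrightarrow> \<alpha> X \<in> iso (ao G X) (ao (coker C f) X)"
    using iso unfolding ab_isomorphic_def is_ab_nat_def by blast
  have hom: "\<alpha> X \<in> hom (ao G X) (ao (coker C f) X)"
    and bij: "bij_betw (\<alpha> X) (carrier (ao G X)) (carrier (ao (coker C f) X))" if "X \<in> Obj C" for X
    using ai[OF that] by (auto simp: iso_def)
  have inj: "x = y" if "\<alpha> X x = \<alpha> X y" "X \<in> Obj C" "x \<in> carrier (ao G X)" "y \<in> carrier (ao G X)" for X x y
    using bij[OF that(2)] that unfolding bij_betw_def inj_on_def by blast
  have rep: "\<exists>k\<in>maps C A X. \<alpha> X x = cls f X k" if "X \<in> Obj C" "x \<in> carrier (ao G X)" for X x
  proof -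
    have "\<alpha> X x \<in> carrier (ao (coker C f) X)" using bij[OF that(1)] that(2) by (auto simp: bij_betw_def)
    then show ?thesis unfolding carrier_coker AB by blast
  qed
  have "cls f A (Idt C A) \<in> carrier (ao (coker C f) A)"
    unfolding carrier_coker using f by (intro imageI) (auto simp: fAB)
  then obtain \<gamma> where g: "\<gamma> \<in> carrier (ao G A)" "\<alpha> A \<gamma> = cls f A (Idt C A)"
    using bij[of A] by (metis \<open>A \<in> Obj C\<close> bij_betw_imp_surj_on imageE)
  have gk: "am G k \<gamma> \<in> carrier (ao G X)" "\<alpha> X (am G k \<gamma>) = cls f X k" if k: "k \<in> maps C A X" "X \<in> Obj C" for X k
  proof -
    show "am G k \<gamma> \<in> carrier (ao G X)" using ab_functorD(3)[OF G _ k(2,1) g(1)] by simp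
    have "\<alpha> X (am G k \<gamma>) = am (coker C f) k (cls f A (Idt C A))" using nat[OF _ k(2,1) g(1)] g(2) by simp
    also have "\<dots> = cls f X (k \<cdot> Idt C A)" by (rule am_coker) (use k fAB in auto)
    finally show "\<alpha> X (am G k \<gamma>) = cls f X k" using k by simp
  qed
  \<comment> \<open>\<gamma> generates \<open>G\<close>, which makes evaluation at \<gamma>
    injective on natural maps.\<close>
  have gen: "x = am G k \<gamma>" if "\<alpha> X x = cls f X k" "k \<in> maps C A X" "X \<in> Obj C" "x \<in> carrier (ao G X)" for X x k
    using inj[OF _ that(3,4) gk(1)[OF that(2,3)]] gk(2)[OF that(2,3)] that(1) by simp
  \<comment> \<open>\<open>f\<close> kills the class of the identity. Hence the value
    \<open>u\<close> of a natural map at \<gamma> satisfies \<open>f \<cdot> u = 0\<close>.\<close>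
  have gf: "am G f \<gamma> = \<one>\<^bsub>ao G B\<^esub>"
  proof -
    have fm: "f \<in> maps C A B" using fAB by simp
    have "cls f B f = precomp_image f B"
      by (subst cls_one) (use fAB in \<open>auto intro!: bexI[of _ "Idt C B"]\<close>)
    also have "\<dots> = \<alpha> B \<one>\<^bsub>ao G B\<^esub>"
      using hom_one[OF hom[of B]] ab_functorD(1)[OF G, of B] ab_functorD(1)[OF coker_functor[OF f], of B]
      by (simp add: one_coker comm_group.axioms(2))
    finally show ?thesis
      using gk[OF fm] ab_functorD(1)[OF G, of B]
      by (intro inj[of B]) (auto simp: monoid.one_closed group.is_monoid comm_group.axioms(2))
  qed
  have bijW: "bij_betw (\<lambda>\<eta>. \<eta> A \<gamma>) (carrier (nat_group C G (corep C W)))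
           {u \<in> maps C W A. f \<cdot> u = \<one>\<^bsub>Hom C W B\<^esub>}" (is "bij_betw _ ?N ?K") if W: "W \<in> Obj C" for W
  proof (rule bij_betw_imageI)
    have nk: "\<eta> X (am G k \<gamma>) = k \<cdot> \<eta> A \<gamma>" if "\<eta> \<in> ?N" "X \<in> Obj C" "k \<in> maps C A X" for \<eta> X k
      using that g(1) unfolding nat_group_def is_ab_nat_def by (simp add: corep_def)
    show "inj_on (\<lambda>\<eta>. \<eta> A \<gamma>) ?N"
    proof (rule inj_onI)
      fix \<eta> \<eta>' assume e: "\<eta> \<in> ?N" "\<eta>' \<in> ?N" "\<eta> A \<gamma> = \<eta>' A \<gamma>"
      have "\<eta> X x = \<eta>' X x" if X: "X \<in> Obj C" "x \<in> carrier (ao G X)" for X x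
      proof -
        obtain k where k: "k \<in> maps C A X" "\<alpha> X x = cls f X k" using rep[OF X] by blast
        have "x = am G k \<gamma>" by (rule gen[OF k(2,1) X])
        then show ?thesis using nk[OF e(1) X(1) k(1)] nk[OF e(2) X(1) k(1)] e(3) by simp
      qed
      moreover have "\<eta> X \<in> extensional (carrier (ao G X))" "\<eta>' X \<in> extensional (carrier (ao G X))"
        if "X \<in> Obj C" for X
        using e that unfolding nat_group_def by auto
      ultimately have "\<eta> X = \<eta>' X" if "X \<in> Obj C" for X
        using that by (intro extensionalityI[of _ "carrier (ao G X)"]) auto
      then show "\<eta> = \<eta>'"
        using e unfolding nat_group_def by (intro PiE_ext[of \<eta> "Obj C" _ \<eta>']) auto
    qed
    show "(\<lambda>\<eta>. \<eta> A \<gamma>) ` ?N = ?K"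
    proof (intro equalityI subsetI)
      fix u assume "u \<in> (\<lambda>\<eta>. \<eta> A \<gamma>) ` ?N"
      then obtain \<eta> where e: "\<eta> \<in> ?N" "u = \<eta> A \<gamma>" by blast
      have he: "\<eta> X \<in> hom (ao G X) (Hom C W X)" if "X \<in> Obj C" for X
        using e that unfolding nat_group_def is_ab_nat_def by (simp add: corep_def)
      have "f \<cdot> u = \<eta> B \<one>\<^bsub>ao G B\<^esub>" using nk[OF e(1), of B f] fAB gf e(2) by simp
      also have "\<dots> = \<one>\<^bsub>Hom C W B\<^esub>"
        using hom_one[OF he[of B]] ab_functorD(1)[OF G, of B] W by (simp add: comm_group.axioms(2))
      finally have "f \<cdot> u = \<one>\<^bsub>Hom C W B\<^esub>" .
      moreover have "u \<in> maps C W A" unfolding e(2) by (rule hom_in_carrier[OF he g(1)]) simp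
      ultimately show "u \<in> ?K" by blast
    next
      fix u assume "u \<in> ?K"
      then have u: "u \<in> arrows C" "Dom C u = W" "Cod C u = A" "f \<cdot> u = \<one>\<^bsub>Hom C W B\<^esub>" using W by auto
      \<comment> \<open>The inverse of evaluation: compose any representative of the coset with
        \<open>u\<close>. Changing the representative by \<open>w \<cdot> f\<close> has no effect,
        since \<open>f \<cdot> u\<close> is zero.\<close>
      define \<eta> where "\<eta> = (\<lambda>X\<in>Obj C. \<lambda>x\<in>carrier (ao G X). (SOME k. k \<in> \<alpha> X x) \<cdot> u)"
      have val: "\<eta> X x = k \<cdot> u" if X: "X \<in> Obj C" "x \<in> carrier (ao G X)" and k: "k \<in> maps C A X" "\<alpha> X x = cls f X k" for X x k
      proof -
        have k': "k \<in> maps C (Dom C f) X" using k fAB by simp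
        define l where "l = (SOME k. k \<in> \<alpha> X x)"
        have "l \<in> cls f X k" unfolding l_def k(2) by (rule someI[of "\<lambda>l. l \<in> cls f X k", OF cls_self[OF f k' X(1)]])
        then obtain w where w: "w \<in> maps C B X" "l = (w \<cdot> f) \<otimes>\<^bsub>Hom C A X\<^esub> k"
          unfolding cls_mem[OF f k' X(1)] fAB by blast
        have "l \<cdot> u = (w \<cdot> (f \<cdot> u)) \<otimes>\<^bsub>Hom C W X\<^esub> (k \<cdot> u)"
          using w k X u(1-3) fAB by (simp add: comp_distrib assoc)
        also have "\<dots> = k \<cdot> u" using w k X(1) u W by simp
        finally show ?thesis using X by (simp add: \<eta>_def l_def)
      qed
      have "is_ab_nat C G (corep C W) \<eta>"
        unfolding is_ab_nat_def
      proof (intro conjI ballI homI)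
        fix X x assume X: "X \<in> Obj C" "x \<in> carrier (ao G X)"
        obtain k where k: "k \<in> maps C A X" "\<alpha> X x = cls f X k" using rep[OF X] by blast
        show "\<eta> X x \<in> carrier (ao (corep C W) X)"
          using val[OF X k] k X u W by (simp add: corep_def)
        fix y assume y: "y \<in> carrier (ao G X)"
        obtain l where l: "l \<in> maps C A X" "\<alpha> X y = cls f X l" using rep[OF X(1) y] by blast
        have "\<alpha> X (x \<otimes>\<^bsub>ao G X\<^esub> y) = cls f X (k \<otimes>\<^bsub>Hom C A X\<^esub> l)"
          using hom_mult[OF hom[OF X(1)] X(2) y] mult_coker[OF f X(1), of k l] k l fAB by simp
        moreover have "x \<otimes>\<^bsub>ao G X\<^esub> y \<in> carrier (ao G X)"
          using ab_functorD(1)[OF G X(1)] X y by (simp add: monoid.m_closed group.is_monoid comm_group.axioms(2))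
        moreover have "k \<otimes>\<^bsub>Hom C A X\<^esub> l \<in> maps C A X" using k l X by simp
        ultimately have "\<eta> X (x \<otimes>\<^bsub>ao G X\<^esub> y) = (k \<otimes>\<^bsub>Hom C A X\<^esub> l) \<cdot> u" using val[OF X(1)] by blast
        also have "\<dots> = (k \<cdot> u) \<otimes>\<^bsub>Hom C W X\<^esub> (l \<cdot> u)" using k l X u by (simp add: comp_distrib)
        finally show "\<eta> X (x \<otimes>\<^bsub>ao G X\<^esub> y) = \<eta> X x \<otimes>\<^bsub>ao (corep C W) X\<^esub> \<eta> X y"
          by (simp add: val[OF X k] val[OF X(1) y l] corep_def)
      next
        fix X Y h x assume h: "X \<in> Obj C" "Y \<in> Obj C" "h \<in> maps C X Y" and x: "x \<in> carrier (ao G X)"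
        obtain k where k: "k \<in> maps C A X" "\<alpha> X x = cls f X k" using rep[OF h(1) x] by blast
        have hk: "h \<cdot> k \<in> maps C A Y" using h k by simp
        have "\<alpha> Y (am G h x) = cls f Y (h \<cdot> k)"
          using nat[OF h x] k am_coker[OF f h(1,2), of k h] h fAB by simp
        then have "\<eta> Y (am G h x) = (h \<cdot> k) \<cdot> u" by (rule val[OF h(2) ab_functorD(3)[OF G h x] hk])
        also have "\<dots> = h \<cdot> (k \<cdot> u)" using h k u by (simp add: assoc)
        finally show "\<eta> Y (am G h x) = am (corep C W) h (\<eta> X x)"
          by (simp add: val[OF h(1) x k] corep_def)
      qed
      then have "\<eta> \<in> ?N" unfolding nat_group_def by (simp add: \<eta>_def)
      moreover have "\<eta> A \<gamma> = Idt C A \<cdot> u" by (rule val[OF _ g(1) _ g(2)]) simp_all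
      ultimately show "u \<in> (\<lambda>\<eta>. \<eta> A \<gamma>) ` ?N" using u by (intro image_eqI[of _ _ \<eta>]) auto
    qed
  qed
  show thesis by (rule that[of \<gamma>]) (use g bijW in \<open>simp_all only: AB\<close>)
qed

end

section \<open>Compact objects\<close>

lemma hom_finprod:
  assumes "comm_group G" "comm_group H" "h \<in> hom G H" "g \<in> A \<rightarrow> carrier G"
  shows "h (finprod G g A) = finprod H (\<lambda>i. h (g i)) A"
proof -
  interpret G: comm_group G by fact
  interpret H: comm_group H by fact
  show ?thesis
  proof (cases "finite A")
    case True
    then show ?thesis using assms(4)
    proof (induction A)
      case empty
      then show ?case using hom_one[OF assms(3) G.is_group H.is_group] by simp
    next
      case (insert a A)
      have "g \<in> A \<rightarrow> carrier G" "g a \<in> carrier G" using insert by auto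
      moreover have "(\<lambda>i. h (g i)) \<in> A \<rightarrow> carrier H" "h (g a) \<in> carrier H"
        using insert.prems hom_in_carrier[OF assms(3)] by auto
      ultimately show ?case using insert by (simp add: hom_mult[OF assms(3)])
    qed
  next
    case False
    then show ?thesis using hom_one[OF assms(3) G.is_group H.is_group] by simp
  qed
qed

section \<open>Projections, idempotents and finite support in coproducts\<close>

context preadditive_category
begin

lemma coproductD:
  assumes "is_coproduct C I X P \<iota>"
  shows "P \<in> Obj C" "i \<in> I \<Longrightarrow> X i \<in> Obj C" "i \<in> I \<Longrightarrow> \<iota> i \<in> arrows C"
    "i \<in> I \<Longrightarrow> Dom C (\<iota> i) = X i" "i \<in> I \<Longrightarrow> Cod C (\<iota> i) = P"
proof -
  show 1: "P \<in> Obj C" "i \<in> I \<Longrightarrow> X i \<in> Obj C" using assms unfolding is_coproduct_def by blast+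
  have "i \<in> I \<Longrightarrow> \<iota> i \<in> maps C (X i) P" using assms unfolding is_coproduct_def by blast
  with 1 show "i \<in> I \<Longrightarrow> \<iota> i \<in> arrows C" "i \<in> I \<Longrightarrow> Dom C (\<iota> i) = X i" "i \<in> I \<Longrightarrow> Cod C (\<iota> i) = P"
    by auto
qed

lemma coproduct_factor:
  assumes "is_coproduct C I X P \<iota>" "Y \<in> Obj C" "\<And>i. i \<in> I \<Longrightarrow> f i \<in> maps C (X i) Y"
  obtains u where "u \<in> maps C P Y" "\<And>i. i \<in> I \<Longrightarrow> u \<cdot> \<iota> i = f i"
proof -
  have "\<exists>!u. u \<in> maps C P Y \<and> (\<forall>i\<in>I. u \<cdot> \<iota> i = f i)"
    using assms unfolding is_coproduct_def by blast
  then show thesis using that by blast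
qed

lemma coproduct_ext:
  assumes P: "is_coproduct C I X P \<iota>" and "Y \<in> Obj C" "u \<in> maps C P Y" "v \<in> maps C P Y"
    and "\<And>i. i \<in> I \<Longrightarrow> u \<cdot> \<iota> i = v \<cdot> \<iota> i"
  shows "u = v"
proof -
  have "\<forall>i\<in>I. u \<cdot> \<iota> i \<in> maps C (X i) Y" using assms coproductD[OF P] by auto
  then have "\<exists>!w. w \<in> maps C P Y \<and> (\<forall>i\<in>I. w \<cdot> \<iota> i = u \<cdot> \<iota> i)"
    using P[unfolded is_coproduct_def, THEN conjunct2, THEN conjunct2, THEN bspec, OF assms(2),
        THEN spec, of "\<lambda>i. u \<cdot> \<iota> i"] by (rule mp[rotated])
  then show ?thesis using assms(3-5) by (metis (no_types, lifting))
qed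

text \<open>The endomorphism of \<open>P\<close> that keeps the summands in \<open>F\<close> and
  kills the others. As an arrow from \<open>P\<close> to itself it exists without choosing a
  coproduct over \<open>F\<close>, and idempotents for different \<open>F\<close> can be
  composed.\<close>

definition summand_idem :: "'i set \<Rightarrow> ('i \<Rightarrow> 'o) \<Rightarrow> 'o \<Rightarrow> ('i \<Rightarrow> 'm) \<Rightarrow> 'i set \<Rightarrow> 'm \<Rightarrow> bool" where
  "summand_idem I X P \<iota> F e \<longleftrightarrow> e \<in> maps C P P \<and> (\<forall>i\<in>I. e \<cdot> \<iota> i = (if i \<in> F then \<iota> i else \<one>\<^bsub>Hom C (X i) P\<^esub>))"

lemma ex_summand_idem:
  assumes P: "is_coproduct C I X P \<iota>"
  obtains e where "summand_idem I X P \<iota> F e"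
proof -
  obtain e where "e \<in> maps C P P" "\<And>i. i \<in> I \<Longrightarrow> e \<cdot> \<iota> i = (if i \<in> F then \<iota> i else \<one>\<^bsub>Hom C (X i) P\<^esub>)"
    by (rule coproduct_factor[OF P, of P "\<lambda>i. if i \<in> F then \<iota> i else \<one>\<^bsub>Hom C (X i) P\<^esub>"])
      (use coproductD[OF P] in auto)
  then show thesis using that unfolding summand_idem_def by blast
qed

lemma summand_idem_comp:
  assumes P: "is_coproduct C I X P \<iota>" and e: "summand_idem I X P \<iota> F e" "summand_idem I X P \<iota> F' e'" and "F \<subseteq> F'"
  shows "e' \<cdot> e = e"
proof (rule coproduct_ext[OF P coproductD(1)[OF P]])
  note c = coproductD[OF P]
  have a: "e \<in> arrows C" "Dom C e = P" "Cod C e = P" "e' \<in> arrows C" "Dom C e' = P" "Cod C e' = P"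
    using e c(1) unfolding summand_idem_def by auto
  then show "e' \<cdot> e \<in> maps C P P" "e \<in> maps C P P" using c(1) by auto
  fix i assume i: "i \<in> I"
  have "(e' \<cdot> e) \<cdot> \<iota> i = e' \<cdot> (e \<cdot> \<iota> i)" using a i c by (simp add: assoc)
  also have "\<dots> = e \<cdot> \<iota> i" using e i c a \<open>F \<subseteq> F'\<close> unfolding summand_idem_def by auto
  finally show "(e' \<cdot> e) \<cdot> \<iota> i = e \<cdot> \<iota> i" .
qed

text \<open>Compactness of \<open>K\<close> says that every arrow from \<open>K\<close> to a coproduct is fixed by the idempotent of
  finitely many summands. In this form it passes to cones without any comparison of direct sums.\<close>

definition finitely_supported :: "'i set \<Rightarrow> ('i \<Rightarrow> 'o) \<Rightarrow> 'o \<Rightarrow> ('i \<Rightarrow> 'm) \<Rightarrow> 'm \<Rightarrow> bool" where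
  "finitely_supported I X P \<iota> u \<longleftrightarrow> (\<exists>F e. finite F \<and> F \<subseteq> I \<and> summand_idem I X P \<iota> F e \<and> e \<cdot> u = u)"

lemma coproduct_projections:
  assumes P: "is_coproduct C I X P \<iota>"
  obtains \<pi> where "\<And>j. j \<in> I \<Longrightarrow> \<pi> j \<in> arrows C \<and> Dom C (\<pi> j) = P \<and> Cod C (\<pi> j) = X j"
    and "\<And>j i. j \<in> I \<Longrightarrow> i \<in> I \<Longrightarrow> \<pi> j \<cdot> \<iota> i = (if i = j then Idt C (X j) else \<one>\<^bsub>Hom C (X i) (X j)\<^esub>)"
proof -
  note c = coproductD[OF P]
  have "\<exists>p. p \<in> maps C P (X j) \<and> (\<forall>i\<in>I. p \<cdot> \<iota> i = (if i = j then Idt C (X j) else \<one>\<^bsub>Hom C (X i) (X j)\<^esub>))"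
    if "j \<in> I" for j
    by (rule coproduct_factor[OF P, of "X j" "\<lambda>i. if i = j then Idt C (X j) else \<one>\<^bsub>Hom C (X i) (X j)\<^esub>"])
      (use c that in auto)
  then have "\<forall>j\<in>I. \<exists>p. p \<in> arrows C \<and> Dom C p = P \<and> Cod C p = X j \<and>
      (\<forall>i\<in>I. p \<cdot> \<iota> i = (if i = j then Idt C (X j) else \<one>\<^bsub>Hom C (X i) (X j)\<^esub>))"
    using c by simp
  from bchoice[OF this] show thesis using that by blast
qed

text \<open>Composing the sum with the projection to \<open>X j\<close> leaves only the term
  \<open>x j\<close>.\<close>

lemma coproduct_sum_inj:
  assumes P: "is_coproduct C I X P \<iota>" and K: "K \<in> Obj C"
    and F: "finite F" "F \<subseteq> I" and x: "\<And>i. i \<in> F \<Longrightarrow> x i \<in> maps C K (X i)"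
    and zero: "finprod (Hom C K P) (\<lambda>i. \<iota> i \<cdot> x i) F = \<one>\<^bsub>Hom C K P\<^esub>" and j: "j \<in> F"
  shows "x j = \<one>\<^bsub>Hom C K (X j)\<^esub>"
proof -
  note c = coproductD[OF P]
  obtain \<pi> where pi: "\<And>j. j \<in> I \<Longrightarrow> \<pi> j \<in> arrows C \<and> Dom C (\<pi> j) = P \<and> Cod C (\<pi> j) = X j"
    "\<And>j i. j \<in> I \<Longrightarrow> i \<in> I \<Longrightarrow> \<pi> j \<cdot> \<iota> i = (if i = j then Idt C (X j) else \<one>\<^bsub>Hom C (X i) (X j)\<^esub>)"
    using coproduct_projections[OF P] by blast
  have jI: "j \<in> I" using j F by blast
  have xi: "x i \<in> arrows C \<and> Dom C (x i) = K \<and> Cod C (x i) = X i" if "i \<in> F" for i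
    using x[OF that] K c(2) F that by auto
  interpret H: comm_group "Hom C K (X j)" using hom_group K c(2)[OF jI] by blast
  have "\<one>\<^bsub>Hom C K (X j)\<^esub> = \<pi> j \<cdot> finprod (Hom C K P) (\<lambda>i. \<iota> i \<cdot> x i) F"
    unfolding zero using pi(1)[OF jI] K by simp
  also have "\<dots> = finprod (Hom C K (X j)) (\<lambda>i. \<pi> j \<cdot> (\<iota> i \<cdot> x i)) F"
    by (rule hom_finprod[OF hom_group hom_group postcomp_hom]) (use pi(1)[OF jI] K c c(2)[OF jI] xi F in auto)
  also have "\<dots> = finprod (Hom C K (X j)) (\<lambda>i. if j = i then x i else \<one>\<^bsub>Hom C K (X j)\<^esub>) F"
  proof (rule H.finprod_cong'[OF refl])
    show "(\<lambda>i. if j = i then x i else \<one>\<^bsub>Hom C K (X j)\<^esub>) \<in> F \<rightarrow> carrier (Hom C K (X j))"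
      using xi K c(2)[OF jI] by auto
    fix i assume "i \<in> F"
    then have i: "i \<in> I" "i \<in> F" using F by auto
    have "\<pi> j \<cdot> (\<iota> i \<cdot> x i) = (\<pi> j \<cdot> \<iota> i) \<cdot> x i" using pi(1)[OF jI] c i xi by (simp add: assoc)
    also have "\<dots> = (if j = i then x i else \<one>\<^bsub>Hom C K (X j)\<^esub>)"
      unfolding pi(2)[OF jI i(1)] using xi[OF i(2)] c(2)[OF jI] by auto
    finally show "\<pi> j \<cdot> (\<iota> i \<cdot> x i) = (if j = i then x i else \<one>\<^bsub>Hom C K (X j)\<^esub>)" .
  qed
  also have "\<dots> = x j"
  proof -
    have "(\<lambda>i. if i = j then x i else \<one>\<^bsub>Hom C K (X j)\<^esub>) \<in> F \<rightarrow> carrier (Hom C K (X j))"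
      using xi K c(2)[OF jI] by auto
    from H.finprod_singleton[OF j F(1) this] show ?thesis by (simp cong: if_cong)
  qed
  finally show ?thesis by simp
qed

text \<open>Both sides agree on every coprojection: composition distributes over the finite sum, and
  at most the term with index \<open>j\<close> survives.\<close>

lemma summand_idem_eq_sum:
  assumes P: "is_coproduct C I X P \<iota>" and F: "finite F" "F \<subseteq> I" and e: "summand_idem I X P \<iota> F e"
    and pi: "\<And>j. j \<in> I \<Longrightarrow> \<pi> j \<in> arrows C \<and> Dom C (\<pi> j) = P \<and> Cod C (\<pi> j) = X j"
    "\<And>j i. j \<in> I \<Longrightarrow> i \<in> I \<Longrightarrow> \<pi> j \<cdot> \<iota> i = (if i = j then Idt C (X j) else \<one>\<^bsub>Hom C (X i) (X j)\<^esub>)"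
  shows "e = finprod (Hom C P P) (\<lambda>i. \<iota> i \<cdot> \<pi> i) F"
proof (rule coproduct_ext[OF P coproductD(1)[OF P]])
  note c = coproductD[OF P]
  interpret H: comm_group "Hom C P P" using hom_group c(1) by blast
  have ip: "(\<lambda>i. \<iota> i \<cdot> \<pi> i) \<in> F \<rightarrow> carrier (Hom C P P)" using F pi c by auto
  show "e \<in> maps C P P" using e unfolding summand_idem_def by blast
  show "finprod (Hom C P P) (\<lambda>i. \<iota> i \<cdot> \<pi> i) F \<in> maps C P P" by (rule H.finprod_closed[OF ip])
  fix j assume j: "j \<in> I"
  interpret J: comm_group "Hom C (X j) P" using hom_group c j by blast
  have "finprod (Hom C P P) (\<lambda>i. \<iota> i \<cdot> \<pi> i) F \<cdot> \<iota> j = finprod (Hom C (X j) P) (\<lambda>i. (\<iota> i \<cdot> \<pi> i) \<cdot> \<iota> j) F"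
    by (rule hom_finprod[OF hom_group hom_group precomp_hom]) (use ip c j in auto)
  also have "\<dots> = finprod (Hom C (X j) P) (\<lambda>i. if j = i then \<iota> i else \<one>\<^bsub>Hom C (X j) P\<^esub>) F"
  proof (rule J.finprod_cong'[OF refl])
    show "(\<lambda>i. if j = i then \<iota> i else \<one>\<^bsub>Hom C (X j) P\<^esub>) \<in> F \<rightarrow> carrier (Hom C (X j) P)"
      using F c j by auto
    fix i assume "i \<in> F"
    then have i: "i \<in> I" using F by auto
    have "(\<iota> i \<cdot> \<pi> i) \<cdot> \<iota> j = \<iota> i \<cdot> (\<pi> i \<cdot> \<iota> j)" using pi(1)[OF i] c i j by (simp add: assoc)
    then show "(\<iota> i \<cdot> \<pi> i) \<cdot> \<iota> j = (if j = i then \<iota> i else \<one>\<^bsub>Hom C (X j) P\<^esub>)"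
      unfolding pi(2)[OF i j] using c i j by auto
  qed
  also have "\<dots> = e \<cdot> \<iota> j"
  proof (cases "j \<in> F")
    case True
    have "(\<lambda>i. if i = j then \<iota> i else \<one>\<^bsub>Hom C (X j) P\<^esub>) \<in> F \<rightarrow> carrier (Hom C (X j) P)"
      using F c j by auto
    from J.finprod_singleton[OF True F(1) this]
    have "finprod (Hom C (X j) P) (\<lambda>i. if j = i then \<iota> i else \<one>\<^bsub>Hom C (X j) P\<^esub>) F = \<iota> j"
      by (simp cong: if_cong)
    then show ?thesis using e j True unfolding summand_idem_def by simp
  next
    case False
    then have "finprod (Hom C (X j) P) (\<lambda>i. if j = i then \<iota> i else \<one>\<^bsub>Hom C (X j) P\<^esub>) F = \<one>\<^bsub>Hom C (X j) P\<^esub>"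
      by (intro J.finprod_one_eqI) auto
    then show ?thesis using e j False unfolding summand_idem_def by simp
  qed
  finally show "e \<cdot> \<iota> j = finprod (Hom C P P) (\<lambda>i. \<iota> i \<cdot> \<pi> i) F \<cdot> \<iota> j" by simp
qed


lemma coproduct_sum_finitely_supported:
  assumes P: "is_coproduct C I X P \<iota>" and K: "K \<in> Obj C"
    and F: "finite F" "F \<subseteq> I" and x: "\<And>i. i \<in> F \<Longrightarrow> x i \<in> maps C K (X i)"
  shows "finitely_supported I X P \<iota> (finprod (Hom C K P) (\<lambda>i. \<iota> i \<cdot> x i) F)"
proof -
  note c = coproductD[OF P]
  obtain e where e: "summand_idem I X P \<iota> F e" using ex_summand_idem[OF P] by blast
  have ea: "e \<in> arrows C" "Dom C e = P" "Cod C e = P" using e c(1) unfolding summand_idem_def by auto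
  interpret H: comm_group "Hom C K P" using hom_group K c(1) by blast
  have xi: "x i \<in> arrows C \<and> Dom C (x i) = K \<and> Cod C (x i) = X i" if "i \<in> F" for i
    using x[OF that] K c(2) F that by auto
  have ix: "(\<lambda>i. \<iota> i \<cdot> x i) \<in> F \<rightarrow> carrier (Hom C K P)" using xi c F K by auto
  have "e \<cdot> finprod (Hom C K P) (\<lambda>i. \<iota> i \<cdot> x i) F = finprod (Hom C K P) (\<lambda>i. e \<cdot> (\<iota> i \<cdot> x i)) F"
    by (rule hom_finprod[OF hom_group hom_group postcomp_hom]) (use ix ea c K in auto)
  also have "\<dots> = finprod (Hom C K P) (\<lambda>i. \<iota> i \<cdot> x i) F"
  proof (rule H.finprod_cong'[OF refl ix])
    fix i assume i: "i \<in> F"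
    have "e \<cdot> (\<iota> i \<cdot> x i) = (e \<cdot> \<iota> i) \<cdot> x i" using i F xi ea c by (simp add: assoc subset_iff)
    then show "e \<cdot> (\<iota> i \<cdot> x i) = \<iota> i \<cdot> x i" using e i F unfolding summand_idem_def by auto
  qed
  finally show ?thesis unfolding finitely_supported_def using F e by blast
qed

text \<open>Expanding the idempotent as a finite sum exhibits the coordinates of \<open>u\<close>:
  they are its composites with the projections.\<close>

lemma finitely_supported_sum:
  assumes P: "is_coproduct C I X P \<iota>" and K: "K \<in> Obj C" and u: "u \<in> maps C K P"
    and fs: "finitely_supported I X P \<iota> u"
  obtains F x where "finite F" "F \<subseteq> I" "\<And>i. i \<in> I \<Longrightarrow> x i \<in> maps C K (X i)"
    "u = finprod (Hom C K P) (\<lambda>i. \<iota> i \<cdot> x i) F"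
proof -
  note c = coproductD[OF P]
  obtain F e where F: "finite F" "F \<subseteq> I" and e: "summand_idem I X P \<iota> F e" "e \<cdot> u = u"
    using fs unfolding finitely_supported_def by blast
  obtain \<pi> where pi: "\<And>j. j \<in> I \<Longrightarrow> \<pi> j \<in> arrows C \<and> Dom C (\<pi> j) = P \<and> Cod C (\<pi> j) = X j"
    "\<And>j i. j \<in> I \<Longrightarrow> i \<in> I \<Longrightarrow> \<pi> j \<cdot> \<iota> i = (if i = j then Idt C (X j) else \<one>\<^bsub>Hom C (X i) (X j)\<^esub>)"
    using coproduct_projections[OF P] by blast
  have u': "u \<in> arrows C" "Dom C u = K" "Cod C u = P" using u K c(1) by auto
  have ip: "(\<lambda>i. \<iota> i \<cdot> \<pi> i) \<in> F \<rightarrow> carrier (Hom C P P)" using F pi c by auto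
  interpret H: comm_group "Hom C K P" using hom_group K c(1) by blast
  have "u = finprod (Hom C P P) (\<lambda>i. \<iota> i \<cdot> \<pi> i) F \<cdot> u"
    using summand_idem_eq_sum[OF P F e(1) pi] e(2) by simp
  also have "\<dots> = finprod (Hom C K P) (\<lambda>i. (\<iota> i \<cdot> \<pi> i) \<cdot> u) F"
    by (rule hom_finprod[OF hom_group hom_group precomp_hom]) (use ip u' c K in auto)
  also have "\<dots> = finprod (Hom C K P) (\<lambda>i. \<iota> i \<cdot> (\<pi> i \<cdot> u)) F"
  proof (rule H.finprod_cong'[OF refl])
    show "(\<lambda>i. \<iota> i \<cdot> (\<pi> i \<cdot> u)) \<in> F \<rightarrow> carrier (Hom C K P)" using F pi(1) c u' K by auto
    fix i assume "i \<in> F"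
    then have i: "i \<in> I" using F by blast
    show "(\<iota> i \<cdot> \<pi> i) \<cdot> u = \<iota> i \<cdot> (\<pi> i \<cdot> u)" using pi(1)[OF i] c i u' by (simp add: assoc)
  qed
  finally have us: "u = finprod (Hom C K P) (\<lambda>i. \<iota> i \<cdot> (\<pi> i \<cdot> u)) F" .
  have m: "\<pi> i \<cdot> u \<in> maps C K (X i)" if "i \<in> I" for i using pi(1)[OF that] u' c(2)[OF that] K by auto
  show thesis by (rule that[OF F m us])
qed

text \<open>The canonical map is injective for every \<open>K\<close>, because projections recover
  the coordinates. So compactness amounts to surjectivity, and the image consists of the finite
  sums, which are exactly the finitely supported arrows.\<close>

lemma compact_object_iff:
  assumes K: "K \<in> Obj C"
  shows "compact_object (\<UU> :: 'u itself) C K \<longleftrightarrow>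
    (\<forall>(I :: 'u set) X P \<iota>. small \<UU> I \<and> is_coproduct C I X P \<iota> \<longrightarrow>
       (\<forall>u\<in>maps C K P. finitely_supported I X P \<iota> u))"
proof -
  let ?s = "\<lambda>I P \<iota> x. gfinprod (Hom C K P) (\<lambda>i. \<iota> i \<cdot> x i) I"
  have "?s I P \<iota> \<in> iso (sum_group I (\<lambda>i. Hom C K (X i))) (Hom C K P) \<longleftrightarrow>
      (\<forall>u\<in>maps C K P. finitely_supported I X P \<iota> u)"
    if P: "is_coproduct C I X P \<iota>" for I :: "'u set" and X P \<iota>
  proof -
    note c = coproductD[OF P]
    interpret H: comm_group "Hom C K P" using hom_group K c(1) by blast
    let ?G = "sum_group I (\<lambda>i. Hom C K (X i))"
    have grp: "group (Hom C K (X i))" if "i \<in> I" for i using K c(2)[OF that] by simp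
    have cs: "carrier ?G = {x \<in> \<Pi>\<^sub>E i\<in>I. carrier (Hom C K (X i)). finite {i \<in> I. x i \<noteq> \<one>\<^bsub>Hom C K (X i)\<^esub>}}"
      by (rule carrier_sum_group[OF grp])
    have "?s I P \<iota> \<in> hom ?G (Hom C K P)"
      by (rule H.hom_group_sum[OF postcomp_hom grp]) (use c K in auto)
    then interpret s: group_hom ?G "Hom C K P" "?s I P \<iota>"
      using grp by (intro group_hom.intro group_hom_axioms.intro sum_group H.is_group) auto
    have sum: "?s I P \<iota> x = finprod (Hom C K P) (\<lambda>i. \<iota> i \<cdot> x i) {i \<in> I. x i \<noteq> \<one>\<^bsub>Hom C K (X i)\<^esub>}"
      "finite {i \<in> I. x i \<noteq> \<one>\<^bsub>Hom C K (X i)\<^esub>}" "\<And>i. i \<in> I \<Longrightarrow> x i \<in> maps C K (X i)"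
      if x: "x \<in> carrier ?G" for x
    proof -
      have xx: "x \<in> {x \<in> \<Pi>\<^sub>E i\<in>I. carrier (Hom C K (X i)). finite {i \<in> I. x i \<noteq> \<one>\<^bsub>Hom C K (X i)\<^esub>}}"
        using x by (simp only: cs)
      from xx have xP: "x \<in> (\<Pi>\<^sub>E i\<in>I. carrier (Hom C K (X i)))" unfolding mem_Collect_eq by (rule conjunct1)
      show m: "x i \<in> maps C K (X i)" if "i \<in> I" for i
        by (rule PiE_mem[OF xP that])
      show f: "finite {i \<in> I. x i \<noteq> \<one>\<^bsub>Hom C K (X i)\<^esub>}" using xx by blast
      have m': "\<iota> i \<cdot> x i \<in> carrier (Hom C K P)" if "i \<in> I" for i
        using m[OF that] c that K by auto
      have "?s I P \<iota> x = ?s {i \<in> I. x i \<noteq> \<one>\<^bsub>Hom C K (X i)\<^esub>} P \<iota> x"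
        by (rule H.gfinprod_mono_neutral_cong_right) (use m' c K in auto)
      also have "\<dots> = finprod (Hom C K P) (\<lambda>i. \<iota> i \<cdot> x i) {i \<in> I. x i \<noteq> \<one>\<^bsub>Hom C K (X i)\<^esub>}"
        by (rule H.gfinprod_eq_finprod[OF f]) (use m' in blast)
      finally show "?s I P \<iota> x = finprod (Hom C K P) (\<lambda>i. \<iota> i \<cdot> x i) {i \<in> I. x i \<noteq> \<one>\<^bsub>Hom C K (X i)\<^esub>}" .
    qed
    have inj: "x = \<one>\<^bsub>?G\<^esub>" if x: "x \<in> carrier ?G" "?s I P \<iota> x = \<one>\<^bsub>Hom C K P\<^esub>" for x
    proof -
      have "x i = \<one>\<^bsub>Hom C K (X i)\<^esub>" if i: "i \<in> I" for i
      proof (rule ccontr)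
        assume ne: "x i \<noteq> \<one>\<^bsub>Hom C K (X i)\<^esub>"
        then have "i \<in> {i \<in> I. x i \<noteq> \<one>\<^bsub>Hom C K (X i)\<^esub>}" using i by simp
        from coproduct_sum_inj[where x = x, OF P K sum(2)[OF x(1)] _ _ _ this]
        show False using ne sum(1,3)[OF x(1)] x(2) by auto
      qed
      moreover have "x \<in> extensional I" using x unfolding cs by (auto simp: PiE_def)
      ultimately show ?thesis by (auto simp: extensional_def restrict_def)
    qed
    have surj: "carrier (Hom C K P) \<subseteq> ?s I P \<iota> ` carrier ?G \<longleftrightarrow> (\<forall>u\<in>maps C K P. finitely_supported I X P \<iota> u)"
    proof (intro iffI ballI subsetI)
      fix u assume "carrier (Hom C K P) \<subseteq> ?s I P \<iota> ` carrier ?G" "u \<in> maps C K P"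
      then obtain x where x: "x \<in> carrier ?G" "u = ?s I P \<iota> x" by blast
      show "finitely_supported I X P \<iota> u" unfolding x(2) sum(1)[OF x(1)]
        by (rule coproduct_sum_finitely_supported[OF P K sum(2)[OF x(1)]]) (use sum(3)[OF x(1)] in blast)+
    next
      fix u assume "\<forall>u\<in>maps C K P. finitely_supported I X P \<iota> u" and u: "u \<in> carrier (Hom C K P)"
      then have "finitely_supported I X P \<iota> u" by blast
      then obtain F x where F: "finite F" "F \<subseteq> I" and x: "\<And>i. i \<in> I \<Longrightarrow> x i \<in> maps C K (X i)"
        and s: "u = finprod (Hom C K P) (\<lambda>i. \<iota> i \<cdot> x i) F"
        using finitely_supported_sum[OF P K u] by blast
      \<comment> \<open>Outside \<open>F\<close> the coordinates of \<open>x\<close> are arbitrary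
        and have to be reset to zero before the family lies in the direct sum.\<close>
      define y where "y = (\<lambda>i\<in>I. if i \<in> F then x i else \<one>\<^bsub>Hom C K (X i)\<^esub>)"
      have ym: "y i \<in> maps C K (X i)" if "i \<in> I" for i
        using x[OF that] c(2)[OF that] K that by (auto simp: y_def)
      have "{i \<in> I. y i \<noteq> \<one>\<^bsub>Hom C K (X i)\<^esub>} \<subseteq> F" by (auto simp: y_def)
      then have "y \<in> carrier ?G"
        unfolding cs using ym F(1) by (auto simp: y_def intro: finite_subset)
      moreover have "?s I P \<iota> y = u"
      proof -
        have m': "\<iota> i \<cdot> y i \<in> carrier (Hom C K P)" if "i \<in> I" for i
          using ym[OF that] c that K by auto
        have "?s I P \<iota> y = gfinprod (Hom C K P) (\<lambda>i. \<iota> i \<cdot> x i) F"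
          by (rule H.gfinprod_mono_neutral_cong_right) (use m' c K F in \<open>auto simp: y_def\<close>)
        also have "\<dots> = u" unfolding s
          by (rule H.gfinprod_eq_finprod[OF F(1)]) (use m' F in \<open>force simp: y_def\<close>)
        finally show ?thesis .
      qed
      ultimately show "u \<in> ?s I P \<iota> ` carrier ?G" by blast
    qed
    show ?thesis unfolding s.iso_iff using inj surj by blast
  qed
  then show ?thesis unfolding compact_object_def using K by blast
qed

section \<open>Opposites, isomorphisms and cancellation\<close>

lemma preadditive_opp: "preadditive_category (opp C)"
  by (rule preadditive_category.intro) (simp_all add: hom_group assoc comp_distrib comp_distrib2)

lemma isoE:
  assumes "is_iso C A B f" "A \<in> Obj C" "B \<in> Obj C"
  obtains g where "f \<in> arrows C" "Dom C f = A" "Cod C f = B" "g \<in> arrows C" "Dom C g = B" "Cod C g = A"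
    "g \<cdot> f = Idt C A" "f \<cdot> g = Idt C B"
proof -
  obtain g where "f \<in> maps C A B" "g \<in> maps C B A" "g \<cdot> f = Idt C A" "f \<cdot> g = Idt C B"
    using assms unfolding is_iso_def by blast
  then show thesis using that assms(2,3) by auto
qed

lemma iso_cancel_left:
  assumes "is_iso C A B f" "A \<in> Obj C" "B \<in> Obj C" "u \<in> maps C X A" "v \<in> maps C X A" "f \<cdot> u = f \<cdot> v" "X \<in> Obj C"
  shows "u = v"
proof -
  obtain g where g: "f \<in> arrows C" "Dom C f = A" "Cod C f = B" "g \<in> arrows C" "Dom C g = B" "Cod C g = A"
    "g \<cdot> f = Idt C A" using isoE[OF assms(1-3)] by blast
  have uv: "u \<in> arrows C" "v \<in> arrows C" "Cod C u = A" "Cod C v = A" using assms by auto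
  have "(g \<cdot> f) \<cdot> u = (g \<cdot> f) \<cdot> v" using g(1-6) uv assms(6) by (simp add: assoc)
  then show ?thesis using g uv by simp
qed

lemma iso_cancel_right:
  assumes "is_iso C A B f" "A \<in> Obj C" "B \<in> Obj C" "u \<in> maps C B X" "v \<in> maps C B X" "u \<cdot> f = v \<cdot> f" "X \<in> Obj C"
  shows "u = v"
proof -
  obtain g where g: "f \<in> arrows C" "Dom C f = A" "Cod C f = B" "g \<in> arrows C" "Dom C g = B" "Cod C g = A"
    "f \<cdot> g = Idt C B" using isoE[OF assms(1-3)] by blast
  have uv: "u \<in> arrows C" "v \<in> arrows C" "Dom C u = B" "Dom C v = B" using assms by auto
  have "u \<cdot> (f \<cdot> g) = v \<cdot> (f \<cdot> g)" using g(1-6) uv assms(6) by (simp add: assoc[symmetric])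
  then show ?thesis using g uv by simp
qed

text \<open>Recognises a zero arrow by composition alone, so that the property can be carried along
  a functor before anything is known about its additivity.\<close>

lemma zero_iff_comp_eq:
  assumes "z \<in> arrows C" "\<And>w. w \<in> maps C (Dom C z) (Dom C z) \<Longrightarrow> z \<cdot> w = z"
  shows "z = \<one>\<^bsub>Hom C (Dom C z) (Cod C z)\<^esub>"
  using assms(2)[of "\<one>\<^bsub>Hom C (Dom C z) (Dom C z)\<^esub>"] assms(1) by simp

end

section \<open>Functors and natural isomorphisms\<close>

lemma functorD:
  assumes "is_functor C E F"
  shows "X \<in> Obj C \<Longrightarrow> fo F X \<in> Obj E" "X \<in> Obj C \<Longrightarrow> fm F (Idt C X) = Idt E (fo F X)"
    "\<lbrakk>X \<in> Obj C; Y \<in> Obj C; f \<in> maps C X Y\<rbrakk> \<Longrightarrow> fm F f \<in> maps E (fo F X) (fo F Y)"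
    "\<lbrakk>X \<in> Obj C; Y \<in> Obj C; Z \<in> Obj C; f \<in> maps C X Y; g \<in> maps C Y Z\<rbrakk>
       \<Longrightarrow> fm F (g \<cdot>\<^bsub>C\<^esub> f) = fm F g \<cdot>\<^bsub>E\<^esub> fm F f"
  using assms unfolding is_functor_def by blast+

lemma functor_arrow:
  assumes "preadditive_category C" "preadditive_category E" "is_functor C E F"
  shows "f \<in> arrows C \<Longrightarrow> fm F f \<in> arrows E" "f \<in> arrows C \<Longrightarrow> Dom E (fm F f) = fo F (Dom C f)"
    "f \<in> arrows C \<Longrightarrow> Cod E (fm F f) = fo F (Cod C f)"
    "\<lbrakk>f \<in> arrows C; g \<in> arrows C; Cod C f = Dom C g\<rbrakk> \<Longrightarrow> fm F (g \<cdot>\<^bsub>C\<^esub> f) = fm F g \<cdot>\<^bsub>E\<^esub> fm F f"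
proof -
  interpret C: preadditive_category C by fact
  interpret E: preadditive_category E by fact
  note F = functorD[OF assms(3)]
  have "fm F f \<in> maps E (fo F (Dom C f)) (fo F (Cod C f))" if "f \<in> arrows C"
    using F(3)[of "Dom C f" "Cod C f" f] that by simp
  then show "f \<in> arrows C \<Longrightarrow> fm F f \<in> arrows E" "f \<in> arrows C \<Longrightarrow> Dom E (fm F f) = fo F (Dom C f)"
    "f \<in> arrows C \<Longrightarrow> Cod E (fm F f) = fo F (Cod C f)"
    using F(1) by auto
  show "fm F (g \<cdot>\<^bsub>C\<^esub> f) = fm F g \<cdot>\<^bsub>E\<^esub> fm F f" if "f \<in> arrows C" "g \<in> arrows C" "Cod C f = Dom C g"
    using F(4)[of "Dom C f" "Dom C g" "Cod C g" f g] that by simp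
qed

lemma comp_ftor_sel [simp]:
  "fo (G \<circ>\<^sub>F F) X = fo G (fo F X)" "fm (G \<circ>\<^sub>F F) f = fm G (fm F f)" "fo id_ftor X = X" "fm id_ftor f = f"
  by (simp_all add: comp_ftor_def id_ftor_def)

lemma nat_isoD:
  assumes "is_nat_iso C E F G \<eta>"
  shows "X \<in> Obj C \<Longrightarrow> is_iso E (fo F X) (fo G X) (\<eta> X)"
    "X \<in> Obj C \<Longrightarrow> \<eta> X \<in> maps E (fo F X) (fo G X)"
    "\<lbrakk>X \<in> Obj C; Y \<in> Obj C; f \<in> maps C X Y\<rbrakk> \<Longrightarrow> \<eta> Y \<cdot>\<^bsub>E\<^esub> fm F f = fm G f \<cdot>\<^bsub>E\<^esub> \<eta> X"
  using assms unfolding is_nat_iso_def is_nat_def by blast+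

text \<open>Equivalences are given with a counit that ends at the identity, while fullness is
  derived from two natural isomorphisms that start at the identity. This turns the counit
  around.\<close>

lemma nat_iso_inverse:
  assumes C: "preadditive_category C" and E: "preadditive_category E"
    and F: "is_functor C E F" and G: "is_functor C E G" and \<eta>: "is_nat_iso C E F G \<eta>"
  shows "\<exists>\<theta>. is_nat_iso C E G F \<theta>"
proof -
  interpret C: preadditive_category C by fact
  interpret E: preadditive_category E by fact
  have "\<forall>X\<in>Obj C. \<exists>g. g \<in> arrows E \<and> Dom E g = fo G X \<and> Cod E g = fo F X \<and>
      g \<cdot>\<^bsub>E\<^esub> \<eta> X = Idt E (fo F X) \<and> \<eta> X \<cdot>\<^bsub>E\<^esub> g = Idt E (fo G X)"
    using E.isoE[OF nat_isoD(1)[OF \<eta>] functorD(1)[OF F] functorD(1)[OF G]] by metis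
  from bchoice[OF this] obtain \<theta> where th: "\<And>X. X \<in> Obj C \<Longrightarrow> \<theta> X \<in> arrows E \<and> Dom E (\<theta> X) = fo G X \<and> Cod E (\<theta> X) = fo F X \<and>
      \<theta> X \<cdot>\<^bsub>E\<^esub> \<eta> X = Idt E (fo F X) \<and> \<eta> X \<cdot>\<^bsub>E\<^esub> \<theta> X = Idt E (fo G X)"
    by blast
  then have tht: "\<theta> X \<in> arrows E \<and> Dom E (\<theta> X) = fo G X \<and> Cod E (\<theta> X) = fo F X" if "X \<in> Obj C" for X
    using that by blast
  have e: "\<eta> X \<in> arrows E" "Dom E (\<eta> X) = fo F X" "Cod E (\<eta> X) = fo G X" if "X \<in> Obj C" for X
    using nat_isoD(2)[OF \<eta> that] functorD(1)[OF F that] functorD(1)[OF G that] by auto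
  have "\<theta> Y \<cdot>\<^bsub>E\<^esub> fm G f = fm F f \<cdot>\<^bsub>E\<^esub> \<theta> X" if o: "X \<in> Obj C" "Y \<in> Obj C" "f \<in> maps C X Y" for X Y f
  proof -
    note ff = functorD(1)[OF F o(1)] functorD(1)[OF F o(2)] functorD(1)[OF G o(1)] functorD(1)[OF G o(2)]
    have f: "fm F f \<in> arrows E" "Dom E (fm F f) = fo F X" "Cod E (fm F f) = fo F Y"
      "fm G f \<in> arrows E" "Dom E (fm G f) = fo G X" "Cod E (fm G f) = fo G Y"
      using functorD(3)[OF F o] functorD(3)[OF G o] ff by auto
    have "\<theta> Y \<cdot>\<^bsub>E\<^esub> fm G f = \<theta> Y \<cdot>\<^bsub>E\<^esub> (fm G f \<cdot>\<^bsub>E\<^esub> (\<eta> X \<cdot>\<^bsub>E\<^esub> \<theta> X))"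
      using th[OF o(1)] f by simp
    also have "\<dots> = \<theta> Y \<cdot>\<^bsub>E\<^esub> ((fm G f \<cdot>\<^bsub>E\<^esub> \<eta> X) \<cdot>\<^bsub>E\<^esub> \<theta> X)"
      using th[OF o(1)] f e[OF o(1)] by (simp add: E.assoc)
    also have "fm G f \<cdot>\<^bsub>E\<^esub> \<eta> X = \<eta> Y \<cdot>\<^bsub>E\<^esub> fm F f" using nat_isoD(3)[OF \<eta> o] by simp
    also have "\<theta> Y \<cdot>\<^bsub>E\<^esub> ((\<eta> Y \<cdot>\<^bsub>E\<^esub> fm F f) \<cdot>\<^bsub>E\<^esub> \<theta> X) = (\<theta> Y \<cdot>\<^bsub>E\<^esub> \<eta> Y) \<cdot>\<^bsub>E\<^esub> (fm F f \<cdot>\<^bsub>E\<^esub> \<theta> X)"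
      using tht[OF o(1)] tht[OF o(2)] f e[OF o(2)] by (simp add: E.assoc)
    also have "\<dots> = fm F f \<cdot>\<^bsub>E\<^esub> \<theta> X" using th[OF o(1)] th[OF o(2)] f by simp
    finally show ?thesis .
  qed
  moreover have "is_iso E (fo G X) (fo F X) (\<theta> X)" if "X \<in> Obj C" for X
    unfolding is_iso_def using th[OF that] e[OF that] functorD(1)[OF F that] functorD(1)[OF G that]
    by (intro conjI bexI[of _ "\<eta> X"]) auto
  ultimately show ?thesis unfolding is_nat_iso_def is_nat_def is_iso_def by blast
qed

lemma functor_comp:
  assumes F: "is_functor C E F" and G: "is_functor E B G"
  shows "is_functor C B (G \<circ>\<^sub>F F)"
  unfolding is_functor_def
proof (intro conjI ballI)
  fix X Y Z f g assume o: "X \<in> Obj C" "Y \<in> Obj C" "Z \<in> Obj C" and fg: "f \<in> maps C X Y" "g \<in> maps C Y Z"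
  have "fm G (fm F g \<cdot>\<^bsub>E\<^esub> fm F f) = fm G (fm F g) \<cdot>\<^bsub>B\<^esub> fm G (fm F f)"
    by (rule functorD(4)[OF G _ _ _ functorD(3)[OF F o(1,2) fg(1)] functorD(3)[OF F o(2,3) fg(2)]])
      (simp_all add: functorD(1)[OF F] o)
  then show "fm (G \<circ>\<^sub>F F) (g \<cdot>\<^bsub>C\<^esub> f) = fm (G \<circ>\<^sub>F F) g \<cdot>\<^bsub>B\<^esub> fm (G \<circ>\<^sub>F F) f"
    by (simp add: functorD(4)[OF F o fg])
qed (simp_all add: functorD(1-3)[OF F] functorD(1-3)[OF G])

lemma functor_id: "is_functor C C id_ftor"
  unfolding is_functor_def by simp

lemma faithful_of_nat_iso:
  assumes C: "preadditive_category C" and F: "is_functor C E F" and G: "is_functor E C G"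
    and \<eta>: "is_nat_iso C C id_ftor (G \<circ>\<^sub>F F) \<eta>"
    and fg: "X \<in> Obj C" "Y \<in> Obj C" "f \<in> maps C X Y" "g \<in> maps C X Y" "fm F f = fm F g"
  shows "f = g"
proof -
  interpret C: preadditive_category C by fact
  have "\<eta> Y \<cdot>\<^bsub>C\<^esub> f = \<eta> Y \<cdot>\<^bsub>C\<^esub> g"
    using nat_isoD(3)[OF \<eta> fg(1-3)] nat_isoD(3)[OF \<eta> fg(1,2,4)] fg(5) by simp
  moreover have "is_iso C Y (fo G (fo F Y)) (\<eta> Y)" using nat_isoD(1)[OF \<eta> fg(2)] by simp
  ultimately show ?thesis
    using C.iso_cancel_left fg functorD(1)[OF F] functorD(1)[OF G] by blast
qed

text \<open>The preimage \<open>k\<close> is the conjugate of \<open>fm G h\<close> by \<eta>.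
  Cancelling \<eta> shows that \<open>fm F k\<close> and \<open>h\<close> have the same image under
  \<open>G\<close>, and \<epsilon> makes \<open>G\<close> faithful.\<close>

lemma full_of_nat_iso:
  assumes C: "preadditive_category C" and E: "preadditive_category E"
    and F: "is_functor C E F" and G: "is_functor E C G"
    and \<eta>: "is_nat_iso C C id_ftor (G \<circ>\<^sub>F F) \<eta>" and \<epsilon>: "is_nat_iso E E id_ftor (F \<circ>\<^sub>F G) \<epsilon>"
    and o: "X \<in> Obj C" "Y \<in> Obj C" and h: "h \<in> maps E (fo F X) (fo F Y)"
  obtains k where "k \<in> maps C X Y" "fm F k = h"
proof -
  interpret C: preadditive_category C by fact
  have FG: "fo G (fo F X) \<in> Obj C" "fo G (fo F Y) \<in> Obj C" using functorD(1)[OF F] functorD(1)[OF G] o by blast+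
  have eX: "is_iso C X (fo G (fo F X)) (\<eta> X)" and eY: "is_iso C Y (fo G (fo F Y)) (\<eta> Y)"
    using nat_isoD(1)[OF \<eta>] o by auto
  obtain t where t: "\<eta> Y \<in> arrows C" "Dom C (\<eta> Y) = Y" "Cod C (\<eta> Y) = fo G (fo F Y)"
    "t \<in> arrows C" "Dom C t = fo G (fo F Y)" "Cod C t = Y" "\<eta> Y \<cdot>\<^bsub>C\<^esub> t = Idt C (fo G (fo F Y))"
    using C.isoE[OF eY o(2) FG(2)] by blast
  have x: "\<eta> X \<in> arrows C" "Dom C (\<eta> X) = X" "Cod C (\<eta> X) = fo G (fo F X)"
    using C.isoE[OF eX o(1) FG(1)] by blast+
  have Gh: "fm G h \<in> arrows C" "Dom C (fm G h) = fo G (fo F X)" "Cod C (fm G h) = fo G (fo F Y)"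
    using functorD(3)[OF G functorD(1)[OF F o(1)] functorD(1)[OF F o(2)] h] FG by auto
  define k where "k = t \<cdot>\<^bsub>C\<^esub> (fm G h \<cdot>\<^bsub>C\<^esub> \<eta> X)"
  have k: "k \<in> maps C X Y" using t x Gh o by (simp add: k_def)
  have "fm G (fm F k) \<cdot>\<^bsub>C\<^esub> \<eta> X = \<eta> Y \<cdot>\<^bsub>C\<^esub> k" using nat_isoD(3)[OF \<eta> o k] by simp
  also have "\<dots> = (\<eta> Y \<cdot>\<^bsub>C\<^esub> t) \<cdot>\<^bsub>C\<^esub> (fm G h \<cdot>\<^bsub>C\<^esub> \<eta> X)" unfolding k_def using t(1-6) x Gh by (simp add: C.assoc)
  also have "\<dots> = fm G h \<cdot>\<^bsub>C\<^esub> \<eta> X" using t x Gh by simp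
  finally have "fm G (fm F k) \<cdot>\<^bsub>C\<^esub> \<eta> X = fm G h \<cdot>\<^bsub>C\<^esub> \<eta> X" .
  moreover have Fk: "fm F k \<in> maps E (fo F X) (fo F Y)" by (rule functorD(3)[OF F o k])
  then have "fm G (fm F k) \<in> maps C (fo G (fo F X)) (fo G (fo F Y))"
    by (rule functorD(3)[OF G functorD(1)[OF F o(1)] functorD(1)[OF F o(2)]])
  moreover have "fm G h \<in> maps C (fo G (fo F X)) (fo G (fo F Y))" using Gh FG by simp
  ultimately have "fm G (fm F k) = fm G h" using C.iso_cancel_right[OF eX o(1) FG(1)] FG(2) by blast
  then have "fm F k = h"
    by (rule faithful_of_nat_iso[OF E G F \<epsilon> functorD(1)[OF F o(1)] functorD(1)[OF F o(2)] Fk h])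
  then show thesis using that k by blast
qed

text \<open>A zero arrow absorbs every endomorphism of its domain. By fullness its image under
  \<open>F\<close> does so too, hence is zero. For a quasi-inverse of the suspension this takes the
  place of additivity.\<close>

lemma full_functor_zero:
  assumes C: "preadditive_category C" and E: "preadditive_category E" and F: "is_functor C E F"
    and full: "\<And>h. h \<in> maps E (fo F X) (fo F X) \<Longrightarrow> \<exists>k\<in>maps C X X. fm F k = h"
    and o: "X \<in> Obj C" "Y \<in> Obj C"
  shows "fm F \<one>\<^bsub>Hom C X Y\<^esub> = \<one>\<^bsub>Hom E (fo F X) (fo F Y)\<^esub>"
proof -
  interpret C: preadditive_category C by fact
  interpret E: preadditive_category E by fact
  note a = functor_arrow[OF C E F]
  have z: "fm F \<one>\<^bsub>Hom C X Y\<^esub> \<in> arrows E" "Dom E (fm F \<one>\<^bsub>Hom C X Y\<^esub>) = fo F X" "Cod E (fm F \<one>\<^bsub>Hom C X Y\<^esub>) = fo F Y"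
    using a(1-3)[of "\<one>\<^bsub>Hom C X Y\<^esub>"] o by auto
  have "fm F \<one>\<^bsub>Hom C X Y\<^esub> \<cdot>\<^bsub>E\<^esub> w = fm F \<one>\<^bsub>Hom C X Y\<^esub>" if "w \<in> maps E (fo F X) (fo F X)" for w
  proof -
    obtain k where k: "k \<in> maps C X X" "fm F k = w" using full[OF \<open>w \<in> _\<close>] by blast
    have "fm F (\<one>\<^bsub>Hom C X Y\<^esub> \<cdot>\<^bsub>C\<^esub> k) = fm F \<one>\<^bsub>Hom C X Y\<^esub> \<cdot>\<^bsub>E\<^esub> fm F k" by (rule a(4)) (use o k in auto)
    then show ?thesis using k o by simp
  qed
  from E.zero_iff_comp_eq[OF z(1), unfolded z, OF this] show ?thesis .
qed

section \<open>Triangles\<close>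

lemma (in preadditive_category) zero_object_iff:
  assumes "Z \<in> Obj C"
  shows "zero_object C Z \<longleftrightarrow> Idt C Z = \<one>\<^bsub>Hom C Z Z\<^esub>"
proof
  assume "zero_object C Z"
  then have "\<exists>!f. f \<in> maps C Z Z" using assms unfolding zero_object_def by blast
  moreover have "Idt C Z \<in> maps C Z Z" "\<one>\<^bsub>Hom C Z Z\<^esub> \<in> maps C Z Z" using assms by simp_all
  ultimately show "Idt C Z = \<one>\<^bsub>Hom C Z Z\<^esub>" by blast
next
  assume id: "Idt C Z = \<one>\<^bsub>Hom C Z Z\<^esub>"
  have "f = \<one>\<^bsub>Hom C X Z\<^esub>" if "X \<in> Obj C" "f \<in> maps C X Z" for X f
  proof -
    have "f = Idt C Z \<cdot> f" using that assms by simp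
    then show ?thesis unfolding id using that assms by simp
  qed
  moreover have "f = \<one>\<^bsub>Hom C Z X\<^esub>" if "X \<in> Obj C" "f \<in> maps C Z X" for X f
  proof -
    have "f = f \<cdot> Idt C Z" using that assms by simp
    then show ?thesis unfolding id using that assms by simp
  qed
  moreover have "\<one>\<^bsub>Hom C X Z\<^esub> \<in> maps C X Z" "\<one>\<^bsub>Hom C Z X\<^esub> \<in> maps C Z X" if "X \<in> Obj C" for X
    using that assms by simp_all
  ultimately show "zero_object C Z" unfolding zero_object_def using assms by (intro conjI ballI ex1I) blast+
qed

context triangulated_category
begin

lemma sus_functor: "is_functor T T (Sus T)"
  using sus_additive unfolding additive_functor_def by blast

lemma sus_simps [simp]:
  "X \<in> Obj T \<Longrightarrow> sus T X \<in> Obj T" "X \<in> Obj T \<Longrightarrow> susm T (Idt T X) = Idt T (sus T X)"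
  "f \<in> arrows T \<Longrightarrow> susm T f \<in> arrows T" "f \<in> arrows T \<Longrightarrow> Dom T (susm T f) = sus T (Dom T f)"
  "f \<in> arrows T \<Longrightarrow> Cod T (susm T f) = sus T (Cod T f)"
  using functorD(1,2)[OF sus_functor] functor_arrow[OF preadditive_category_axioms preadditive_category_axioms sus_functor]
  by auto

lemma sus_zero [simp]:
  assumes "X \<in> Obj T" "Y \<in> Obj T"
  shows "susm T \<one>\<^bsub>Hom T X Y\<^esub> = \<one>\<^bsub>Hom T (sus T X) (sus T Y)\<^esub>"
  using sus_additive assms hom_one[of "susm T" "Hom T X Y" "Hom T (sus T X) (sus T Y)"]
  unfolding additive_functor_def by simp

lemma zero_object_sus: "zero_object T Z \<Longrightarrow> zero_object T (sus T Z)"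
proof -
  assume z: "zero_object T Z"
  then have Z: "Z \<in> Obj T" unfolding zero_object_def by blast
  then have "susm T (Idt T Z) = susm T \<one>\<^bsub>Hom T Z Z\<^esub>" using z zero_object_iff by simp
  then show ?thesis using Z by (simp add: zero_object_iff)
qed

lemma triD:
  assumes "Tri T X Y Z f g h"
  shows "X \<in> Obj T" "Y \<in> Obj T" "Z \<in> Obj T" "f \<in> arrows T" "Dom T f = X" "Cod T f = Y"
    "g \<in> arrows T" "Dom T g = Y" "Cod T g = Z" "h \<in> arrows T" "Dom T h = Z" "Cod T h = sus T X"
  using tri_closed[OF assms] by auto

lemma tri_rotated:
  assumes "Tri T X Y Z f g h"
  shows "Tri T Y Z (sus T X) g h (inv\<^bsub>Hom T (sus T X) (sus T Y)\<^esub> (susm T f))"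
  using tri_rotate[of X Y Z f g h] tri_closed[OF assms] assms by blast

text \<open>The triangle on the identity of \<open>X\<close> maps to the given one with first
  components \<open>Idt T X\<close> and \<open>f\<close>. The third component shows that
  \<open>g \<cdot> f\<close> passes through a zero object.\<close>

lemma tri_comp_zero:
  assumes t: "Tri T X Y Z f g h"
  shows "g \<cdot> f = \<one>\<^bsub>Hom T X Z\<^esub>"
proof -
  note d = triD[OF t]
  obtain N0 where z: "zero_object T N0" using ex_zero by blast
  then have N0: "N0 \<in> Obj T" unfolding zero_object_def by blast
  have "Tri T X X N0 (Idt T X) \<one>\<^bsub>Hom T X N0\<^esub> \<one>\<^bsub>Hom T N0 (sus T X)\<^esub>" by (rule tri_id[OF d(1) z])
  then obtain c where c: "c \<in> maps T N0 Z" "c \<cdot> \<one>\<^bsub>Hom T X N0\<^esub> = g \<cdot> f"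
    using tri_morphism[OF _ t, of X X N0 "Idt T X" _ _ "Idt T X" f] d by auto
  then show ?thesis using d(1,3) N0 by auto
qed

text \<open>Exactness of Hom(-, W): zero and \<open>v\<close> are the first two components of a
  morphism to the triangle 0 -> W -> W -> \<Sigma> 0, and its third component is
  \<open>w\<close>.\<close>

lemma tri_factor:
  assumes t: "Tri T X Y Z f g h" and v: "v \<in> maps T Y W" "W \<in> Obj T" and z: "v \<cdot> f = \<one>\<^bsub>Hom T X W\<^esub>"
  obtains w where "w \<in> maps T Z W" "v = w \<cdot> g"
proof -
  note d = triD[OF t]
  obtain N0 where N0: "zero_object T N0" using ex_zero by blast
  then have Oo: "N0 \<in> Obj T" unfolding zero_object_def by blast
  have uniq: "\<And>a b. a \<in> maps T X' N0 \<Longrightarrow> b \<in> maps T X' N0 \<Longrightarrow> a = b"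
     "\<And>a b. a \<in> maps T N0 X' \<Longrightarrow> b \<in> maps T N0 X' \<Longrightarrow> a = b" if "X' \<in> Obj T" for X'
    using N0 that unfolding zero_object_def by blast+
  \<comment> \<open>The target triangle is an identity triangle rotated backwards. Its third object
    must then be a suspension, so the suspension of a zero object is used; the sign of the rotation
    does not change a zero arrow.\<close>
  have "Tri T W W (sus T N0) (Idt T W) \<one>\<^bsub>Hom T W (sus T N0)\<^esub> \<one>\<^bsub>Hom T (sus T N0) (sus T W)\<^esub>"
    by (rule tri_id[OF v(2) zero_object_sus[OF N0]])
  moreover have "inv\<^bsub>Hom T (sus T N0) (sus T W)\<^esub> (susm T \<one>\<^bsub>Hom T N0 W\<^esub>) = \<one>\<^bsub>Hom T (sus T N0) (sus T W)\<^esub>"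
    using Oo v(2) by (simp add: monoid.inv_one group.is_monoid)
  ultimately have t2: "Tri T N0 W W \<one>\<^bsub>Hom T N0 W\<^esub> (Idt T W) \<one>\<^bsub>Hom T W (sus T N0)\<^esub>"
    using tri_rotate[of N0 W W "\<one>\<^bsub>Hom T N0 W\<^esub>" "Idt T W" "\<one>\<^bsub>Hom T W (sus T N0)\<^esub>"] Oo v(2) by simp
  have e: "v \<cdot> f = \<one>\<^bsub>Hom T N0 W\<^esub> \<cdot> \<one>\<^bsub>Hom T X N0\<^esub>" using z Oo v(2) d(1) by simp
  have "\<one>\<^bsub>Hom T X N0\<^esub> \<in> maps T X N0" using d(1) Oo by simp
  from tri_morphism[OF t t2 this v(1) e]
  obtain c where "c \<in> maps T Z W" "c \<cdot> g = Idt T W \<cdot> v" by blast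
  then show thesis by (intro that[of c]) (use v d in auto)
qed

text \<open>The support of \<open>u\<close> is found in two pieces. \<open>u \<cdot> g\<close> is
  fixed by the idempotent \<open>e\<close> of a finite set, so the difference of \<open>u\<close>
  and \<open>e \<cdot> u\<close> kills \<open>g\<close> and factors through \<open>h\<close> by an
  arrow \<open>w\<close> from a compact object. \<open>w\<close> is fixed by the idempotent of a
  second finite set, and the idempotent of the union fixes \<open>u\<close>.\<close>

lemma compact_cone:
  assumes t: "Tri T A B K f g h" and B: "compact_object (\<UU> :: 'u itself) T B" and A: "compact_object \<UU> T (sus T A)"
  shows "compact_object \<UU> T K"
proof -
  note d = triD[OF t]
  have oA: "sus T A \<in> Obj T" using d by simp
  have "finitely_supported I X P \<iota> u"
    if P: "small \<UU> I" "is_coproduct T I X P \<iota>" and u0: "u \<in> maps T K P" for I :: "'u set" and X P \<iota> u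
  proof -
    note c = coproductD[OF P(2)]
    have u: "u \<in> arrows T" "Dom T u = K" "Cod T u = P" using u0 d c by auto
    have ug: "u \<cdot> g \<in> maps T B P" using u d c by simp
    then have "finitely_supported I X P \<iota> (u \<cdot> g)"
      using B P unfolding compact_object_iff[OF d(2)] by blast
    then obtain F e where F: "finite F" "F \<subseteq> I" "summand_idem I X P \<iota> F e" "e \<cdot> (u \<cdot> g) = u \<cdot> g"
      unfolding finitely_supported_def by blast
    have e: "e \<in> arrows T" "Dom T e = P" "Cod T e = P" using F(3) c(1) unfolding summand_idem_def by auto
    define v where "v = u \<otimes>\<^bsub>Hom T K P\<^esub> inv\<^bsub>Hom T K P\<^esub> (e \<cdot> u)"
    have v: "v \<in> arrows T" "Dom T v = K" "Cod T v = P" unfolding v_def using u e by auto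
    have "v \<cdot> g = (u \<cdot> g) \<otimes>\<^bsub>Hom T B P\<^esub> inv\<^bsub>Hom T B P\<^esub> ((e \<cdot> u) \<cdot> g)"
      unfolding v_def using u e d by (simp add: comp_distrib neg_comp)
    also have "(e \<cdot> u) \<cdot> g = u \<cdot> g" using F(4) u e d by (simp add: assoc)
    also have "(u \<cdot> g) \<otimes>\<^bsub>Hom T B P\<^esub> inv\<^bsub>Hom T B P\<^esub> (u \<cdot> g) = \<one>\<^bsub>Hom T B P\<^esub>" using u d by simp
    finally have "v \<cdot> g = \<one>\<^bsub>Hom T B P\<^esub>" .
    then obtain w where w: "w \<in> maps T (sus T A) P" "v = w \<cdot> h"
      using tri_factor[OF tri_rotated[OF t], of v P] v d c by auto
    have w': "w \<in> arrows T" "Dom T w = sus T A" "Cod T w = P" using w(1) oA c by auto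
    have "finitely_supported I X P \<iota> w"
      using A P w unfolding compact_object_iff[OF oA] by blast
    then obtain F' e' where F': "finite F'" "F' \<subseteq> I" "summand_idem I X P \<iota> F' e'" "e' \<cdot> w = w"
      unfolding finitely_supported_def by blast
    obtain e2 where e2p: "summand_idem I X P \<iota> (F \<union> F') e2" using ex_summand_idem[OF P(2)] by blast
    have e2: "e2 \<in> arrows T" "Dom T e2 = P" "Cod T e2 = P" using e2p c(1) unfolding summand_idem_def by auto
    have e': "e' \<in> arrows T" "Dom T e' = P" "Cod T e' = P" using F'(3) c(1) unfolding summand_idem_def by auto
    have ee: "e2 \<cdot> e = e" "e2 \<cdot> e' = e'"
      using summand_idem_comp[OF P(2) F(3) e2p] summand_idem_comp[OF P(2) F'(3) e2p] by auto
    have "e2 \<cdot> w = e2 \<cdot> (e' \<cdot> w)" using F'(4) by simp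
    also have "\<dots> = (e2 \<cdot> e') \<cdot> w" using e2 e' w' by (simp add: assoc)
    finally have "e2 \<cdot> w = w" using ee F'(4) by simp
    then have e2v: "e2 \<cdot> v = v" unfolding w(2) using e2 w' d by (simp add: assoc[symmetric])
    have uv: "u = v \<otimes>\<^bsub>Hom T K P\<^esub> (e \<cdot> u)" unfolding v_def using u e Hom_diff_cancel by simp
    have "e2 \<cdot> u = e2 \<cdot> (v \<otimes>\<^bsub>Hom T K P\<^esub> (e \<cdot> u))" using uv by simp
    also have "\<dots> = (e2 \<cdot> v) \<otimes>\<^bsub>Hom T K P\<^esub> ((e2 \<cdot> e) \<cdot> u)"
      using e2 v e u by (simp add: comp_distrib2 assoc)
    also have "\<dots> = u" using e2v ee uv by simp
    finally show ?thesis unfolding finitely_supported_def using F F' e2p by blast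
  qed
  then show ?thesis unfolding compact_object_iff[OF d(3)] by blast
qed

text \<open>For a quasi-inverse \<open>G\<close> of the suspension, \<eta> turns an arrow \<Sigma> K
  -> P into an arrow K -> G P. Since \<open>G\<close> preserves coproducts and zero arrows, it sends
  summand idempotents to summand idempotents, so supports can be compared before and after
  \<open>G\<close>.\<close>

lemma compact_sus:
  assumes K: "compact_object (\<UU> :: 'u itself) T K"
  shows "compact_object \<UU> T (sus T K)"
proof -
  note pre = preadditive_category_axioms
  have Ko: "K \<in> Obj T" using K unfolding compact_object_def by blast
  obtain G \<eta> \<epsilon>0 where G: "is_functor T T G" and eta: "is_nat_iso T T id_ftor (G \<circ>\<^sub>F Sus T) \<eta>"
    and eps0: "is_nat_iso T T (Sus T \<circ>\<^sub>F G) id_ftor \<epsilon>0"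
    using sus_equivalence unfolding is_equivalence_def by blast
  obtain \<epsilon> where eps: "is_nat_iso T T id_ftor (Sus T \<circ>\<^sub>F G) \<epsilon>"
    using nat_iso_inverse[OF pre pre functor_comp[OF G sus_functor] functor_id eps0] by blast
  note Ga = functor_arrow[OF pre pre G] and Go = functorD(1,2)[OF G]
  note full = full_of_nat_iso[OF pre pre G sus_functor eps eta]
  note faith = faithful_of_nat_iso[OF pre G sus_functor eps]
  have zero: "fm G \<one>\<^bsub>Hom T X Y\<^esub> = \<one>\<^bsub>Hom T (fo G X) (fo G Y)\<^esub>" if "X \<in> Obj T" "Y \<in> Obj T" for X Y
    by (rule full_functor_zero[OF pre pre G _ that]) (use full[OF that(1) that(1)] in blast)
  have "finitely_supported I X P \<iota> u"
    if P: "small \<UU> I" "is_coproduct T I X P \<iota>" and u0: "u \<in> maps T (sus T K) P" for I :: "'u set" and X P \<iota> u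
  proof -
    note c = coproductD[OF P(2)]
    have u: "u \<in> arrows T" "Dom T u = sus T K" "Cod T u = P" using u0 Ko c by auto
    \<comment> \<open>An equivalence preserves coproducts: \<eta> moves a family with target
      \<open>Y\<close> to target G \<Sigma> Y, fullness of \<open>G\<close> lifts it to a family
      with target \<Sigma> Y, and the factorisation found there is sent back by \<open>G\<close> and
      the inverse of \<eta>.\<close>
    have GP: "is_coproduct T I (\<lambda>i. fo G (X i)) (fo G P) (\<lambda>i. fm G (\<iota> i))"
      unfolding is_coproduct_def
    proof (intro conjI ballI allI impI)
      show "fo G P \<in> Obj T" "\<And>i. i \<in> I \<Longrightarrow> fo G (X i) \<in> Obj T" "\<And>i. i \<in> I \<Longrightarrow> fm G (\<iota> i) \<in> maps T (fo G (X i)) (fo G P)"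
        using c Go Ga by auto
      fix Y f assume Y: "Y \<in> Obj T" and f: "\<forall>i\<in>I. f i \<in> maps T (fo G (X i)) Y"
      have sY: "sus T Y \<in> Obj T" "fo G (sus T Y) \<in> Obj T" using Y Go by auto
      have "is_iso T Y (fo G (sus T Y)) (\<eta> Y)" using nat_isoD(1)[OF eta Y] by simp
      from isoE[OF this Y sY(2)] obtain t where t: "\<eta> Y \<in> arrows T" "Dom T (\<eta> Y) = Y" "Cod T (\<eta> Y) = fo G (sus T Y)"
        "t \<in> arrows T" "Dom T t = fo G (sus T Y)" "Cod T t = Y" "t \<cdot> \<eta> Y = Idt T Y" "\<eta> Y \<cdot> t = Idt T (fo G (sus T Y))"
        by blast
      have "\<forall>i\<in>I. \<exists>k. k \<in> maps T (X i) (sus T Y) \<and> fm G k = \<eta> Y \<cdot> f i"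
      proof
        fix i assume i: "i \<in> I"
        have "\<eta> Y \<cdot> f i \<in> maps T (fo G (X i)) (fo G (sus T Y))" using f i c Go Y t sY by auto
        from full[OF c(2)[OF i] sY(1) this] show "\<exists>k. k \<in> maps T (X i) (sus T Y) \<and> fm G k = \<eta> Y \<cdot> f i" by blast
      qed
      from bchoice[OF this] obtain k where k: "\<And>i. i \<in> I \<Longrightarrow> k i \<in> maps T (X i) (sus T Y)" "\<And>i. i \<in> I \<Longrightarrow> fm G (k i) = \<eta> Y \<cdot> f i"
        by blast
      obtain w where w: "w \<in> maps T P (sus T Y)" "\<And>i. i \<in> I \<Longrightarrow> w \<cdot> \<iota> i = k i"
        using coproduct_factor[OF P(2) sY(1), of k] k(1) by blast
      have w': "w \<in> arrows T" "Dom T w = P" "Cod T w = sus T Y" using w(1) c sY by auto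
      show "\<exists>!u. u \<in> maps T (fo G P) Y \<and> (\<forall>i\<in>I. u \<cdot> fm G (\<iota> i) = f i)"
      proof (intro ex1I conjI ballI)
        show "t \<cdot> fm G w \<in> maps T (fo G P) Y" using t Ga w' Go c Y by auto
        fix i assume i: "i \<in> I"
        have fi: "f i \<in> arrows T" "Cod T (f i) = Y" using f i c Go Y by auto
        have "fm G w \<cdot> fm G (\<iota> i) = \<eta> Y \<cdot> f i"
          using Ga(4)[of "\<iota> i" w] c i w' w(2)[OF i] k(2)[OF i] by simp
        then have "(t \<cdot> fm G w) \<cdot> fm G (\<iota> i) = t \<cdot> (\<eta> Y \<cdot> f i)"
          using t(4-6) Ga(1-3)[OF w'(1)] Ga(1-3)[OF c(3)[OF i]] w' c(4,5)[OF i] by (simp add: assoc)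
        also have "\<dots> = (t \<cdot> \<eta> Y) \<cdot> f i" using t(1-6) fi by (simp add: assoc)
        also have "\<dots> = f i" using t(7) fi by simp
        finally show "(t \<cdot> fm G w) \<cdot> fm G (\<iota> i) = f i" .
      next
        fix z assume z: "z \<in> maps T (fo G P) Y \<and> (\<forall>i\<in>I. z \<cdot> fm G (\<iota> i) = f i)"
        have z': "z \<in> arrows T" "Dom T z = fo G P" "Cod T z = Y" using z Go c Y by auto
        have "\<eta> Y \<cdot> z \<in> maps T (fo G P) (fo G (sus T Y))" using z' t Go c sY by simp
        from full[OF c(1) sY(1) this] obtain l where l: "l \<in> maps T P (sus T Y)" "fm G l = \<eta> Y \<cdot> z" by blast
        have l': "l \<in> arrows T" "Dom T l = P" "Cod T l = sus T Y" using l(1) c sY by auto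
        have "l = w"
        proof (rule coproduct_ext[OF P(2) sY(1) l(1) w(1)])
          fix i assume i: "i \<in> I"
          have "fm G (l \<cdot> \<iota> i) = (\<eta> Y \<cdot> z) \<cdot> fm G (\<iota> i)" using Ga(4)[of "\<iota> i" l] c i l' l(2) by simp
          also have "\<dots> = \<eta> Y \<cdot> (z \<cdot> fm G (\<iota> i))"
            using t(1-3) z' Ga(1-3)[OF c(3)[OF i]] c(4,5)[OF i] by (simp add: assoc)
          also have "\<dots> = fm G (w \<cdot> \<iota> i)" using z i k(2)[OF i] w(2)[OF i] by simp
          finally show "l \<cdot> \<iota> i = w \<cdot> \<iota> i"
            by (rule faith[OF c(2)[OF i] sY(1), rotated 2]) (use l' w' c i sY in auto)
        qed
        then have "fm G w = \<eta> Y \<cdot> z" using l(2) by simp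
        then have "t \<cdot> fm G w = (t \<cdot> \<eta> Y) \<cdot> z" using t(1-6) z' by (simp add: assoc)
        then show "z = t \<cdot> fm G w" using t(7) z' by simp
      qed
    qed
    have gK: "fo G (sus T K) \<in> Obj T" using Ko Go by simp
    have "is_iso T K (fo G (sus T K)) (\<eta> K)" using nat_isoD(1)[OF eta Ko] by simp
    note eK = this
    obtain eKa: "\<eta> K \<in> arrows T" "Dom T (\<eta> K) = K" "Cod T (\<eta> K) = fo G (sus T K)"
      using isoE[OF eK Ko gK] by blast
    have Gu: "fm G u \<in> arrows T" "Dom T (fm G u) = fo G (sus T K)" "Cod T (fm G u) = fo G P" using Ga u by auto
    have "fm G u \<cdot> \<eta> K \<in> maps T K (fo G P)" using Gu eKa Ko Go c by simp
    then have "finitely_supported I (\<lambda>i. fo G (X i)) (fo G P) (\<lambda>i. fm G (\<iota> i)) (fm G u \<cdot> \<eta> K)"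
      using K P(1) GP unfolding compact_object_iff[OF Ko] by blast
    then obtain F e where F: "finite F" "F \<subseteq> I" and e: "summand_idem I (\<lambda>i. fo G (X i)) (fo G P) (\<lambda>i. fm G (\<iota> i)) F e"
      and eu: "e \<cdot> (fm G u \<cdot> \<eta> K) = fm G u \<cdot> \<eta> K"
      unfolding finitely_supported_def by blast
    obtain e' where e': "summand_idem I X P \<iota> F e'" using ex_summand_idem[OF P(2)] by blast
    have ea: "e \<in> arrows T" "Dom T e = fo G P" "Cod T e = fo G P" using e Go c(1) unfolding summand_idem_def by auto
    have ea': "e' \<in> arrows T" "Dom T e' = P" "Cod T e' = P" using e' c(1) unfolding summand_idem_def by auto
    \<comment> \<open>Both arrows act in the same way on the coprojections. For indices outside
      \<open>F\<close> this is where \<open>G\<close> has to preserve zero arrows.\<close>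
    have "fm G e' = e"
    proof (rule coproduct_ext[OF GP])
      show "fo G P \<in> Obj T" "fm G e' \<in> maps T (fo G P) (fo G P)" "e \<in> maps T (fo G P) (fo G P)"
        using Go c ea ea' Ga by auto
      fix i assume i: "i \<in> I"
      have "fm G e' \<cdot> fm G (\<iota> i) = fm G (e' \<cdot> \<iota> i)" using Ga(4)[of "\<iota> i" e'] ea' c i by simp
      also have "\<dots> = e \<cdot> fm G (\<iota> i)"
        using e e' i zero[OF c(2)[OF i] c(1)] unfolding summand_idem_def by auto
      finally show "fm G e' \<cdot> fm G (\<iota> i) = e \<cdot> fm G (\<iota> i)" .
    qed
    moreover have "fm G (e' \<cdot> u) = fm G e' \<cdot> fm G u" by (rule Ga(4)) (use ea' u in auto)
    moreover have "(e \<cdot> fm G u) \<cdot> \<eta> K = e \<cdot> (fm G u \<cdot> \<eta> K)" by (rule assoc) (use ea Gu eKa in auto)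
    ultimately have eq: "fm G (e' \<cdot> u) \<cdot> \<eta> K = fm G u \<cdot> \<eta> K" using eu by simp
    have eu': "e' \<cdot> u \<in> maps T (sus T K) P" using ea' u Ko c by simp
    have sK: "sus T K \<in> Obj T" using Ko by simp
    have m: "fm G v \<in> maps T (fo G (sus T K)) (fo G P)" if "v \<in> maps T (sus T K) P" for v
      by (rule functorD(3)[OF G sK c(1) that])
    have "fm G (e' \<cdot> u) = fm G u"
      by (rule iso_cancel_right[OF eK Ko gK m[OF eu'] m[OF u0] eq Go(1)[OF c(1)]])
    then have "e' \<cdot> u = u" by (rule faith[OF sK c(1) eu' u0])
    then show ?thesis unfolding finitely_supported_def using F e' by blast
  qed
  then show ?thesis using Ko by (simp add: compact_object_iff)
qed

end

section \<open>Presentations over the compact objects\<close>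

lemma Cpt_sel [simp]:
  "Obj (Cpt \<UU> T) = {C. compact_object \<UU> T C}" "Dom (Cpt \<UU> T) = Dom T" "Cod (Cpt \<UU> T) = Cod T"
  "Hom (Cpt \<UU> T) = Hom T" "Cmp (Cpt \<UU> T) = Cmp T" "Idt (Cpt \<UU> T) = Idt T"
  by (simp_all add: Cpt_def)

lemma compact_obj: "compact_object \<UU> T C \<Longrightarrow> C \<in> Obj T"
  by (simp add: compact_object_def)

lemma coker_Cpt: "coker (Cpt \<UU> T) f = coker T f"
  by (simp add: coker_def)

lemma corep_Cpt: "corep (Cpt \<UU> T) X = corep T X"
  by (simp add: corep_def)

lemma (in preadditive_category) preadditive_Cpt: "preadditive_category (Cpt \<UU> C)"
  unfolding Cpt_def by (rule preadditive_full_subcategory) (auto intro: compact_obj)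

lemma (in preadditive_category) arrows_Cpt:
  "f \<in> arrows (Cpt \<UU> C) \<longleftrightarrow> f \<in> arrows C \<and> compact_object \<UU> C (Dom C f) \<and> compact_object \<UU> C (Cod C f)"
  by (auto simp: arrows_def[of "Cpt \<UU> C"] compact_obj)

context preadditive_category
begin

lemma presents_hom_surj:
  assumes f: "presents \<UU> C f G" and f': "presents \<UU> C f' G" and G: "ab_closed (Cpt \<UU> C) G" and X: "X \<in> Obj C"
  shows "hom_surj f X \<longleftrightarrow> hom_surj f' X"
proof -
  have imp: "hom_surj f X" if ff': "presents \<UU> C f G" "presents \<UU> C f' G" and s: "hom_surj f' X" for f f'
  proof -
    have iso: "ab_isomorphic (Cpt \<UU> C) (coker C f) (coker C f')"
      using ff' ab_isomorphic_trans[OF ab_isomorphic_sym[OF G]] unfolding presents_def by blast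
    have a: "f \<in> arrows (Cpt \<UU> C)" "f' \<in> arrows (Cpt \<UU> C)" using ff' unfolding presents_def by auto
    show ?thesis
      by (rule coker_iso_hom_surj[OF _ _ _ _ _ _ _ iso[unfolded Cpt_def] X s])
        (use a in \<open>auto simp: arrows_Cpt intro: compact_obj\<close>)
  qed
  show ?thesis using imp f f' by blast
qed

text \<open>Removes the choice made in \<open>fp_ext\<close>: any presentation at hand may be used
  in place of the chosen one.\<close>

lemma trivial_fp_ext_iff:
  assumes f: "presents \<UU> C f G" and G: "ab_closed (Cpt \<UU> C) G" and X: "X \<in> Obj C"
  shows "trivial_group (ao (fp_ext \<UU> C G) X) \<longleftrightarrow> hom_surj f X"
proof -
  have p: "presents \<UU> C (SOME f. presents \<UU> C f G) G" by (rule someI[of "\<lambda>f. presents \<UU> C f G", OF f])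
  then have "(SOME f. presents \<UU> C f G) \<in> arrows C" unfolding presents_def arrows_Cpt by blast
  then have "trivial_group (ao (fp_ext \<UU> C G) X) \<longleftrightarrow> hom_surj (SOME f. presents \<UU> C f G) X"
    unfolding fp_ext_def using trivial_coker_iff X by blast
  then show ?thesis using presents_hom_surj[OF p f G X] by simp
qed

text \<open>Makes an arrow that is surjective on \<D> available as a test for the dual: its cokernel
  already takes values in the type over which \<open>annihilated\<close> ranges.\<close>

lemma coker_annihilated:
  assumes f: "f \<in> arrows (Cpt \<UU> C)" and D: "\<D> \<subseteq> Obj C" "\<And>X. X \<in> \<D> \<Longrightarrow> hom_surj f X"
  shows "coker C f \<in> annihilated \<UU> C \<D>" "presents \<UU> C f (coker C f)" "is_ab_functor (Cpt \<UU> C) (coker C f)"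
proof -
  show F: "is_ab_functor (Cpt \<UU> C) (coker C f)"
    using preadditive_category.coker_functor[OF preadditive_Cpt f] by (simp add: coker_Cpt)
  show p: "presents \<UU> C f (coker C f)" unfolding presents_def using f ab_isomorphic_refl[OF F] by blast
  have "trivial_group (ao (fp_ext \<UU> C (coker C f)) X)" if "X \<in> \<D>" for X
    using trivial_fp_ext_iff[OF p ab_functor_closed[OF F]] D that by blast
  then show "coker C f \<in> annihilated \<UU> C \<D>"
    unfolding annihilated_def finitely_presented_def using F p by blast
qed

lemma annihilated_presented:
  assumes G: "G \<in> annihilated \<UU> C \<D>" and D: "\<D> \<subseteq> Obj C"
  obtains f where "presents \<UU> C f G" "is_ab_functor (Cpt \<UU> C) G" "\<And>X. X \<in> \<D> \<Longrightarrow> hom_surj f X"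
proof -
  obtain f where f: "presents \<UU> C f G" "is_ab_functor (Cpt \<UU> C) G"
    using G unfolding annihilated_def finitely_presented_def by blast
  have "hom_surj f X" if "X \<in> \<D>" for X
    using trivial_fp_ext_iff[OF f(1) ab_functor_closed[OF f(2)]] G D that unfolding annihilated_def by blast
  with f that show thesis by blast
qed

section \<open>Invariance under isomorphism of objects and of arrows\<close>

lemma hom_surj_iso:
  assumes "is_iso C X Y a" "X \<in> Obj C" "Y \<in> Obj C" "f \<in> arrows C" "hom_surj f X"
  shows "hom_surj f Y"
proof -
  obtain b where ab: "a \<in> arrows C" "Dom C a = X" "Cod C a = Y" "b \<in> arrows C" "Dom C b = Y" "Cod C b = X" "a \<cdot> b = Idt C Y"
    using isoE[OF assms(1-3)] by blast
  show ?thesis unfolding hom_surj_def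
  proof
    fix u assume "u \<in> maps C (Dom C f) Y"
    then have u: "u \<in> arrows C" "Dom C u = Dom C f" "Cod C u = Y" using assms by auto
    then have "b \<cdot> u \<in> maps C (Dom C f) X" using ab assms by simp
    then obtain v where v: "v \<in> maps C (Cod C f) X" "b \<cdot> u = v \<cdot> f" using assms unfolding hom_surj_def by blast
    have v': "v \<in> arrows C" "Dom C v = Cod C f" "Cod C v = X" using v(1) assms by auto
    have "u = (a \<cdot> b) \<cdot> u" using ab u by simp
    also have "\<dots> = a \<cdot> (b \<cdot> u)" using ab(1-6) u by (simp add: assoc)
    also have "\<dots> = (a \<cdot> v) \<cdot> f" unfolding v(2) using ab(1-6) v' assms(4) by (simp add: assoc)
    finally have "u = (a \<cdot> v) \<cdot> f" .
    moreover have "a \<cdot> v \<in> maps C (Cod C f) Y" using ab v' assms by simp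
    ultimately show "\<exists>v\<in>maps C (Cod C f) Y. u = v \<cdot> f" by blast
  qed
qed

lemma hom_inj_iso:
  assumes "is_iso C X Y a" "X \<in> Obj C" "Y \<in> Obj C" "f \<in> arrows C" "hom_inj f X"
  shows "hom_inj f Y"
proof -
  obtain b where ab: "a \<in> arrows C" "Dom C a = X" "Cod C a = Y" "b \<in> arrows C" "Dom C b = Y" "Cod C b = X" "a \<cdot> b = Idt C Y"
    using isoE[OF assms(1-3)] by blast
  show ?thesis unfolding hom_inj_def
  proof (intro ballI impI)
    fix v assume v0: "v \<in> maps C (Cod C f) Y" and z: "v \<cdot> f = \<one>\<^bsub>Hom C (Dom C f) Y\<^esub>"
    have v: "v \<in> arrows C" "Dom C v = Cod C f" "Cod C v = Y" using v0 assms by auto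
    have "(b \<cdot> v) \<cdot> f = b \<cdot> (v \<cdot> f)" using ab(1-6) v assms(4) by (simp add: assoc)
    also have "\<dots> = \<one>\<^bsub>Hom C (Dom C f) X\<^esub>" unfolding z using ab assms by simp
    finally have "b \<cdot> v = \<one>\<^bsub>Hom C (Cod C f) X\<^esub>"
      using assms(5) ab v assms(2,4) unfolding hom_inj_def by simp
    then have "a \<cdot> (b \<cdot> v) = \<one>\<^bsub>Hom C (Cod C f) Y\<^esub>" using ab assms by simp
    moreover have "a \<cdot> (b \<cdot> v) = (a \<cdot> b) \<cdot> v" using ab(1-6) v by (simp add: assoc)
    ultimately show "v = \<one>\<^bsub>Hom C (Cod C f) Y\<^esub>" using ab v by simp
  qed
qed

text \<open>Pull an arrow \<open>u\<close> on \<open>A'\<close> back to \<open>A\<close> along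
  \<open>a\<close>, extend it over \<open>f\<close>, and compose with \<open>b\<close>. Since
  \<open>a \<cdot> a'\<close> is the identity, the square formed by \<open>a'\<close> and
  \<open>b\<close> returns \<open>u\<close>.\<close>

lemma hom_surj_retract:
  assumes f: "f \<in> maps C A B" and f': "f' \<in> maps C A' B'" and o: "A \<in> Obj C" "B \<in> Obj C" "A' \<in> Obj C" "B' \<in> Obj C"
    and a: "a \<in> maps C A A'" "a' \<in> maps C A' A" "a \<cdot> a' = Idt C A'" and b: "b \<in> maps C B' B"
    and sq: "f \<cdot> a' = b \<cdot> f'" and X: "X \<in> Obj C" and s: "hom_surj f X"
  shows "hom_surj f' X"
proof -
  have ff: "f \<in> arrows C" "Dom C f = A" "Cod C f = B" "f' \<in> arrows C" "Dom C f' = A'" "Cod C f' = B'"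
    and aa: "a \<in> arrows C" "Dom C a = A" "Cod C a = A'" "a' \<in> arrows C" "Dom C a' = A'" "Cod C a' = A"
    and bb: "b \<in> arrows C" "Dom C b = B'" "Cod C b = B"
    using f f' a b o by auto
  show ?thesis unfolding hom_surj_def ff
  proof
    fix u assume "u \<in> maps C A' X"
    then have u: "u \<in> arrows C" "Dom C u = A'" "Cod C u = X" using o X by auto
    then have "u \<cdot> a \<in> maps C A X" using aa o X by simp
    then obtain v where v: "v \<in> maps C B X" "u \<cdot> a = v \<cdot> f" using s unfolding hom_surj_def ff by blast
    have v': "v \<in> arrows C" "Dom C v = B" "Cod C v = X" using v(1) o X by auto
    have "u = u \<cdot> (a \<cdot> a')" using a(3) u by simp
    also have "\<dots> = (v \<cdot> f) \<cdot> a'" unfolding v(2)[symmetric] using aa u by (simp add: assoc)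
    also have "\<dots> = v \<cdot> (b \<cdot> f')" unfolding sq[symmetric] using v' ff aa by (simp add: assoc)
    also have "\<dots> = (v \<cdot> b) \<cdot> f'" using v' ff bb by (simp add: assoc)
    finally have "u = (v \<cdot> b) \<cdot> f'" .
    moreover have "v \<cdot> b \<in> maps C B' X" using v' bb o X by simp
    ultimately show "\<exists>v\<in>maps C B' X. u = v \<cdot> f'" by blast
  qed
qed

text \<open>Serves to replace \<open>f\<close> by its double dual under \<open>D\<close> and
  \<open>D'\<close>, along the unit of the equivalence.\<close>

lemma hom_surj_iso_arrow:
  assumes a: "is_iso C A A' a" "A \<in> Obj C" "A' \<in> Obj C" and b: "is_iso C B B' b" "B \<in> Obj C" "B' \<in> Obj C"
    and f: "f \<in> maps C A B" and f': "f' \<in> maps C A' B'" and sq: "b \<cdot> f = f' \<cdot> a" and X: "X \<in> Obj C"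
  shows "hom_surj f X \<longleftrightarrow> hom_surj f' X"
proof -
  obtain a' where aa: "a \<in> arrows C" "Dom C a = A" "Cod C a = A'" "a' \<in> arrows C" "Dom C a' = A'" "Cod C a' = A" "a' \<cdot> a = Idt C A" "a \<cdot> a' = Idt C A'"
    using isoE[OF a] by blast
  obtain b' where bb: "b \<in> arrows C" "Dom C b = B" "Cod C b = B'" "b' \<in> arrows C" "Dom C b' = B'" "Cod C b' = B" "b' \<cdot> b = Idt C B"
    using isoE[OF b] by blast
  have ff: "f \<in> arrows C" "Dom C f = A" "Cod C f = B" "f' \<in> arrows C" "Dom C f' = A'" "Cod C f' = B'"
    using f f' a b by auto
  have "f \<cdot> a' = (b' \<cdot> b) \<cdot> (f \<cdot> a')" using bb ff aa by simp
  also have "\<dots> = b' \<cdot> ((b \<cdot> f) \<cdot> a')" using bb(1-6) ff aa(1-6) by (simp add: assoc)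
  also have "\<dots> = (b' \<cdot> f') \<cdot> (a \<cdot> a')" unfolding sq using bb(1-6) ff aa(1-6) by (simp add: assoc)
  also have "\<dots> = b' \<cdot> f'" using aa ff bb by simp
  finally have sq': "f \<cdot> a' = b' \<cdot> f'" .
  have m: "a \<in> maps C A A'" "a' \<in> maps C A' A" "b \<in> maps C B B'" "b' \<in> maps C B' B" using aa bb a b by auto
  show ?thesis
    using hom_surj_retract[OF f f' a(2) b(2) a(3) b(3) m(1,2) aa(8) m(4) sq' X]
      hom_surj_retract[OF f' f a(3) b(3) a(2) b(2) m(2,1) aa(7) m(3) sq[symmetric] X] by blast
qed

lemma zero_object_hom_inj:
  assumes Z: "zero_object C Z" and f: "f \<in> arrows C"
  shows "hom_inj f Z"
  unfolding hom_inj_def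
proof (intro ballI impI)
  fix v assume "v \<in> maps C (Cod C f) Z"
  moreover have "\<one>\<^bsub>Hom C (Cod C f) Z\<^esub> \<in> maps C (Cod C f) Z" using Z f unfolding zero_object_def by simp
  moreover have "\<exists>!f'. f' \<in> maps C (Cod C f) Z"
    using Z arrow_obj(2)[OF f] unfolding zero_object_def by blast
  ultimately show "v = \<one>\<^bsub>Hom C (Cod C f) Z\<^esub>" by blast
qed

lemma zero_object_hom_surj:
  assumes "zero_object C Z" "f \<in> arrows C"
  shows "hom_surj f Z"
proof -
  have Z: "Z \<in> Obj C" using assms unfolding zero_object_def by blast
  have "u = \<one>\<^bsub>Hom C (Cod C f) Z\<^esub> \<cdot> f" if "u \<in> maps C (Dom C f) Z" for u
  proof -
    have "\<one>\<^bsub>Hom C (Cod C f) Z\<^esub> \<cdot> f \<in> maps C (Dom C f) Z" using Z assms by simp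
    moreover have "\<exists>!f'. f' \<in> maps C (Dom C f) Z" using assms(1) arrow_obj(1)[OF assms(2)] unfolding zero_object_def by blast
    ultimately show ?thesis using that by blast
  qed
  moreover have "\<one>\<^bsub>Hom C (Cod C f) Z\<^esub> \<in> maps C (Cod C f) Z" using Z assms by simp
  ultimately show ?thesis unfolding hom_surj_def by blast
qed

end

section \<open>Duality with values in the rationals modulo the integers\<close>

text \<open>The source of \<theta> has to be known as a group before \<theta> can be said to
  preserve the unit.\<close>

lemma hom_group_one:
  assumes "comm_group G"
  shows "\<one>\<^bsub>hom_group G QmodZ\<^esub> \<in> carrier (hom_group G QmodZ)" "group (hom_group G QmodZ)"
proof -
  interpret G: comm_group G by fact
  interpret Q: comm_group QmodZ by (rule comm_group_QmodZ)
  show one: "\<one>\<^bsub>hom_group G QmodZ\<^esub> \<in> carrier (hom_group G QmodZ)"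
    by (auto simp: hom_group_def hom_def)
  show "group (hom_group G QmodZ)"
  proof (rule groupI)
    fix \<phi> \<psi> \<rho> assume "\<phi> \<in> carrier (hom_group G QmodZ)" "\<psi> \<in> carrier (hom_group G QmodZ)" "\<rho> \<in> carrier (hom_group G QmodZ)"
    note p = this
    show "\<phi> \<otimes>\<^bsub>hom_group G QmodZ\<^esub> \<psi> \<in> carrier (hom_group G QmodZ)"
      using p by (auto simp: hom_group_def hom_def Pi_iff Q.m_ac)
    show "\<phi> \<otimes>\<^bsub>hom_group G QmodZ\<^esub> \<psi> \<otimes>\<^bsub>hom_group G QmodZ\<^esub> \<rho> = \<phi> \<otimes>\<^bsub>hom_group G QmodZ\<^esub> (\<psi> \<otimes>\<^bsub>hom_group G QmodZ\<^esub> \<rho>)"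
      using p by (auto simp: hom_group_def hom_def Pi_iff Q.m_ac fun_eq_iff)
  next
    fix \<phi> assume p: "\<phi> \<in> carrier (hom_group G QmodZ)"
    show "\<one>\<^bsub>hom_group G QmodZ\<^esub> \<otimes>\<^bsub>hom_group G QmodZ\<^esub> \<phi> = \<phi>"
      using p by (auto simp: hom_group_def hom_def Pi_iff fun_eq_iff extensional_def)
    show "\<exists>\<psi>\<in>carrier (hom_group G QmodZ). \<psi> \<otimes>\<^bsub>hom_group G QmodZ\<^esub> \<phi> = \<one>\<^bsub>hom_group G QmodZ\<^esub>"
      using p by (intro bexI[of _ "\<lambda>x\<in>carrier G. inv\<^bsub>QmodZ\<^esub> (\<phi> x)"])
        (auto simp: hom_group_def hom_def Pi_iff fun_eq_iff Q.inv_mult)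
  qed (rule one)
qed

lemma restrict_hom_group:
  assumes "comm_group G" "\<phi> \<in> hom G H"
  shows "restrict \<phi> (carrier G) \<in> carrier (hom_group G H)"
  using assms by (auto simp: hom_group_def hom_def comm_group_def comm_monoid_def monoid.m_closed)

section \<open>The AGJ isomorphisms as character duality\<close>

lemma AGJ_precomp:
  assumes T: "preadditive_category T" and U: "preadditive_category U"
    and agj: "AGJ_natural_iso \<UU> T U Q D" and Q: "is_functor (opp T) U Q" and D: "is_functor (Cpt \<UU> T) (opp (Cpt \<UU> U)) D"
    and X: "X \<in> Obj T"
  obtains \<theta> where "\<And>C. compact_object \<UU> T C \<Longrightarrow> \<theta> C \<in> iso (hom_group (Hom T C X) QmodZ) (Hom U (fo D C) (fo Q X))"
    and "\<And>A B f \<phi>. \<lbrakk>compact_object \<UU> T A; compact_object \<UU> T B; f \<in> maps T A B; \<phi> \<in> carrier (hom_group (Hom T A X) QmodZ)\<rbrakk>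
          \<Longrightarrow> \<theta> B (\<lambda>u\<in>maps T B X. \<phi> (u \<cdot>\<^bsub>T\<^esub> f)) = \<theta> A \<phi> \<cdot>\<^bsub>U\<^esub> fm D f"
proof -
  interpret T: preadditive_category T by fact
  interpret U: preadditive_category U by fact
  obtain \<theta> where iso: "\<And>C X. \<lbrakk>C \<in> Obj (Cpt \<UU> T); X \<in> Obj T\<rbrakk> \<Longrightarrow> \<theta> C X \<in> iso (hom_group (Hom T C X) QmodZ) (Hom U (fo D C) (fo Q X))"
    and nat: "\<And>C C' X X' c x \<phi>. \<lbrakk>C \<in> Obj (Cpt \<UU> T); C' \<in> Obj (Cpt \<UU> T); X \<in> Obj T; X' \<in> Obj T; c \<in> maps T C C'; x \<in> maps T X' X;
          \<phi> \<in> carrier (hom_group (Hom T C X) QmodZ)\<rbrakk> \<Longrightarrow>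
             \<theta> C' X' (\<lambda>u\<in>maps T C' X'. \<phi> (x \<cdot>\<^bsub>T\<^esub> u \<cdot>\<^bsub>T\<^esub> c)) =
             fm Q x \<cdot>\<^bsub>U\<^esub> \<theta> C X \<phi> \<cdot>\<^bsub>U\<^esub> fm D c"
    using agj unfolding AGJ_natural_iso_def by blast
  have QX: "fo Q X \<in> Obj U" "fm Q (Idt T X) = Idt U (fo Q X)" using functorD(1,2)[OF Q] X by auto
  have Do: "fo D C \<in> Obj U" if "compact_object \<UU> T C" for C
    using functorD(1)[OF D] that by (auto intro: compact_obj)
  show thesis
  proof (rule that[of "\<lambda>C. \<theta> C X"])
    show "\<theta> C X \<in> iso (hom_group (Hom T C X) QmodZ) (Hom U (fo D C) (fo Q X))" if "compact_object \<UU> T C" for C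
      using iso[of C X] that X by simp
    fix A B f \<phi> assume A: "compact_object \<UU> T A" and B: "compact_object \<UU> T B" and f: "f \<in> maps T A B"
      and \<phi>: "\<phi> \<in> carrier (hom_group (Hom T A X) QmodZ)"
    have o: "A \<in> Obj T" "B \<in> Obj T" using A B by (auto intro: compact_obj)
    have "(\<lambda>u\<in>maps T B X. \<phi> (Idt T X \<cdot>\<^bsub>T\<^esub> u \<cdot>\<^bsub>T\<^esub> f)) = (\<lambda>u\<in>maps T B X. \<phi> (u \<cdot>\<^bsub>T\<^esub> f))"
      by (rule restrict_ext) (use o X in simp)
    moreover have "\<theta> A X \<phi> \<in> maps U (fo D A) (fo Q X)"
      using iso[of A X] A X \<phi> by (auto simp: iso_def hom_def simp del: T.maps_iff U.maps_iff)
    then have "Idt U (fo Q X) \<cdot>\<^bsub>U\<^esub> \<theta> A X \<phi> = \<theta> A X \<phi>" using Do[OF A] QX by simp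
    ultimately show "\<theta> B X (\<lambda>u\<in>maps T B X. \<phi> (u \<cdot>\<^bsub>T\<^esub> f)) = \<theta> A X \<phi> \<cdot>\<^bsub>U\<^esub> fm D f"
      using nat[of A B X X f "Idt T X" \<phi>] A B X f \<phi> QX by simp
  qed
qed

text \<open>Through \<theta>, Hom(D f, Q X) is the map that Hom(f, X) induces on character groups,
  and passing to characters exchanges surjective and injective. Going from \<open>f\<close> to
  characters, injective becomes surjective because \<rat>/\<int> is injective; both ways back use
  that characters separate elements.\<close>

lemma AGJ_hom_surj_inj:
  assumes T: "preadditive_category T" and U: "preadditive_category U"
    and agj: "AGJ_natural_iso \<UU> T U Q D" and Q: "is_functor (opp T) U Q" and D: "is_functor (Cpt \<UU> T) (opp (Cpt \<UU> U)) D"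
    and X: "X \<in> Obj T" and f: "f \<in> arrows (Cpt \<UU> T)"
  shows "preadditive_category.hom_surj T f X \<longleftrightarrow> preadditive_category.hom_inj U (fm D f) (fo Q X)" (is ?surj)
    and "preadditive_category.hom_inj T f X \<longleftrightarrow> preadditive_category.hom_surj U (fm D f) (fo Q X)" (is ?inj)
proof -
  interpret T: preadditive_category T by fact
  interpret U: preadditive_category U by fact
  interpret QZ: comm_group QmodZ by (rule comm_group_QmodZ)
  define A B where AB: "A = Dom T f" "B = Cod T f"
  have f': "f \<in> arrows T" "Dom T f = A" "Cod T f = B" and K: "compact_object \<UU> T A" "compact_object \<UU> T B"
    using f by (simp_all add: T.arrows_Cpt AB)
  have o: "A \<in> Obj T" "B \<in> Obj T" using K by (auto intro: compact_obj)
  have fm': "f \<in> maps T A B" using f' o by simp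
  have QX: "fo Q X \<in> Obj U" using functorD(1)[OF Q] X by auto
  have Do: "fo D C \<in> Obj U" if "compact_object \<UU> T C" for C
    using functorD(1)[OF D] that by (auto intro: compact_obj)
  have "fm D f \<in> maps U (fo D B) (fo D A)" using functorD(3)[OF D, of A B f] K fm' by simp
  then have Df: "fm D f \<in> arrows U" "Dom U (fm D f) = fo D B" "Cod U (fm D f) = fo D A" using Do K by auto
  obtain \<theta> where iso: "\<And>C. compact_object \<UU> T C \<Longrightarrow> \<theta> C \<in> iso (hom_group (Hom T C X) QmodZ) (Hom U (fo D C) (fo Q X))"
    and nat: "\<And>A B f \<phi>. \<lbrakk>compact_object \<UU> T A; compact_object \<UU> T B; f \<in> maps T A B; \<phi> \<in> carrier (hom_group (Hom T A X) QmodZ)\<rbrakk>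
          \<Longrightarrow> \<theta> B (\<lambda>u\<in>maps T B X. \<phi> (u \<cdot>\<^bsub>T\<^esub> f)) = \<theta> A \<phi> \<cdot>\<^bsub>U\<^esub> fm D f"
    using AGJ_precomp[OF T U agj Q D X] by metis
  let ?HA = "hom_group (Hom T A X) QmodZ" and ?HB = "hom_group (Hom T B X) QmodZ"
  have cg: "comm_group (Hom T A X)" "comm_group (Hom T B X)" using T.hom_group o X by auto
  have bij: "bij_betw (\<theta> C) (carrier (hom_group (Hom T C X) QmodZ)) (maps U (fo D C) (fo Q X))" if "compact_object \<UU> T C" for C
    using iso[OF that] by (simp add: iso_def)
  have th1: "\<theta> C \<one>\<^bsub>hom_group (Hom T C X) QmodZ\<^esub> = \<one>\<^bsub>Hom U (fo D C) (fo Q X)\<^esub>" if "compact_object \<UU> T C" for C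
    using iso[OF that] hom_one hom_group_one(2)[OF T.hom_group[OF compact_obj[OF that] X]] Do[OF that] QX
    unfolding iso_def by (metis (no_types, lifting) U.group_Hom mem_Collect_eq)
  have ph: "(\<lambda>u. u \<cdot>\<^bsub>T\<^esub> f) \<in> hom (Hom T B X) (Hom T A X)" by (rule T.precomp_hom[OF f' X])
  \<comment> \<open>The map induced on characters by precomposition with \<open>f\<close>.
    Naturality of \<theta> turns it into precomposition with \<open>fm D f\<close>.\<close>
  define pull where "pull \<phi> = (\<lambda>u\<in>maps T B X. \<phi> (u \<cdot>\<^bsub>T\<^esub> f))" for \<phi> :: "_ \<Rightarrow> rat set"
  have pull: "pull \<phi> \<in> carrier ?HB" "\<theta> B (pull \<phi>) = \<theta> A \<phi> \<cdot>\<^bsub>U\<^esub> fm D f" if p: "\<phi> \<in> carrier ?HA" for \<phi>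
  proof -
    have "\<phi> \<in> hom (Hom T A X) QmodZ" using p unfolding hom_group_def by simp
    from hom_compose[OF ph this] show "pull \<phi> \<in> carrier ?HB"
      unfolding pull_def using restrict_hom_group[OF cg(2)] by (simp add: o_def)
    show "\<theta> B (pull \<phi>) = \<theta> A \<phi> \<cdot>\<^bsub>U\<^esub> fm D f" unfolding pull_def by (rule nat[OF K fm' p])
  qed
  have one: "\<one>\<^bsub>hom_group (Hom T C X) QmodZ\<^esub> = (\<lambda>u\<in>maps T C X. \<one>\<^bsub>QmodZ\<^esub>)" for C by (simp add: hom_group_def)
  have imA: "maps U (fo D A) (fo Q X) = \<theta> A ` carrier ?HA" and imB: "maps U (fo D B) (fo Q X) = \<theta> B ` carrier ?HB"
    using bij_betw_imp_surj_on[OF bij] K by simp_all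
  have iA: "\<theta> A \<phi> = \<theta> A \<psi> \<longleftrightarrow> \<phi> = \<psi>" if "\<phi> \<in> carrier ?HA" "\<psi> \<in> carrier ?HA" for \<phi> \<psi>
    using bij[OF K(1)] that unfolding bij_betw_def inj_on_def by blast
  have iB: "\<theta> B \<phi> = \<theta> B \<psi> \<longleftrightarrow> \<phi> = \<psi>" if "\<phi> \<in> carrier ?HB" "\<psi> \<in> carrier ?HB" for \<phi> \<psi>
    using bij[OF K(2)] that unfolding bij_betw_def inj_on_def by blast
  have "U.hom_inj (fm D f) (fo Q X) \<longleftrightarrow> (\<forall>\<phi>\<in>carrier ?HA. \<theta> A \<phi> \<cdot>\<^bsub>U\<^esub> fm D f = \<one>\<^bsub>Hom U (fo D B) (fo Q X)\<^esub> \<longrightarrow> \<theta> A \<phi> = \<one>\<^bsub>Hom U (fo D A) (fo Q X)\<^esub>)"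
    by (simp only: U.hom_inj_def Df imA ball_simps)
  also have "\<dots> \<longleftrightarrow> (\<forall>\<phi>\<in>carrier ?HA. pull \<phi> = \<one>\<^bsub>?HB\<^esub> \<longrightarrow> \<phi> = \<one>\<^bsub>?HA\<^esub>)"
    by (rule ball_cong[OF refl])
      (simp only: pull(2)[symmetric] th1[OF K(1), symmetric] th1[OF K(2), symmetric] iA iB pull(1) hom_group_one(1) cg)
  finally have inj_iff: "U.hom_inj (fm D f) (fo Q X) \<longleftrightarrow> (\<forall>\<phi>\<in>carrier ?HA. pull \<phi> = \<one>\<^bsub>?HB\<^esub> \<longrightarrow> \<phi> = \<one>\<^bsub>?HA\<^esub>)" .
  have "U.hom_surj (fm D f) (fo Q X) \<longleftrightarrow> (\<forall>\<psi>\<in>carrier ?HB. \<exists>\<phi>\<in>carrier ?HA. \<theta> B \<psi> = \<theta> A \<phi> \<cdot>\<^bsub>U\<^esub> fm D f)"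
    by (simp only: U.hom_surj_def Df imA imB ball_simps bex_simps)
  also have "\<dots> \<longleftrightarrow> (\<forall>\<psi>\<in>carrier ?HB. \<exists>\<phi>\<in>carrier ?HA. \<psi> = pull \<phi>)"
    by (intro ball_cong bex_cong refl) (simp only: pull(2)[symmetric] iB pull(1))
  finally have surj_iff: "U.hom_surj (fm D f) (fo Q X) \<longleftrightarrow> (\<forall>\<psi>\<in>carrier ?HB. \<exists>\<phi>\<in>carrier ?HA. \<psi> = pull \<phi>)" .
  show ?surj
    unfolding inj_iff
  proof (intro iffI ballI impI)
    fix \<phi> assume s: "T.hom_surj f X" and p: "\<phi> \<in> carrier ?HA" "pull \<phi> = \<one>\<^bsub>?HB\<^esub>"
    have "\<phi> u = \<one>\<^bsub>QmodZ\<^esub>" if u: "u \<in> maps T A X" for u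
    proof -
      obtain v where v: "v \<in> maps T B X" "u = v \<cdot>\<^bsub>T\<^esub> f" using s u unfolding T.hom_surj_def f' by blast
      have "\<phi> u = pull \<phi> v" unfolding pull_def using v by (simp only: restrict_apply')
      also have "\<dots> = \<one>\<^bsub>QmodZ\<^esub>" unfolding p(2) one using v(1) by (simp only: restrict_apply')
      finally show ?thesis .
    qed
    moreover have "\<phi> \<in> extensional (maps T A X)" using p(1) by (simp add: hom_group_def)
    ultimately show "\<phi> = \<one>\<^bsub>?HA\<^esub>" unfolding one
      by (intro extensionalityI[of _ "maps T A X"]) (simp_all only: restrict_extensional restrict_apply')
  next
    assume i: "\<forall>\<phi>\<in>carrier ?HA. pull \<phi> = \<one>\<^bsub>?HB\<^esub> \<longrightarrow> \<phi> = \<one>\<^bsub>?HA\<^esub>"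
    have "(\<lambda>u. u \<cdot>\<^bsub>T\<^esub> f) ` maps T B X = maps T A X"
    proof (rule QmodZ_detects_surjective[OF cg(2,1) ph])
      \<comment> \<open>A character that is trivial on the image of Hom(f, X) lies in the kernel of
        \<open>pull\<close>, hence is trivial.\<close>
      fix \<psi> y assume psi: "\<psi> \<in> hom (Hom T A X) QmodZ" "\<And>x. x \<in> maps T B X \<Longrightarrow> \<psi> (x \<cdot>\<^bsub>T\<^esub> f) = \<one>\<^bsub>QmodZ\<^esub>" and y: "y \<in> maps T A X"
      have r: "restrict \<psi> (maps T A X) \<in> carrier ?HA"
        by (rule restrict_hom_group[OF cg(1) psi(1)])
      have "pull (restrict \<psi> (maps T A X)) = \<one>\<^bsub>?HB\<^esub>" unfolding pull_def one
        by (rule restrict_ext) (use psi(2) hom_in_carrier[OF ph] in \<open>simp only: restrict_apply'\<close>)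
      then have "restrict \<psi> (maps T A X) = \<one>\<^bsub>?HA\<^esub>" using i r by blast
      then show "\<psi> y = \<one>\<^bsub>QmodZ\<^esub>" unfolding one using y by (metis restrict_apply')
    qed
    then show "T.hom_surj f X" using T.hom_surj_iff[OF f'(1) X] f' by simp
  qed
  show ?inj
    unfolding surj_iff
  proof (intro iffI ballI)
    fix \<psi> assume i: "T.hom_inj f X" and p: "\<psi> \<in> carrier ?HB"
    \<comment> \<open>Characters of Hom(B, X) now extend along the embedding into Hom(A, X).\<close>
    have "inj_on (\<lambda>u. u \<cdot>\<^bsub>T\<^esub> f) (maps T B X)" using i T.hom_inj_iff[OF f'(1) X] f' by simp
    then obtain \<phi> where phi: "\<phi> \<in> hom (Hom T A X) QmodZ" "\<And>x. x \<in> maps T B X \<Longrightarrow> \<phi> (x \<cdot>\<^bsub>T\<^esub> f) = \<psi> x"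
      using hom_extends_along_mono[OF cg(2,1) comm_group_QmodZ divisible_QmodZ ph, of \<psi>] p
      unfolding hom_group_def by auto
    have r: "restrict \<phi> (maps T A X) \<in> carrier ?HA"
      by (rule restrict_hom_group[OF cg(1) phi(1)])
    moreover have "\<psi> = pull (restrict \<phi> (maps T A X))"
    proof (rule extensionalityI[of _ "maps T B X"])
      show "\<psi> \<in> extensional (maps T B X)" using p by (simp add: hom_group_def)
      show "pull (restrict \<phi> (maps T A X)) \<in> extensional (maps T B X)" unfolding pull_def by (rule restrict_extensional)
      fix x assume "x \<in> maps T B X"
      then show "\<psi> x = pull (restrict \<phi> (maps T A X)) x" unfolding pull_def
        using phi(2) hom_in_carrier[OF ph] by (simp only: restrict_apply')
    qed
    ultimately show "\<exists>\<phi>\<in>carrier ?HA. \<psi> = pull \<phi>" by blast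
  next
    assume s: "\<forall>\<psi>\<in>carrier ?HB. \<exists>\<phi>\<in>carrier ?HA. \<psi> = pull \<phi>"
    show "T.hom_inj f X" unfolding T.hom_inj_def f'
    proof (intro ballI impI, rule ccontr)
      fix v assume v: "v \<in> maps T B X" "v \<cdot>\<^bsub>T\<^esub> f = \<one>\<^bsub>Hom T A X\<^esub>" "v \<noteq> \<one>\<^bsub>Hom T B X\<^esub>"
      \<comment> \<open>A character that is nontrivial at \<open>v\<close> cannot be a pullback,
        because \<open>v\<close> becomes zero after composition with \<open>f\<close>.\<close>
      obtain \<psi> where psi: "\<psi> \<in> hom (Hom T B X) QmodZ" "\<psi> v \<noteq> \<one>\<^bsub>QmodZ\<^esub>"
        using QmodZ_separates[OF cg(2) v(1,3)] by blast
      have "restrict \<psi> (maps T B X) \<in> carrier ?HB"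
        by (rule restrict_hom_group[OF cg(2) psi(1)])
      then obtain \<phi> where phi: "\<phi> \<in> carrier ?HA" "restrict \<psi> (maps T B X) = pull \<phi>" using s by blast
      have "\<psi> v = pull \<phi> v" using v(1) phi(2) by (metis restrict_apply')
      also have "\<dots> = \<phi> \<one>\<^bsub>Hom T A X\<^esub>" unfolding pull_def using v by (simp only: restrict_apply')
      also have "\<dots> = \<one>\<^bsub>QmodZ\<^esub>"
        using hom_one[of \<phi> "Hom T A X" QmodZ] phi(1) cg(1) QZ.is_group by (simp add: hom_group_def comm_group.axioms(2))
      finally show False using psi(2) by blast
    qed
  qed
qed

section \<open>The dual definable category\<close>

text \<open>\<open>Q\<close> reverses a triangle: the outer terms trade places and the middle one
  stays.\<close>

lemma extension_closed_transfer:
  assumes Q: "exact_contravariant T U Q"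
    and tri: "\<And>X Y Z f g h. Tri T X Y Z f g h \<Longrightarrow> X \<in> Obj T \<and> Y \<in> Obj T \<and> Z \<in> Obj T"
    and DE: "\<And>X. X \<in> Obj T \<Longrightarrow> X \<in> \<D> \<longleftrightarrow> fo Q X \<in> \<E>"
    and ext: "extension_closed U \<E>"
  shows "extension_closed T \<D>"
  unfolding extension_closed_def
proof (intro allI impI)
  fix X Y Z f g h assume a: "Tri T X Y Z f g h \<and> X \<in> \<D> \<and> Z \<in> \<D>"
  obtain \<phi> where "Tri U (fo Q Z) (fo Q Y) (fo Q X) (fm Q g) (fm Q f) (susm U (fm Q h) \<cdot>\<^bsub>U\<^esub> \<phi> X)"
    using Q a unfolding exact_contravariant_def by blast
  then show "Y \<in> \<D>" using ext a DE tri unfolding extension_closed_def by blast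
qed

text \<open>Reversing triangles exchanges two of the closure conditions and keeps the third.
  Suspensions are compared through \<phi>, which is only an isomorphism; this is the purpose of
  \<open>iso\<close>.\<close>

lemma triangulated_subcategory_transfer:
  assumes T: "triangulated_category T" and U: "triangulated_category U"
    and Q: "exact_contravariant T U Q"
    and sub: "\<D> \<subseteq> Obj T" and DE: "\<And>X. X \<in> Obj T \<Longrightarrow> X \<in> \<D> \<longleftrightarrow> fo Q X \<in> \<E>"
    and iso: "\<And>Y Y' a. \<lbrakk>is_iso U Y Y' a; Y \<in> Obj U; Y' \<in> Obj U; Y \<in> \<E>\<rbrakk> \<Longrightarrow> Y' \<in> \<E>"
    and zero: "\<And>Z. zero_object T Z \<Longrightarrow> Z \<in> \<D>"
    and tr: "triangulated_subcategory U \<E>"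
  shows "triangulated_subcategory T \<D>"
proof -
  interpret T: triangulated_category T by fact
  interpret U: triangulated_category U by fact
  obtain \<phi> where phi: "is_nat_iso (opp T) U Q (Sus U \<circ>\<^sub>F Q \<circ>\<^sub>F Sus T) \<phi>"
    and Qt: "\<And>X Y Z f g h. Tri T X Y Z f g h \<Longrightarrow>
           Tri U (fo Q Z) (fo Q Y) (fo Q X) (fm Q g) (fm Q f) (susm U (fm Q h) \<cdot>\<^bsub>U\<^esub> \<phi> X)"
    using Q unfolding exact_contravariant_def by blast
  have Qo: "fo Q X \<in> Obj U" if "X \<in> Obj T" for X
    using Q functorD(1)[of "opp T" U Q X] that unfolding exact_contravariant_def additive_functor_def by simp
  have tU: "\<And>X Y Z f g h. Tri U X Y Z f g h \<Longrightarrow>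
        (X \<in> \<E> \<and> Y \<in> \<E> \<longrightarrow> Z \<in> \<E>) \<and> (Y \<in> \<E> \<and> Z \<in> \<E> \<longrightarrow> X \<in> \<E>) \<and> (X \<in> \<E> \<and> Z \<in> \<E> \<longrightarrow> Y \<in> \<E>)"
    and sU: "\<And>X. X \<in> Obj U \<Longrightarrow> sus U X \<in> \<E> \<longleftrightarrow> X \<in> \<E>"
    using tr unfolding triangulated_subcategory_def by blast+
  show ?thesis unfolding triangulated_subcategory_def
  proof (intro conjI ballI allI impI sub)
    show "\<exists>Z\<in>\<D>. zero_object T Z" using T.ex_zero zero by blast
    fix X assume X: "X \<in> Obj T"
    let ?Y = "sus U (fo Q (sus T X))"
    have o: "fo Q (sus T X) \<in> Obj U" "fo Q X \<in> Obj U" "?Y \<in> Obj U" using X Qo by auto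
    \<comment> \<open>\<E> contains Q (\<Sigma> X) iff it contains the suspension of that object,
      and by \<phi> iff it contains Q X.\<close>
    have i: "is_iso U (fo Q X) ?Y (\<phi> X)" using nat_isoD(1)[OF phi, of X] X by simp
    have "is_iso U ?Y (fo Q X) (SOME g. is_iso U ?Y (fo Q X) g)"
    proof (rule someI_ex)
      obtain g where "\<phi> X \<in> maps U (fo Q X) ?Y" "g \<in> maps U ?Y (fo Q X)"
        "g \<cdot>\<^bsub>U\<^esub> \<phi> X = Idt U (fo Q X)" "\<phi> X \<cdot>\<^bsub>U\<^esub> g = Idt U ?Y"
        using i unfolding is_iso_def by blast
      then show "\<exists>g. is_iso U ?Y (fo Q X) g" unfolding is_iso_def by blast
    qed
    then have "fo Q X \<in> \<E> \<longleftrightarrow> ?Y \<in> \<E>" using iso i o by blast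
    then show "sus T X \<in> \<D> \<longleftrightarrow> X \<in> \<D>" using DE X sU[OF o(1)] by simp
  next
    fix X Y Z f g h assume t: "Tri T X Y Z f g h"
    note D = DE[OF T.triD(1)[OF t]] DE[OF T.triD(2)[OF t]] DE[OF T.triD(3)[OF t]] and E = tU[OF Qt[OF t]]
    show "X \<in> \<D> \<and> Y \<in> \<D> \<Longrightarrow> Z \<in> \<D>" "Y \<in> \<D> \<and> Z \<in> \<D> \<Longrightarrow> X \<in> \<D>" "X \<in> \<D> \<and> Z \<in> \<D> \<Longrightarrow> Y \<in> \<D>"
      using D E by blast+
  qed
qed

section \<open>Groups of natural maps into Hom(W, -)\<close>

lemma (in preadditive_category) nat_group_corep:
  assumes "\<eta> \<in> carrier (nat_group C G (corep C W))"
  shows "X \<in> Obj C \<Longrightarrow> \<eta> X \<in> hom (ao G X) (Hom C W X)"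
    "\<lbrakk>X \<in> Obj C; x \<in> carrier (ao G X)\<rbrakk> \<Longrightarrow> \<eta> X x \<in> maps C W X"
    "\<lbrakk>X \<in> Obj C; Y \<in> Obj C; g \<in> maps C X Y; x \<in> carrier (ao G X)\<rbrakk> \<Longrightarrow> \<eta> Y (am G g x) = g \<cdot> \<eta> X x"
  using assms hom_in_carrier[of "\<eta> X" "ao G X" "Hom C W X"]
  unfolding nat_group_def is_ab_nat_def by (simp_all add: corep_def del: maps_iff)

text \<open>The two closure facts behind \<open>ab_closed\<close> for \<open>delta\<close>: addition
  of natural maps, and the action of an arrow by composition on the right.\<close>

lemma (in preadditive_category) nat_group_corep_closed:
  assumes G: "is_ab_functor C G" and W: "W \<in> Obj C"
    and eta: "\<eta> \<in> carrier (nat_group C G (corep C W))"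
  shows "\<theta> \<in> carrier (nat_group C G (corep C W)) \<Longrightarrow> \<eta> \<otimes>\<^bsub>nat_group C G (corep C W)\<^esub> \<theta> \<in> carrier (nat_group C G (corep C W))"
    and "\<lbrakk>w \<in> maps C V W; V \<in> Obj C\<rbrakk> \<Longrightarrow> (\<lambda>X\<in>Obj C. \<lambda>x\<in>carrier (ao G X). \<eta> X x \<cdot> w) \<in> carrier (nat_group C G (corep C V))"
proof -
  note e = nat_group_corep[OF eta]
  have m: "x \<otimes>\<^bsub>ao G X\<^esub> y \<in> carrier (ao G X)" if "X \<in> Obj C" "x \<in> carrier (ao G X)" "y \<in> carrier (ao G X)" for X x y
    using ab_functor_closed[OF G] that unfolding ab_closed_def by blast
  have a: "am G g x \<in> carrier (ao G Y)" if "X \<in> Obj C" "Y \<in> Obj C" "g \<in> maps C X Y" "x \<in> carrier (ao G X)" for X Y g x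
    using ab_functorD(3)[OF G that] .
  \<comment> \<open>Elements of \<open>nat_group\<close> are restricted functions. This reduces
    membership to conditions on the unrestricted values and serves both claims.\<close>
  have mk: "\<rho> \<in> carrier (nat_group C G (corep C V))"
    if r: "\<rho> = (\<lambda>X\<in>Obj C. \<lambda>x\<in>carrier (ao G X). \<rho>' X x)"
      and c: "\<And>X x. \<lbrakk>X \<in> Obj C; x \<in> carrier (ao G X)\<rbrakk> \<Longrightarrow> \<rho>' X x \<in> maps C V X"
      and h: "\<And>X x y. \<lbrakk>X \<in> Obj C; x \<in> carrier (ao G X); y \<in> carrier (ao G X)\<rbrakk> \<Longrightarrow> \<rho>' X (x \<otimes>\<^bsub>ao G X\<^esub> y) = \<rho>' X x \<otimes>\<^bsub>Hom C V X\<^esub> \<rho>' X y"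
      and n: "\<And>X Y g x. \<lbrakk>X \<in> Obj C; Y \<in> Obj C; g \<in> maps C X Y; x \<in> carrier (ao G X)\<rbrakk> \<Longrightarrow> \<rho>' Y (am G g x) = g \<cdot> \<rho>' X x"
    for \<rho> \<rho>' V
  proof -
    have v: "\<rho> X x = \<rho>' X x" if "X \<in> Obj C" "x \<in> carrier (ao G X)" for X x using that by (simp add: r)
    have "is_ab_nat C G (corep C V) \<rho>" unfolding is_ab_nat_def
    proof (intro conjI ballI homI)
      fix X x y assume X: "X \<in> Obj C" "x \<in> carrier (ao G X)"
      show "\<rho> X x \<in> carrier (ao (corep C V) X)" unfolding v[OF X] using c[OF X] by (simp add: corep_def del: maps_iff)
      assume y: "y \<in> carrier (ao G X)"
      show "\<rho> X (x \<otimes>\<^bsub>ao G X\<^esub> y) = \<rho> X x \<otimes>\<^bsub>ao (corep C V) X\<^esub> \<rho> X y"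
        unfolding v[OF X] v[OF X(1) y] v[OF X(1) m[OF X y]] using h[OF X y] by (simp add: corep_def)
    next
      fix X Y g x assume o: "X \<in> Obj C" "Y \<in> Obj C" "g \<in> maps C X Y" "x \<in> carrier (ao G X)"
      show "\<rho> Y (am G g x) = am (corep C V) g (\<rho> X x)"
        unfolding v[OF o(1,4)] v[OF o(2) a[OF o]] using n[OF o] by (simp add: corep_def)
    qed
    then show ?thesis unfolding nat_group_def by (simp add: r)
  qed
  have e': "\<eta> X x \<in> arrows C" "Dom C (\<eta> X x) = W" "Cod C (\<eta> X x) = X" if "X \<in> Obj C" "x \<in> carrier (ao G X)" for X x
    using e(2)[OF that] W that(1) by auto
  show "(\<lambda>X\<in>Obj C. \<lambda>x\<in>carrier (ao G X). \<eta> X x \<cdot> w) \<in> carrier (nat_group C G (corep C V))"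
    if w: "w \<in> maps C V W" "V \<in> Obj C"
  proof (rule mk[OF refl])
    have w': "w \<in> arrows C" "Dom C w = V" "Cod C w = W" using w W by auto
    show "\<eta> X x \<cdot> w \<in> maps C V X" if "X \<in> Obj C" "x \<in> carrier (ao G X)" for X x
      using e'[OF that] w' w that by simp
    show "\<eta> X (x \<otimes>\<^bsub>ao G X\<^esub> y) \<cdot> w = (\<eta> X x \<cdot> w) \<otimes>\<^bsub>Hom C V X\<^esub> (\<eta> X y \<cdot> w)"
      if "X \<in> Obj C" "x \<in> carrier (ao G X)" "y \<in> carrier (ao G X)" for X x y
      using hom_mult[OF e(1)[OF that(1)] that(2,3)] e'[OF that(1,2)] e'[OF that(1,3)] w' by (simp add: comp_distrib)
    show "\<eta> Y (am G g x) \<cdot> w = g \<cdot> (\<eta> X x \<cdot> w)"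
      if "X \<in> Obj C" "Y \<in> Obj C" "g \<in> maps C X Y" "x \<in> carrier (ao G X)" for X Y g x
      using e(3)[OF that] e'[OF that(1,4)] w' that(1-3) by (simp add: assoc)
  qed
  assume "\<theta> \<in> carrier (nat_group C G (corep C W))"
  note t = nat_group_corep[OF this]
  have t': "\<theta> X x \<in> arrows C" "Dom C (\<theta> X x) = W" "Cod C (\<theta> X x) = X" if "X \<in> Obj C" "x \<in> carrier (ao G X)" for X x
    using t(2)[OF that] W that(1) by auto
  have mu: "\<eta> \<otimes>\<^bsub>nat_group C G (corep C W)\<^esub> \<theta> = (\<lambda>X\<in>Obj C. \<lambda>x\<in>carrier (ao G X). \<eta> X x \<otimes>\<^bsub>Hom C W X\<^esub> \<theta> X x)"
    by (simp add: nat_group_def corep_def)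
  show "\<eta> \<otimes>\<^bsub>nat_group C G (corep C W)\<^esub> \<theta> \<in> carrier (nat_group C G (corep C W))"
  proof (rule mk[OF mu])
    show "\<eta> X x \<otimes>\<^bsub>Hom C W X\<^esub> \<theta> X x \<in> maps C W X" if "X \<in> Obj C" "x \<in> carrier (ao G X)" for X x
      using e'[OF that] t'[OF that] W that(1) by simp
    show "\<eta> X (x \<otimes>\<^bsub>ao G X\<^esub> y) \<otimes>\<^bsub>Hom C W X\<^esub> \<theta> X (x \<otimes>\<^bsub>ao G X\<^esub> y) = (\<eta> X x \<otimes>\<^bsub>Hom C W X\<^esub> \<theta> X x) \<otimes>\<^bsub>Hom C W X\<^esub> (\<eta> X y \<otimes>\<^bsub>Hom C W X\<^esub> \<theta> X y)"
      if x: "X \<in> Obj C" "x \<in> carrier (ao G X)" "y \<in> carrier (ao G X)" for X x y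
    proof -
      interpret H: comm_group "Hom C W X" using hom_group[OF W x(1)] .
      show ?thesis
        using hom_mult[OF e(1)[OF x(1)] x(2,3)] hom_mult[OF t(1)[OF x(1)] x(2,3)]
          e(2)[OF x(1,2)] e(2)[OF x(1,3)] t(2)[OF x(1,2)] t(2)[OF x(1,3)]
        by (simp add: H.m_ac del: maps_iff)
    qed
    show "\<eta> Y (am G g x) \<otimes>\<^bsub>Hom C W Y\<^esub> \<theta> Y (am G g x) = g \<cdot> (\<eta> X x \<otimes>\<^bsub>Hom C W X\<^esub> \<theta> X x)"
      if "X \<in> Obj C" "Y \<in> Obj C" "g \<in> maps C X Y" "x \<in> carrier (ao G X)" for X Y g x
      using e(3)[OF that] t(3)[OF that] e'[OF that(1,4)] t'[OF that(1,4)] that(1-3) by (simp add: comp_distrib2)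
  qed
qed

section \<open>Additivity, faithfulness and fullness of D\<close>

locale AGJ_duality =
  fixes \<UU> :: "'u itself" and T :: "('o, 'm) tcat" and U :: "('p, 'n) tcat"
    and Q :: "('o, 'm, 'p, 'n) ftor" and Q' :: "('p, 'n, 'o, 'm) ftor"
    and D :: "('o, 'm, 'p, 'n) ftor" and D' :: "('p, 'n, 'o, 'm) ftor"
  assumes triple: "AGJ_duality_triple \<UU> T U Q Q' D D'"
begin

sublocale T: triangulated_category T
  using triple unfolding AGJ_duality_triple_def duality_triple_def compactly_generated_def by blast

sublocale U: triangulated_category U
  using triple unfolding AGJ_duality_triple_def duality_triple_def compactly_generated_def by blast

lemma Q_exact: "exact_contravariant T U Q" "exact_contravariant U T Q'"
  using triple unfolding AGJ_duality_triple_def duality_triple_def by blast+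

lemma Q_functor: "is_functor (opp T) U Q" "is_functor (opp U) T Q'"
  using Q_exact unfolding exact_contravariant_def additive_functor_def by blast+

lemma Q_obj: "X \<in> Obj T \<Longrightarrow> fo Q X \<in> Obj U" "Y \<in> Obj U \<Longrightarrow> fo Q' Y \<in> Obj T"
  using functorD(1)[OF Q_functor(1)] functorD(1)[OF Q_functor(2)] by auto

lemma theta: "AGJ_natural_iso \<UU> T U Q D" "AGJ_natural_iso \<UU> U T Q' D'"
  using triple unfolding AGJ_duality_triple_def by blast+

lemma D_equivalence: "adjoint_equivalence (Cpt \<UU> T) (opp (Cpt \<UU> U)) D D'"
  using triple unfolding AGJ_duality_triple_def by blast

lemma D_functor: "is_functor (Cpt \<UU> T) (opp (Cpt \<UU> U)) D" "is_functor (opp (Cpt \<UU> U)) (Cpt \<UU> T) D'"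
  using D_equivalence unfolding adjoint_equivalence_def by blast+

text \<open>With this reading of \<open>D'\<close>, what was proved for \<open>D\<close> over
  \<open>T\<close> applies to \<open>D'\<close> over \<open>U\<close>.\<close>

lemma D'_functor: "is_functor (Cpt \<UU> U) (opp (Cpt \<UU> T)) D'"
  using D_functor(2) unfolding is_functor_def by simp

abbreviation "cT \<equiv> compact_object \<UU> T"
abbreviation "cU \<equiv> compact_object \<UU> U"

lemma compact_objs: "cT A \<Longrightarrow> A \<in> Obj T" "cU B \<Longrightarrow> B \<in> Obj U"
  by (simp_all add: compact_obj)

lemma D_obj: "cT A \<Longrightarrow> cU (fo D A)" "cU B \<Longrightarrow> cT (fo D' B)"
  using functorD(1)[OF D_functor(1)] functorD(1)[OF D_functor(2)] by auto

lemma D_maps: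
  assumes "cT A" "cT B" "f \<in> maps T A B"
  shows "fm D f \<in> arrows U" "Dom U (fm D f) = fo D B" "Cod U (fm D f) = fo D A"
proof -
  have "fm D f \<in> maps U (fo D B) (fo D A)" using functorD(3)[OF D_functor(1), of A B f] assms by simp
  from U.mapsD[OF this compact_obj compact_obj] D_obj assms
  show "fm D f \<in> arrows U" "Dom U (fm D f) = fo D B" "Cod U (fm D f) = fo D A" by blast+
qed

lemma D'_maps:
  assumes "cU A" "cU B" "f \<in> maps U A B"
  shows "fm D' f \<in> arrows T" "Dom T (fm D' f) = fo D' B" "Cod T (fm D' f) = fo D' A"
proof -
  have "fm D' f \<in> maps T (fo D' B) (fo D' A)" using functorD(3)[OF D_functor(2), of B A f] assms by simp
  from T.mapsD[OF this compact_obj compact_obj] D_obj assms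
  show "fm D' f \<in> arrows T" "Dom T (fm D' f) = fo D' B" "Cod T (fm D' f) = fo D' A" by blast+
qed

lemma D_comp:
  assumes "cT A" "cT B" "cT C" "f \<in> maps T A B" "g \<in> maps T B C"
  shows "fm D (g \<cdot>\<^bsub>T\<^esub> f) = fm D f \<cdot>\<^bsub>U\<^esub> fm D g"
  using functorD(4)[OF D_functor(1), of A B C f g] assms by simp

text \<open>Additivity of \<open>D\<close> is not assumed: it comes from additivity of the maps \<open>\<theta>\<close>, since arrows into
  \<open>D A\<close> are detected by the pure monomorphism \<open>D A \<rightarrow> Q (Q' (D A))\<close>.\<close>

lemma D_add:
  assumes A: "cT A" and B: "cT B" and fg: "f \<in> maps T A B" "g \<in> maps T A B"
  shows "fm D (f \<otimes>\<^bsub>Hom T A B\<^esub> g) = fm D f \<otimes>\<^bsub>Hom U (fo D B) (fo D A)\<^esub> fm D g"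
proof -
  have o: "A \<in> Obj T" "B \<in> Obj T" "fo D A \<in> Obj U" "fo D B \<in> Obj U" using A B D_obj compact_objs by auto
  have s: "f \<otimes>\<^bsub>Hom T A B\<^esub> g \<in> maps T A B" using fg o by simp
  note Df = D_maps[OF A B fg(1)] and Dg = D_maps[OF A B fg(2)] and Ds = D_maps[OF A B s]
  \<comment> \<open>Additivity is first checked after composition with an arrow \<open>v\<close>
    into some Q X. There \<open>v\<close> is the image of a character \<phi> under \<theta>, and
    both \<phi> and \<open>\<theta> B\<close> are additive.\<close>
  have eq: "v \<cdot>\<^bsub>U\<^esub> fm D (f \<otimes>\<^bsub>Hom T A B\<^esub> g) = v \<cdot>\<^bsub>U\<^esub> (fm D f \<otimes>\<^bsub>Hom U (fo D B) (fo D A)\<^esub> fm D g)"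
    if X: "X \<in> Obj T" and v: "v \<in> maps U (fo D A) (fo Q X)" for X v
  proof -
    obtain \<theta> where iso: "\<And>C. cT C \<Longrightarrow> \<theta> C \<in> iso (hom_group (Hom T C X) QmodZ) (Hom U (fo D C) (fo Q X))"
      and nat: "\<And>A B f \<phi>. \<lbrakk>cT A; cT B; f \<in> maps T A B; \<phi> \<in> carrier (hom_group (Hom T A X) QmodZ)\<rbrakk>
          \<Longrightarrow> \<theta> B (\<lambda>u\<in>maps T B X. \<phi> (u \<cdot>\<^bsub>T\<^esub> f)) = \<theta> A \<phi> \<cdot>\<^bsub>U\<^esub> fm D f"
      using AGJ_precomp[OF T.preadditive_category_axioms U.preadditive_category_axioms theta(1) Q_functor(1) D_functor(1) X] by metis
    let ?HA = "hom_group (Hom T A X) QmodZ" and ?HB = "hom_group (Hom T B X) QmodZ"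
    have "bij_betw (\<theta> A) (carrier ?HA) (maps U (fo D A) (fo Q X))" using iso[OF A] by (simp add: iso_def)
    then obtain \<phi> where phi: "\<phi> \<in> carrier ?HA" "v = \<theta> A \<phi>" using v unfolding bij_betw_def by blast
    have ph: "\<phi> \<in> hom (Hom T A X) QmodZ" using phi(1) by (simp add: hom_group_def)
    define p where "p k = (\<lambda>u\<in>maps T B X. \<phi> (u \<cdot>\<^bsub>T\<^esub> k))" for k
    have pc: "p k \<in> carrier ?HB" if k: "k \<in> maps T A B" for k
    proof -
      have "(\<lambda>u. u \<cdot>\<^bsub>T\<^esub> k) \<in> hom (Hom T B X) (Hom T A X)"
        by (rule T.precomp_hom) (use k o X in auto)
      from hom_compose[OF this ph] show ?thesis
        unfolding p_def using restrict_hom_group[OF T.hom_group[OF o(2) X]] by (simp add: o_def)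
    qed
    have thB: "\<theta> B \<in> hom ?HB (Hom U (fo D B) (fo Q X))" using iso[OF B] by (simp add: iso_def)
    have "p (f \<otimes>\<^bsub>Hom T A B\<^esub> g) = p f \<otimes>\<^bsub>?HB\<^esub> p g"
    proof -
      have "\<phi> (u \<cdot>\<^bsub>T\<^esub> (f \<otimes>\<^bsub>Hom T A B\<^esub> g)) = \<phi> (u \<cdot>\<^bsub>T\<^esub> f) \<otimes>\<^bsub>QmodZ\<^esub> \<phi> (u \<cdot>\<^bsub>T\<^esub> g)" if u: "u \<in> maps T B X" for u
      proof -
        have "u \<cdot>\<^bsub>T\<^esub> (f \<otimes>\<^bsub>Hom T A B\<^esub> g) = (u \<cdot>\<^bsub>T\<^esub> f) \<otimes>\<^bsub>Hom T A X\<^esub> (u \<cdot>\<^bsub>T\<^esub> g)"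
          by (rule T.comp_distrib2) (use u fg o X in auto)
        moreover have "u \<cdot>\<^bsub>T\<^esub> f \<in> maps T A X" "u \<cdot>\<^bsub>T\<^esub> g \<in> maps T A X" using u fg o X by auto
        ultimately show ?thesis using hom_mult[OF ph] by simp
      qed
      then show ?thesis unfolding p_def hom_group_def
        by (auto simp: fun_eq_iff simp del: T.maps_iff)
    qed
    then have "\<theta> B (p (f \<otimes>\<^bsub>Hom T A B\<^esub> g)) = \<theta> B (p f) \<otimes>\<^bsub>Hom U (fo D B) (fo Q X)\<^esub> \<theta> B (p g)"
      using hom_mult[OF thB pc[OF fg(1)] pc[OF fg(2)]] by simp
    then have "v \<cdot>\<^bsub>U\<^esub> fm D (f \<otimes>\<^bsub>Hom T A B\<^esub> g) = (v \<cdot>\<^bsub>U\<^esub> fm D f) \<otimes>\<^bsub>Hom U (fo D B) (fo Q X)\<^esub> (v \<cdot>\<^bsub>U\<^esub> fm D g)"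
      unfolding p_def nat[OF A B s phi(1)] nat[OF A B fg(1) phi(1)] nat[OF A B fg(2) phi(1)] phi(2) .
    then show ?thesis using v Df Dg o Q_obj(1)[OF X] by (simp add: U.comp_distrib2)
  qed
  obtain j where jp: "\<forall>Y\<in>Obj U. pure_mono \<UU> U Y (fo Q (fo Q' Y)) (j Y)"
    using triple unfolding AGJ_duality_triple_def duality_triple_def by blast
  let ?DA = "fo D A" and ?X = "fo Q' (fo D A)"
  have Xo: "?X \<in> Obj T" "fo Q ?X \<in> Obj U" using Q_obj o by auto
  obtain Z g' h' where tri: "Tri U ?DA (fo Q ?X) Z (j ?DA) g' h'"
    and se: "short_exact (opp (Cpt \<UU> U)) (yon U ?DA) (yon U (fo Q ?X)) (yon U Z) (yon_map U (j ?DA)) (yon_map U g')"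
    using jp o unfolding pure_mono_def by blast
  have j: "j ?DA \<in> maps U ?DA (fo Q ?X)" using U.tri_closed[OF tri] by blast
  \<comment> \<open>Purity makes composition with \<open>j\<close> injective on arrows out of
    compact objects, and \<open>fo D B\<close> is compact.\<close>
  have inj: "inj_on (\<lambda>u. j ?DA \<cdot>\<^bsub>U\<^esub> u) (maps U (fo D B) ?DA)"
    using se D_obj(1)[OF B] unfolding short_exact_def by (simp add: yon_def yon_map_def)
  have "fm D f \<otimes>\<^bsub>Hom U (fo D B) ?DA\<^esub> fm D g \<in> maps U (fo D B) ?DA" using Df Dg o by simp
  moreover have "fm D (f \<otimes>\<^bsub>Hom T A B\<^esub> g) \<in> maps U (fo D B) ?DA" using Ds o by simp
  ultimately show ?thesis using eq[OF Xo(1) j] inj unfolding inj_on_def by blast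
qed

lemma D_zero:
  assumes A: "cT A" and B: "cT B"
  shows "fm D \<one>\<^bsub>Hom T A B\<^esub> = \<one>\<^bsub>Hom U (fo D B) (fo D A)\<^esub>"
proof -
  have o: "A \<in> Obj T" "B \<in> Obj T" "fo D A \<in> Obj U" "fo D B \<in> Obj U" using A B D_obj compact_objs by auto
  have "fm D \<in> hom (Hom T A B) (Hom U (fo D B) (fo D A))"
    by (rule homI) (use D_add[OF A B] D_maps[OF A B] o in auto)
  then show ?thesis using hom_one o by (metis T.group_Hom U.group_Hom)
qed

text \<open>The counit is inverted so that both families start at the identity. Read in
  \<open>U\<close> rather than in its opposite, \<kappa> consists of arrows D D' Y -> Y.\<close>

lemma D_units:
  obtains \<eta> \<kappa> where "is_nat_iso (Cpt \<UU> T) (Cpt \<UU> T) id_ftor (D' \<circ>\<^sub>F D) \<eta>"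
    and "is_nat_iso (opp (Cpt \<UU> U)) (opp (Cpt \<UU> U)) id_ftor (D \<circ>\<^sub>F D') \<kappa>"
proof -
  obtain \<eta> \<epsilon> where e: "is_nat_iso (Cpt \<UU> T) (Cpt \<UU> T) id_ftor (D' \<circ>\<^sub>F D) \<eta>"
    "is_nat_iso (opp (Cpt \<UU> U)) (opp (Cpt \<UU> U)) (D \<circ>\<^sub>F D') id_ftor \<epsilon>"
    using D_equivalence unfolding adjoint_equivalence_def by blast
  have p: "preadditive_category (opp (Cpt \<UU> U))"
    by (rule preadditive_category.preadditive_opp[OF U.preadditive_Cpt])
  show thesis
    using nat_iso_inverse[OF p p functor_comp[OF D_functor(2,1)] functor_id e(2)] e(1) that by blast
qed

lemma D_faithful:
  assumes "cT A" "cT B" "f \<in> maps T A B" "g \<in> maps T A B" "fm D f = fm D g"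
  shows "f = g"
proof -
  obtain \<eta> where e: "is_nat_iso (Cpt \<UU> T) (Cpt \<UU> T) id_ftor (D' \<circ>\<^sub>F D) \<eta>" using D_units by blast
  show ?thesis
    by (rule faithful_of_nat_iso[OF T.preadditive_Cpt D_functor e, of A B]) (use assms in simp_all)
qed

lemma D_full:
  assumes "cT A" "cT B" "h \<in> maps U (fo D B) (fo D A)"
  obtains k where "k \<in> maps T A B" "fm D k = h"
proof -
  obtain \<eta> \<kappa> where e: "is_nat_iso (Cpt \<UU> T) (Cpt \<UU> T) id_ftor (D' \<circ>\<^sub>F D) \<eta>"
    "is_nat_iso (opp (Cpt \<UU> U)) (opp (Cpt \<UU> U)) id_ftor (D \<circ>\<^sub>F D') \<kappa>" using D_units by blast
  have p: "preadditive_category (opp (Cpt \<UU> U))"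
    by (rule preadditive_category.preadditive_opp[OF U.preadditive_Cpt])
  show thesis
    by (rule full_of_nat_iso[OF T.preadditive_Cpt p D_functor e, of A B h]) (use assms that in simp_all)
qed

section \<open>The functor delta as a kernel, and its presentation\<close>

lemma D_comp_zero_iff:
  assumes c: "cT W" "cT A" "cT B" and u: "u \<in> maps T W A" and f: "f \<in> maps T A B"
  shows "f \<cdot>\<^bsub>T\<^esub> u = \<one>\<^bsub>Hom T W B\<^esub> \<longleftrightarrow> fm D u \<cdot>\<^bsub>U\<^esub> fm D f = \<one>\<^bsub>Hom U (fo D B) (fo D W)\<^esub>"
proof -
  have o: "W \<in> Obj T" "A \<in> Obj T" "B \<in> Obj T" using c compact_objs by auto
  have m: "f \<cdot>\<^bsub>T\<^esub> u \<in> maps T W B" "\<one>\<^bsub>Hom T W B\<^esub> \<in> maps T W B" using u f o by auto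
  have "f \<cdot>\<^bsub>T\<^esub> u = \<one>\<^bsub>Hom T W B\<^esub> \<longleftrightarrow> fm D (f \<cdot>\<^bsub>T\<^esub> u) = fm D \<one>\<^bsub>Hom T W B\<^esub>"
    by (rule iffI, simp only:) (rule D_faithful[OF c(1,3) m])
  then show ?thesis using D_comp[OF c u f] D_zero[OF c(1,3)] by simp
qed

text \<open>Evaluation at the generator \<gamma> identifies the value of \<delta> G at
  \<open>Y\<close> with the arrows u: D' Y -> A killed by \<open>f\<close>. Applying
  \<open>D\<close> and composing with \<kappa> turns these into the arrows v: D A -> Y whose
  composite with \<open>D f\<close> is zero.\<close>

lemma delta_iso_kernel:
  assumes f: "presents \<UU> T f G" and G: "is_ab_functor (Cpt \<UU> T) G"
  shows "ab_isomorphic (Cpt \<UU> U) (delta \<UU> T D' G) (U.hom_kernel (fm D f))"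
proof -
  interpret CT: preadditive_category "Cpt \<UU> T" by (rule T.preadditive_Cpt)
  define A B where AB: "A = Dom T f" "B = Cod T f"
  have fa: "f \<in> arrows (Cpt \<UU> T)" using f unfolding presents_def by blast
  then have f': "f \<in> arrows T" "Dom T f = A" "Cod T f = B" and c: "cT A" "cT B"
    by (simp_all add: T.arrows_Cpt AB)
  have o: "A \<in> Obj T" "B \<in> Obj T" using c compact_objs by auto
  have fm': "f \<in> maps T A B" using f' o by simp
  note Df = D_maps[OF c fm']
  have DAB: "fo D A \<in> Obj U" "fo D B \<in> Obj U" using D_obj c compact_objs by auto
  have "ab_isomorphic (Cpt \<UU> T) G (coker (Cpt \<UU> T) f)" using f unfolding presents_def coker_Cpt by blast
  from CT.nat_group_corep_bij[OF fa G this, unfolded Cpt_sel corep_Cpt f']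
  obtain \<gamma> where g: "\<gamma> \<in> carrier (ao G A)"
    and bij: "\<And>W. W \<in> {C. cT C} \<Longrightarrow> bij_betw (\<lambda>\<eta>. \<eta> A \<gamma>) (carrier (nat_group (Cpt \<UU> T) G (corep T W)))
           {u \<in> maps T W A. f \<cdot>\<^bsub>T\<^esub> u = \<one>\<^bsub>Hom T W B\<^esub>}" by blast
  obtain \<kappa> where kap: "is_nat_iso (opp (Cpt \<UU> U)) (opp (Cpt \<UU> U)) id_ftor (D \<circ>\<^sub>F D') \<kappa>" using D_units by blast
  have kiso: "is_iso U (fo D (fo D' Y)) Y (\<kappa> Y)" if "cU Y" for Y
    using nat_isoD(1)[OF kap, of Y] that unfolding is_iso_def by auto
  have DDo: "fo D (fo D' Y) \<in> Obj U" "Y \<in> Obj U" "cT (fo D' Y)" "fo D' Y \<in> Obj T" if "cU Y" for Y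
    using D_obj compact_objs that by auto
  have ka: "\<kappa> Y \<in> arrows U" "Dom U (\<kappa> Y) = fo D (fo D' Y)" "Cod U (\<kappa> Y) = Y" if "cU Y" for Y
    using U.isoE[OF kiso[OF that] DDo(1,2)[OF that]] by blast+
  have knat: "k \<cdot>\<^bsub>U\<^esub> \<kappa> Y = \<kappa> Y' \<cdot>\<^bsub>U\<^esub> fm D (fm D' k)" if "cU Y" "cU Y'" "k \<in> maps U Y Y'" for Y Y' k
    using nat_isoD(3)[OF kap, of Y' Y k] that by simp
  have Kb: "bij_betw (\<lambda>u. \<kappa> Y \<cdot>\<^bsub>U\<^esub> fm D u) {u \<in> maps T (fo D' Y) A. f \<cdot>\<^bsub>T\<^esub> u = \<one>\<^bsub>Hom T (fo D' Y) B\<^esub>}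
       {v \<in> maps U (fo D A) Y. v \<cdot>\<^bsub>U\<^esub> fm D f = \<one>\<^bsub>Hom U (fo D B) Y\<^esub>}" (is "bij_betw _ ?K ?L") if Y: "cU Y" for Y
  proof (rule bij_betw_imageI)
    note d = DDo[OF Y] and k = ka[OF Y]
    have Du: "fm D u \<in> arrows U" "Dom U (fm D u) = fo D A" "Cod U (fm D u) = fo D (fo D' Y)" if "u \<in> maps T (fo D' Y) A" for u
      using D_maps[OF d(3) c(1) that] by blast+
    show "inj_on (\<lambda>u. \<kappa> Y \<cdot>\<^bsub>U\<^esub> fm D u) ?K"
    proof (rule inj_onI)
      fix u v assume uv: "u \<in> ?K" "v \<in> ?K" "\<kappa> Y \<cdot>\<^bsub>U\<^esub> fm D u = \<kappa> Y \<cdot>\<^bsub>U\<^esub> fm D v"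
      have "fm D u \<in> maps U (fo D A) (fo D (fo D' Y))" "fm D v \<in> maps U (fo D A) (fo D (fo D' Y))"
        using Du[of u] Du[of v] uv d DAB by auto
      then have "fm D u = fm D v" using U.iso_cancel_left[OF kiso[OF Y] d(1,2) _ _ uv(3) DAB(1)] by blast
      then show "u = v" by (rule D_faithful[OF d(3) c(1), rotated 2]) (use uv in blast)+
    qed
    show "(\<lambda>u. \<kappa> Y \<cdot>\<^bsub>U\<^esub> fm D u) ` ?K = ?L"
    proof (intro equalityI subsetI)
      fix v assume "v \<in> (\<lambda>u. \<kappa> Y \<cdot>\<^bsub>U\<^esub> fm D u) ` ?K"
      then obtain u where u: "u \<in> maps T (fo D' Y) A" "f \<cdot>\<^bsub>T\<^esub> u = \<one>\<^bsub>Hom T (fo D' Y) B\<^esub>" "v = \<kappa> Y \<cdot>\<^bsub>U\<^esub> fm D u" by blast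
      have "v \<cdot>\<^bsub>U\<^esub> fm D f = \<kappa> Y \<cdot>\<^bsub>U\<^esub> (fm D u \<cdot>\<^bsub>U\<^esub> fm D f)"
        unfolding u(3) using k Du[OF u(1)] Df by (simp add: U.assoc)
      also have "\<dots> = \<one>\<^bsub>Hom U (fo D B) Y\<^esub>"
        using D_comp_zero_iff[OF d(3) c u(1) fm'] u(2) k d DAB by simp
      finally show "v \<in> ?L" using u(3) k Du[OF u(1)] DAB d by simp
    next
      fix v assume "v \<in> ?L"
      then have v: "v \<in> arrows U" "Dom U v = fo D A" "Cod U v = Y" "v \<cdot>\<^bsub>U\<^esub> fm D f = \<one>\<^bsub>Hom U (fo D B) Y\<^esub>"
        using DAB d by auto
      obtain t where t: "t \<in> arrows U" "Dom U t = Y" "Cod U t = fo D (fo D' Y)" "\<kappa> Y \<cdot>\<^bsub>U\<^esub> t = Idt U Y"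
        using U.isoE[OF kiso[OF Y] d(1,2)] by blast
      have "t \<cdot>\<^bsub>U\<^esub> v \<in> maps U (fo D A) (fo D (fo D' Y))" using t v DAB d by simp
      then obtain u where u: "u \<in> maps T (fo D' Y) A" "fm D u = t \<cdot>\<^bsub>U\<^esub> v"
        by (rule D_full[OF d(3) c(1)])
      have "\<kappa> Y \<cdot>\<^bsub>U\<^esub> fm D u = (\<kappa> Y \<cdot>\<^bsub>U\<^esub> t) \<cdot>\<^bsub>U\<^esub> v" unfolding u(2) using t(1-3) v(1-3) k by (simp add: U.assoc)
      then have kv: "v = \<kappa> Y \<cdot>\<^bsub>U\<^esub> fm D u" using t v by simp
      have "fm D u \<cdot>\<^bsub>U\<^esub> fm D f = t \<cdot>\<^bsub>U\<^esub> (v \<cdot>\<^bsub>U\<^esub> fm D f)" unfolding u(2) using t(1-3) v(1-3) Df by (simp add: U.assoc)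
      also have "\<dots> = \<one>\<^bsub>Hom U (fo D B) (fo D (fo D' Y))\<^esub>" unfolding v(4) using t DAB by simp
      finally have "f \<cdot>\<^bsub>T\<^esub> u = \<one>\<^bsub>Hom T (fo D' Y) B\<^esub>" using D_comp_zero_iff[OF d(3) c u(1) fm'] by blast
      then show "v \<in> (\<lambda>u. \<kappa> Y \<cdot>\<^bsub>U\<^esub> fm D u) ` ?K" using u(1) kv by blast
    qed
  qed
  define \<nu> where "\<nu> Y \<eta> = \<kappa> Y \<cdot>\<^bsub>U\<^esub> fm D (\<eta> A \<gamma>)" for Y and \<eta> :: "'o \<Rightarrow> _ \<Rightarrow> 'm"
  let ?N = "\<lambda>Y. nat_group (Cpt \<UU> T) G (corep T (fo D' Y))"
  have val: "\<eta> A \<gamma> \<in> maps T (fo D' Y) A" if "cU Y" "\<eta> \<in> carrier (?N Y)" for Y \<eta>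
    using bij_betw_imp_surj_on[OF bij[of "fo D' Y"]] DDo(3)[OF that(1)] that(2) by blast
  have nubij: "bij_betw (\<nu> Y) (carrier (?N Y)) (carrier (ao (U.hom_kernel (fm D f)) Y))" if Y: "cU Y" for Y
  proof -
    have "fo D' Y \<in> {C. cT C}" using DDo(3)[OF Y] by simp
    from bij_betw_trans[OF bij[OF this] Kb[OF Y]] show ?thesis
      unfolding \<nu>_def U.hom_kernel_def Df by (simp add: o_def)
  qed
  have nuhom: "\<nu> Y \<in> hom (?N Y) (ao (U.hom_kernel (fm D f)) Y)" if Y: "cU Y" for Y
  proof (rule homI)
    fix \<eta> \<theta> assume e: "\<eta> \<in> carrier (?N Y)" "\<theta> \<in> carrier (?N Y)"
    show "\<nu> Y \<eta> \<in> carrier (ao (U.hom_kernel (fm D f)) Y)" using nubij[OF Y] e(1) unfolding bij_betw_def by blast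
    note d = DDo[OF Y] and k = ka[OF Y]
    have "(\<eta> \<otimes>\<^bsub>?N Y\<^esub> \<theta>) A \<gamma> = \<eta> A \<gamma> \<otimes>\<^bsub>Hom T (fo D' Y) A\<^esub> \<theta> A \<gamma>"
      using g c by (simp add: nat_group_def corep_def)
    \<comment> \<open>Additivity of \<open>D\<close> is what makes \<nu> a homomorphism.\<close>
    then have "\<nu> Y (\<eta> \<otimes>\<^bsub>?N Y\<^esub> \<theta>) = \<kappa> Y \<cdot>\<^bsub>U\<^esub> (fm D (\<eta> A \<gamma>) \<otimes>\<^bsub>Hom U (fo D A) (fo D (fo D' Y))\<^esub> fm D (\<theta> A \<gamma>))"
      unfolding \<nu>_def using D_add[OF d(3) c(1) val[OF Y e(1)] val[OF Y e(2)]] by simp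
    also have "\<dots> = \<nu> Y \<eta> \<otimes>\<^bsub>Hom U (fo D A) Y\<^esub> \<nu> Y \<theta>" unfolding \<nu>_def
      using k D_maps[OF d(3) c(1) val[OF Y e(1)]] D_maps[OF d(3) c(1) val[OF Y e(2)]]
      by (simp add: U.comp_distrib2)
    finally show "\<nu> Y (\<eta> \<otimes>\<^bsub>?N Y\<^esub> \<theta>) = \<nu> Y \<eta> \<otimes>\<^bsub>ao (U.hom_kernel (fm D f)) Y\<^esub> \<nu> Y \<theta>"
      by (simp add: U.hom_kernel_def Df)
  qed
  have nunat: "\<nu> Y' (am (delta \<UU> T D' G) k \<eta>) = am (U.hom_kernel (fm D f)) k (\<nu> Y \<eta>)"
    if Y: "cU Y" "cU Y'" "k \<in> maps U Y Y'" and e: "\<eta> \<in> carrier (?N Y)" for Y Y' k \<eta>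
  proof -
    note d = DDo[OF Y(1)] DDo[OF Y(2)]
    have D'k: "fm D' k \<in> maps T (fo D' Y') (fo D' Y)" using D'_maps[OF Y] d by simp
    have k: "k \<in> arrows U" "Dom U k = Y" "Cod U k = Y'" using Y(3) d by auto
    note dm = D_maps[OF d(3) c(1) val[OF Y(1) e]] and dk = D_maps[OF d(7,3) D'k]
    have "(am (delta \<UU> T D' G) k \<eta>) A \<gamma> = \<eta> A \<gamma> \<cdot>\<^bsub>T\<^esub> fm D' k"
      using g c by (simp add: delta_def)
    then have "\<nu> Y' (am (delta \<UU> T D' G) k \<eta>) = \<kappa> Y' \<cdot>\<^bsub>U\<^esub> (fm D (fm D' k) \<cdot>\<^bsub>U\<^esub> fm D (\<eta> A \<gamma>))"
      unfolding \<nu>_def using D_comp[OF d(7,3) c(1) D'k val[OF Y(1) e]] by simp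
    also have "\<dots> = (\<kappa> Y' \<cdot>\<^bsub>U\<^esub> fm D (fm D' k)) \<cdot>\<^bsub>U\<^esub> fm D (\<eta> A \<gamma>)"
      using dm dk ka[OF Y(2)] by (simp add: U.assoc)
    also have "\<dots> = k \<cdot>\<^bsub>U\<^esub> \<nu> Y \<eta>" unfolding knat[OF Y, symmetric] \<nu>_def
      using dm k ka[OF Y(1)] by (simp add: U.assoc)
    finally show ?thesis by (simp add: U.hom_kernel_def)
  qed
  have ad: "ao (delta \<UU> T D' G) Y = ?N Y" for Y by (simp add: delta_def)
  show ?thesis unfolding ab_isomorphic_def is_ab_nat_def
    by (rule exI[of _ \<nu>]) (use nuhom nubij nunat in \<open>auto simp: ad iso_def simp del: U.maps_iff\<close>)
qed

text \<open>Comparing two presentations of \<delta> G involves inverting an isomorphism that starts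
  at \<delta> G, and this closure is what the inversion asks for.\<close>

lemma delta_closed:
  assumes G: "is_ab_functor (Cpt \<UU> T) G"
  shows "ab_closed (Cpt \<UU> U) (delta \<UU> T D' G)"
proof -
  interpret CT: preadditive_category "Cpt \<UU> T" by (rule T.preadditive_Cpt)
  note cl = CT.nat_group_corep_closed[OF G, unfolded corep_Cpt Cpt_sel mem_Collect_eq]
  show ?thesis unfolding ab_closed_def Cpt_sel
  proof (intro conjI ballI)
    fix Y \<eta> \<theta> assume "Y \<in> {C. cU C}" "\<eta> \<in> carrier (ao (delta \<UU> T D' G) Y)" "\<theta> \<in> carrier (ao (delta \<UU> T D' G) Y)"
    then show "\<eta> \<otimes>\<^bsub>ao (delta \<UU> T D' G) Y\<^esub> \<theta> \<in> carrier (ao (delta \<UU> T D' G) Y)"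
      using cl(1)[OF D_obj(2)] by (simp add: delta_def)
  next
    fix Y Y' k \<eta> assume o: "Y \<in> {C. cU C}" "Y' \<in> {C. cU C}" "k \<in> maps U Y Y'" "\<eta> \<in> carrier (ao (delta \<UU> T D' G) Y)"
    have "fm D' k \<in> maps T (fo D' Y') (fo D' Y)"
      using D'_maps[of Y Y' k] o compact_obj[OF D_obj(2)[of Y]] compact_obj[OF D_obj(2)[of Y']] by simp
    then show "am (delta \<UU> T D' G) k \<eta> \<in> carrier (ao (delta \<UU> T D' G) Y')"
      using cl(2)[OF D_obj(2)[of Y], of \<eta> "fm D' k" "fo D' Y'"] o D_obj(2)[of Y'] by (simp add: delta_def)
  qed
qed

text \<open>In the triangle \<open>D B \<rightarrow> D A \<rightarrow> K \<rightarrow> \<Sigma> (D B)\<close> over \<open>D f\<close> the last arrow presents \<open>\<delta> G\<close>, because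
  \<open>\<delta> G\<close> is the kernel of \<open>Hom(D f, -)\<close>.\<close>

lemma delta_presented:
  assumes f: "presents \<UU> T f G" and G: "is_ab_functor (Cpt \<UU> T) G"
  obtains h where "presents \<UU> U h (delta \<UU> T D' G)"
    and "\<And>Y. Y \<in> Obj U \<Longrightarrow> U.hom_surj h Y \<longleftrightarrow> U.hom_inj (fm D f) Y"
proof -
  define A B where AB: "A = Dom T f" "B = Cod T f"
  have fa: "f \<in> arrows (Cpt \<UU> T)" using f unfolding presents_def by blast
  then have f': "f \<in> arrows T" "Dom T f = A" "Cod T f = B" and c: "cT A" "cT B"
    by (simp_all add: T.arrows_Cpt AB)
  have fm': "f \<in> maps T A B" using f' c compact_objs by simp
  note Df = D_maps[OF c fm']
  have DAB: "fo D A \<in> Obj U" "fo D B \<in> Obj U" using D_obj c compact_objs by auto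
  have "fm D f \<in> maps U (fo D B) (fo D A)" using Df DAB by simp
  from U.tri_cone[OF DAB(2,1) this]
  obtain K g h where t: "Tri U (fo D B) (fo D A) K (fm D f) g h" by blast
  note d = U.triD[OF t] and t2 = U.tri_rotated[OF t]
  \<comment> \<open>A presentation must be an arrow of the category of compact objects, so both ends
    of \<open>h\<close> have to be compact.\<close>
  have sB: "cU (sus U (fo D B))" by (rule U.compact_sus[OF D_obj(1)[OF c(2)]])
  have K: "cU K" by (rule U.compact_cone[OF t D_obj(1)[OF c(1)] sB])
  have ha: "h \<in> arrows (Cpt \<UU> U)" unfolding U.arrows_Cpt using d K sB by simp
  have z: "g \<cdot>\<^bsub>U\<^esub> fm D f = \<one>\<^bsub>Hom U (fo D B) K\<^esub>" "h \<cdot>\<^bsub>U\<^esub> g = \<one>\<^bsub>Hom U (fo D A) (sus U (fo D B))\<^esub>"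
    using U.tri_comp_zero[OF t] U.tri_comp_zero[OF t2] by auto
  have "ab_isomorphic (full_subcategory U {C. cU C}) (coker U h) (U.hom_kernel (fm D f))"
  proof (rule U.coker_iso_hom_kernel[of "fm D f" g h])
    show "fm D f \<in> arrows U" "g \<in> arrows U" "h \<in> arrows U" "Cod U (fm D f) = Dom U g" "Cod U g = Dom U h"
      using d by simp_all
    show "{C. cU C} \<subseteq> Obj U" using compact_objs by auto
    show "g \<cdot>\<^bsub>U\<^esub> fm D f = \<one>\<^bsub>Hom U (Dom U (fm D f)) (Cod U g)\<^esub>" "h \<cdot>\<^bsub>U\<^esub> g = \<one>\<^bsub>Hom U (Dom U g) (Cod U h)\<^esub>"
      using z d by simp_all
    show "\<exists>w\<in>maps U (Cod U g) X. v = w \<cdot>\<^bsub>U\<^esub> g"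
      if "X \<in> {C. cU C}" "v \<in> maps U (Dom U g) X" "v \<cdot>\<^bsub>U\<^esub> fm D f = \<one>\<^bsub>Hom U (Dom U (fm D f)) X\<^esub>" for X v
      using U.tri_factor[OF t, of v X] that compact_objs(2)[of X] unfolding d by blast
    show "\<exists>w\<in>maps U (Cod U h) X. v = w \<cdot>\<^bsub>U\<^esub> h"
      if "X \<in> {C. cU C}" "v \<in> maps U (Dom U h) X" "v \<cdot>\<^bsub>U\<^esub> g = \<one>\<^bsub>Hom U (Dom U g) X\<^esub>" for X v
      using U.tri_factor[OF t2, of v X] that compact_objs(2)[of X] unfolding d by blast
  qed
  then have hk: "ab_isomorphic (Cpt \<UU> U) (coker U h) (U.hom_kernel (fm D f))" unfolding Cpt_def .
  have "ab_closed (Cpt \<UU> U) (coker U h)"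
    using ab_functor_closed preadditive_category.coker_functor[OF U.preadditive_Cpt ha] unfolding coker_Cpt by blast
  from ab_isomorphic_trans[OF delta_iso_kernel[OF f G] ab_isomorphic_sym[OF this hk]]
  have p: "presents \<UU> U h (delta \<UU> T D' G)" unfolding presents_def using ha by blast
  \<comment> \<open>For every object \<open>Y\<close>, compact or not, exactness of Hom(-, Y) along
    the triangle makes both conditions say that each arrow from \<open>K\<close> to \<open>Y\<close>
    becomes zero after composition with \<open>g\<close>.\<close>
  have "U.hom_surj h Y \<longleftrightarrow> U.hom_inj (fm D f) Y" if Y: "Y \<in> Obj U" for Y
  proof
    assume s: "U.hom_surj h Y"
    show "U.hom_inj (fm D f) Y" unfolding U.hom_inj_def Df
    proof (intro ballI impI)
      fix v assume v: "v \<in> maps U (fo D A) Y" "v \<cdot>\<^bsub>U\<^esub> fm D f = \<one>\<^bsub>Hom U (fo D B) Y\<^esub>"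
      obtain w where w: "w \<in> maps U K Y" "v = w \<cdot>\<^bsub>U\<^esub> g" using U.tri_factor[OF t v(1) Y v(2)] by blast
      obtain r where r: "r \<in> maps U (sus U (fo D B)) Y" "w = r \<cdot>\<^bsub>U\<^esub> h"
        using s w(1) unfolding U.hom_surj_def d by blast
      have "v = r \<cdot>\<^bsub>U\<^esub> (h \<cdot>\<^bsub>U\<^esub> g)" unfolding w(2) r(2) using r(1) d Y sB compact_objs by (simp add: U.assoc)
      then show "v = \<one>\<^bsub>Hom U (fo D A) Y\<^esub>" unfolding z(2) using r(1) d Y by simp
    qed
  next
    assume i: "U.hom_inj (fm D f) Y"
    show "U.hom_surj h Y" unfolding U.hom_surj_def d
    proof
      fix w assume w: "w \<in> maps U K Y"
      have w': "w \<in> arrows U" "Dom U w = K" "Cod U w = Y" using w d Y by auto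
      have wg: "w \<cdot>\<^bsub>U\<^esub> g \<in> maps U (fo D A) Y" using w' d Y by simp
      have "(w \<cdot>\<^bsub>U\<^esub> g) \<cdot>\<^bsub>U\<^esub> fm D f = w \<cdot>\<^bsub>U\<^esub> (g \<cdot>\<^bsub>U\<^esub> fm D f)" using w' d by (simp add: U.assoc)
      also have "\<dots> = \<one>\<^bsub>Hom U (fo D B) Y\<^esub>" unfolding z(1) using w' DAB by simp
      finally have "w \<cdot>\<^bsub>U\<^esub> g = \<one>\<^bsub>Hom U (fo D A) Y\<^esub>" using i wg unfolding U.hom_inj_def Df by blast
      then show "\<exists>r\<in>maps U (sus U (fo D B)) Y. w = r \<cdot>\<^bsub>U\<^esub> h" using U.tri_factor[OF t2 w Y] by blast
    qed
  qed
  then show thesis using that p by blast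
qed

text \<open>Replaces the functors in the definition of the dual by arrows: cokernels realise every
  arrow that is surjective on \<D>, and a presentation of an annihilated functor is such an
  arrow.\<close>

lemma dual_definable_iff:
  assumes sub: "\<D> \<subseteq> Obj T"
  shows "Y \<in> dual_definable \<UU> T U D' \<D> \<longleftrightarrow> Y \<in> Obj U \<and>
    (\<forall>f\<in>arrows (Cpt \<UU> T). (\<forall>X\<in>\<D>. T.hom_surj f X) \<longrightarrow> U.hom_inj (fm D f) Y)"
proof -
  have key: "trivial_group (ao (fp_ext \<UU> U (delta \<UU> T D' G)) Y) \<longleftrightarrow> U.hom_inj (fm D f) Y"
    if fG: "presents \<UU> T f G" "is_ab_functor (Cpt \<UU> T) G" and Y: "Y \<in> Obj U" for f and G :: "('o, 'm, 'm set) abftor"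
  proof -
    obtain h where h: "presents \<UU> U h (delta \<UU> T D' G)" "U.hom_surj h Y \<longleftrightarrow> U.hom_inj (fm D f) Y"
      using delta_presented[OF fG] Y by blast
    show ?thesis using U.trivial_fp_ext_iff[OF h(1) delta_closed[OF fG(2)] Y] h(2) by simp
  qed
  show ?thesis
  proof (intro iffI conjI ballI impI)
    assume Y: "Y \<in> dual_definable \<UU> T U D' \<D>"
    then show Yo: "Y \<in> Obj U" unfolding dual_definable_def by blast
    fix f assume f: "f \<in> arrows (Cpt \<UU> T)" "\<forall>X\<in>\<D>. T.hom_surj f X"
    note ca = T.coker_annihilated[OF f(1) sub]
    have "trivial_group (ao (fp_ext \<UU> U (delta \<UU> T D' (coker T f))) Y)"
      using Y ca(1) f(2) unfolding dual_definable_def by blast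
    then show "U.hom_inj (fm D f) Y" using key[OF ca(2,3) Yo] f(2) by blast
  next
    assume Y: "Y \<in> Obj U \<and> (\<forall>f\<in>arrows (Cpt \<UU> T). (\<forall>X\<in>\<D>. T.hom_surj f X) \<longrightarrow> U.hom_inj (fm D f) Y)"
    have "trivial_group (ao (fp_ext \<UU> U (delta \<UU> T D' G)) Y)" if G: "G \<in> annihilated \<UU> T \<D>" for G
    proof -
      obtain f where f: "presents \<UU> T f G" "is_ab_functor (Cpt \<UU> T) G" "\<And>X. X \<in> \<D> \<Longrightarrow> T.hom_surj f X"
        using T.annihilated_presented[OF G sub] by blast
      then have "f \<in> arrows (Cpt \<UU> T)" unfolding presents_def by blast
      then show ?thesis using key[OF f(1,2)] Y f(3) by blast
    qed
    then show "Y \<in> dual_definable \<UU> T U D' \<D>" unfolding dual_definable_def using Y by blast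
  qed
qed

section \<open>Comparison of a definable class with its dual\<close>

lemma Q_hom_surj:
  assumes "X \<in> Obj T" "f \<in> arrows (Cpt \<UU> T)"
  shows "T.hom_surj f X \<longleftrightarrow> U.hom_inj (fm D f) (fo Q X)"
  by (rule AGJ_hom_surj_inj(1)[OF T.preadditive_category_axioms U.preadditive_category_axioms theta(1) Q_functor(1) D_functor(1) assms])

text \<open>The isomorphisms \<theta> for \<open>U\<close>, taken at the arrow \<open>D f\<close>,
  speak about D' (D f). The unit of the equivalence identifies this arrow with
  \<open>f\<close>.\<close>

lemma Q'_hom_surj:
  assumes Y: "Y \<in> Obj U" and f: "f \<in> arrows (Cpt \<UU> T)"
  shows "T.hom_surj f (fo Q' Y) \<longleftrightarrow> U.hom_inj (fm D f) Y"
proof -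
  define A B where AB: "A = Dom T f" "B = Cod T f"
  have f': "f \<in> arrows T" "Dom T f = A" "Cod T f = B" and c: "cT A" "cT B"
    using f by (simp_all add: T.arrows_Cpt AB)
  have o: "A \<in> Obj T" "B \<in> Obj T" using c compact_objs by auto
  have fm': "f \<in> maps T A B" using f' o by simp
  note Df = D_maps[OF c fm'] and Dc = D_obj(1)[OF c(1)] D_obj(1)[OF c(2)]
  have Da: "fm D f \<in> arrows (Cpt \<UU> U)" unfolding U.arrows_Cpt Df using Dc Df by simp
  have Dm: "fm D f \<in> maps U (fo D B) (fo D A)" using Df Dc compact_objs by simp
  have D'f: "fm D' (fm D f) \<in> maps T (fo D' (fo D A)) (fo D' (fo D B))"
    using D'_maps[OF Dc(2,1) Dm] D_obj(2)[OF Dc(1)] D_obj(2)[OF Dc(2)] compact_objs by simp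
  obtain \<eta> where eta: "is_nat_iso (Cpt \<UU> T) (Cpt \<UU> T) id_ftor (D' \<circ>\<^sub>F D) \<eta>" using D_units by blast
  have ei: "is_iso T C (fo D' (fo D C)) (\<eta> C)" if "cT C" for C
    using nat_isoD(1)[OF eta, of C] that unfolding is_iso_def by simp
  have en: "\<eta> B \<cdot>\<^bsub>T\<^esub> f = fm D' (fm D f) \<cdot>\<^bsub>T\<^esub> \<eta> A" using nat_isoD(3)[OF eta, of A B f] c fm' by simp
  have "T.hom_surj f (fo Q' Y) \<longleftrightarrow> T.hom_surj (fm D' (fm D f)) (fo Q' Y)"
    by (rule T.hom_surj_iso_arrow[OF ei[OF c(1)] o(1) _ ei[OF c(2)] o(2) _ fm' D'f en Q_obj(2)[OF Y]])
      (use D_obj c compact_objs in blast)+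
  also have "\<dots> \<longleftrightarrow> U.hom_inj (fm D f) Y"
    by (rule AGJ_hom_surj_inj(2)[OF U.preadditive_category_axioms T.preadditive_category_axioms theta(2) Q_functor(2) D'_functor Y Da, symmetric])
  finally show ?thesis .
qed

text \<open>The arrows in \<Phi> are surjective on \<D>, hence are among the tests that define the
  dual. So the tests on Q X include the defining conditions of \<open>X\<close>, and conversely a
  member \<open>X\<close> of \<D> passes all tests because these are surjective on \<D>. The same
  reasoning applies to Q' Y. Closure under isomorphism and zero objects is what the transfer of
  triangulated subcategories asks for in addition.\<close>

lemma definable_dual_iff:
  assumes "definable \<UU> T \<D>"
  shows "\<D> \<subseteq> Obj T" and "X \<in> Obj T \<Longrightarrow> X \<in> \<D> \<longleftrightarrow> fo Q X \<in> dual_definable \<UU> T U D' \<D>"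
    and "Y \<in> Obj U \<Longrightarrow> Y \<in> dual_definable \<UU> T U D' \<D> \<longleftrightarrow> fo Q' Y \<in> \<D>"
    and "\<lbrakk>is_iso T X X' a; X \<in> Obj T; X' \<in> Obj T; X \<in> \<D>\<rbrakk> \<Longrightarrow> X' \<in> \<D>"
    and "zero_object T Z \<Longrightarrow> Z \<in> \<D>"
    and "\<lbrakk>is_iso U Y Y' b; Y \<in> Obj U; Y' \<in> Obj U; Y \<in> dual_definable \<UU> T U D' \<D>\<rbrakk> \<Longrightarrow> Y' \<in> dual_definable \<UU> T U D' \<D>"
    and "zero_object U W \<Longrightarrow> W \<in> dual_definable \<UU> T U D' \<D>"
proof -
  obtain \<Phi> where Phi: "\<Phi> \<subseteq> arrows (Cpt \<UU> T)"
    and D0: "\<D> = {X \<in> Obj T. \<forall>f\<in>\<Phi>. (\<lambda>u. u \<cdot>\<^bsub>T\<^esub> f) ` maps T (Cod T f) X = maps T (Dom T f) X}"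
    using assms unfolding definable_def by blast
  have a: "f \<in> arrows T" if "f \<in> \<Phi>" for f using Phi that unfolding subset_iff T.arrows_Cpt by blast
  have D: "X \<in> \<D> \<longleftrightarrow> X \<in> Obj T \<and> (\<forall>f\<in>\<Phi>. T.hom_surj f X)" for X
    unfolding D0 using T.hom_surj_iff[OF a] by auto
  show sub: "\<D> \<subseteq> Obj T" using D by blast
  show "X \<in> \<D> \<longleftrightarrow> fo Q X \<in> dual_definable \<UU> T U D' \<D>" if X: "X \<in> Obj T" for X
    unfolding dual_definable_iff[OF sub] using D Phi Q_hom_surj[OF X] Q_obj(1)[OF X] X by blast
  show "Y \<in> dual_definable \<UU> T U D' \<D> \<longleftrightarrow> fo Q' Y \<in> \<D>" if Y: "Y \<in> Obj U" for Y
    unfolding dual_definable_iff[OF sub] using D Phi Q'_hom_surj[OF Y] Q_obj(2)[OF Y] Y by blast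
  show "\<lbrakk>is_iso T X X' a; X \<in> Obj T; X' \<in> Obj T; X \<in> \<D>\<rbrakk> \<Longrightarrow> X' \<in> \<D>"
    unfolding D using T.hom_surj_iso a by blast
  show "zero_object T Z \<Longrightarrow> Z \<in> \<D>"
    unfolding D using T.zero_object_hom_surj a unfolding zero_object_def by blast
  have Da: "fm D f \<in> arrows U" if "f \<in> arrows (Cpt \<UU> T)" for f
  proof -
    have c: "cT (Dom T f)" "cT (Cod T f)" and "f \<in> arrows T" using that unfolding T.arrows_Cpt by blast+
    then show ?thesis using D_maps(1)[OF c] compact_objs by simp
  qed
  show "\<lbrakk>is_iso U Y Y' b; Y \<in> Obj U; Y' \<in> Obj U; Y \<in> dual_definable \<UU> T U D' \<D>\<rbrakk> \<Longrightarrow> Y' \<in> dual_definable \<UU> T U D' \<D>"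
    unfolding dual_definable_iff[OF sub] using U.hom_inj_iso Da by blast
  show "zero_object U W \<Longrightarrow> W \<in> dual_definable \<UU> T U D' \<D>"
    unfolding dual_definable_iff[OF sub] using U.zero_object_hom_inj Da unfolding zero_object_def by blast
qed

end

theorem corollary6p20:
  fixes T :: "('o, 'm) tcat" and U :: "('p, 'n) tcat"
    and Q :: "('o, 'm, 'p, 'n) ftor" and Q' :: "('p, 'n, 'o, 'm) ftor"
    and D :: "('o, 'm, 'p, 'n) ftor" and D' :: "('p, 'n, 'o, 'm) ftor"
    and \<D> :: "'o set"
  assumes "grothendieck_universe TYPE('u)"
    and "AGJ_duality_triple TYPE('u) T U Q Q' D D'"
    and "definable TYPE('u) T \<D>"
  shows "(extension_closed T \<D> \<longleftrightarrow> extension_closed U (dual_definable TYPE('u) T U D' \<D>)) \<and>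
         (triangulated_subcategory T \<D> \<longleftrightarrow>
          triangulated_subcategory U (dual_definable TYPE('u) T U D' \<D>))"
proof -
  interpret AGJ_duality "TYPE('u)" T U Q Q' D D' by (rule AGJ_duality.intro) fact
  let ?E = "dual_definable TYPE('u) T U D' \<D>"
  note d = definable_dual_iff[OF assms(3)]
  have E: "?E \<subseteq> Obj U" unfolding dual_definable_def by blast
  \<comment> \<open>The dual plays the part of \<E> for \<open>Q\<close>, and \<D> plays it for
    \<open>Q'\<close>.\<close>
  have "extension_closed U ?E \<Longrightarrow> extension_closed T \<D>"
    by (rule extension_closed_transfer[OF Q_exact(1) _ d(2)]) (use T.tri_closed in blast)+
  moreover have "extension_closed T \<D> \<Longrightarrow> extension_closed U ?E"
    by (rule extension_closed_transfer[OF Q_exact(2) _ d(3)]) (use U.tri_closed in blast)+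
  moreover have "triangulated_subcategory U ?E \<Longrightarrow> triangulated_subcategory T \<D>"
    by (rule triangulated_subcategory_transfer[OF T.triangulated_category_axioms U.triangulated_category_axioms
          Q_exact(1) d(1,2,6,5)])
  moreover have "triangulated_subcategory T \<D> \<Longrightarrow> triangulated_subcategory U ?E"
    by (rule triangulated_subcategory_transfer[OF U.triangulated_category_axioms T.triangulated_category_axioms
          Q_exact(2) E d(3,4,7)])
  ultimately show ?thesis by blast
qed

end
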